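(* Let $T^3-AT+B$ be in standard form with function field $\mathcal{F}$, and let $I$ be the index of $y$. If the place at infinity of $\mathbb{F}_q(x)$ is totally ramified in $\mathcal{F}$, then the genus of $\mathcal{F}$ is $g=\deg B-\deg I-1$.
   Context: $q$ is a power of $3$. $A,B\in\mathbb{F}_q[x]$, $A\neq 0$, and $T^3-AT+B\in\mathbb{F}_q[x,T]$ is absolutely irreducible; $\mathcal{F}=\mathbb{F}_q(x,y)$ with $y^3-Ay+B=0$, and $\mathcal{O}_{\mathcal{F}}$ is the integral closure of $\mathbb{F}_q[x]$ in $\mathcal{F}$. The place at infinity of $\mathbb{F}_q(x)$ is the one with uniformizer $1/x$. The polynomial $T^3-AT+B$ is in standard form if (a) there are no non-constant $Q\in\mathbb{F}_q[x]$ and $i\in\mathbb{F}_q[x]$ with $Q^2\mid A$ and $Q^3\mid i^3-iA+B$, and (b) either $3\nmid\deg B$ and $2\deg B>3\deg A$, or $2\deg B\le 3\deg A$. The index $I\in\mathbb{F}_q[x]$ of $y$ (defined up to a nonzero constant) satisfies $\mathrm{disc}(1,y,y^2)=A^3=I^2\,\mathrm{disc}(\mathcal{F})$, where $\mathrm{disc}(\mathcal{F})$ is the discriminant of an $\mathbb{F}_q[x]$-basis of $\mathcal{O}_{\mathcal{F}}$. *)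

theory Defs
  imports
    "HOL-Algebra.Algebraic_Closure_Type"
    "HOL-Analysis.Determinants"
    "HOL-Computational_Algebra.Computational_Algebra"
begin

section \<open>Field extensions given by an embedding\<close>

text \<open>
  An extension of fields is a type \<open>'f\<close> of class \<open>field\<close> together with an embedding of the
  base field into \<open>'f\<close>; the extension field is the whole type \<open>'f\<close>.
\<close>

definition field_hom :: "('a :: field \<Rightarrow> 'b :: field) \<Rightarrow> bool" where
  "field_hom \<iota> \<longleftrightarrow> \<iota> 1 = 1 \<and> (\<forall>a b. \<iota> (a + b) = \<iota> a + \<iota> b) \<and> (\<forall>a b. \<iota> (a * b) = \<iota> a * \<iota> b)"

definition scale_by :: "('a :: field \<Rightarrow> 'f :: field) \<Rightarrow> 'a \<Rightarrow> 'f \<Rightarrow> 'f" where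
  "scale_by \<iota> a z = \<iota> a * z"

definition ext_degree :: "('a :: field \<Rightarrow> 'f :: field) \<Rightarrow> nat" where
  "ext_degree \<iota> = vector_space.dim (scale_by \<iota>) UNIV"

definition generated_by :: "('a :: field \<Rightarrow> 'f :: field) \<Rightarrow> 'f \<Rightarrow> bool" where
  "generated_by \<iota> y \<longleftrightarrow> (\<forall>z. \<exists>p q :: 'a poly.
     poly (map_poly \<iota> q) y \<noteq> 0 \<and> z = poly (map_poly \<iota> p) y / poly (map_poly \<iota> q) y)"

text \<open>
  The trace of multiplication by \<open>z\<close>; it does not depend on the basis chosen by \<open>SOME\<close>.
\<close>

definition field_trace :: "('a :: field \<Rightarrow> 'f :: field) \<Rightarrow> 'f \<Rightarrow> 'a" where
  "field_trace \<iota> z =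
     (let B = (SOME B. module.independent (scale_by \<iota>) B \<and> module.span (scale_by \<iota>) B = UNIV)
      in \<Sum>b\<in>B. module.representation (scale_by \<iota>) B (z * b) b)"

definition discriminant :: "('a :: field \<Rightarrow> 'f :: field) \<Rightarrow> 'f ^ 'n \<Rightarrow> 'a" where
  "discriminant \<iota> b = det (\<chi> i j. field_trace \<iota> (b $ i * b $ j))"


section \<open>Places, divisors and the genus of a function field\<close>

text \<open>
  Here \<open>\<kappa>\<close> embeds the field of constants into the function field. Places are represented by
  their valuation rings \<open>R\<close>; the place itself is the maximal ideal of \<open>R\<close>.
\<close>

definition valuation_ring :: "('k :: field \<Rightarrow> 'f :: field) \<Rightarrow> 'f set \<Rightarrow> bool" where
  "valuation_ring \<kappa> R \<longleftrightarrow>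
     range \<kappa> \<subset> R \<and> R \<subset> UNIV \<and> (\<forall>a\<in>R. \<forall>b\<in>R. a - b \<in> R \<and> a * b \<in> R) \<and>
     (\<forall>z. z \<in> R \<or> inverse z \<in> R)"

definition max_ideal :: "'f :: field set \<Rightarrow> 'f set" where
  "max_ideal R = {z \<in> R. z = 0 \<or> inverse z \<notin> R}"

definition uniformizer :: "'f :: field set \<Rightarrow> 'f \<Rightarrow> bool" where
  "uniformizer R t \<longleftrightarrow> max_ideal R = (\<lambda>a. t * a) ` R"

text \<open>The normalized discrete valuation of \<open>R\<close>; only meaningful for \<open>z \<noteq> 0\<close>.\<close>

definition ord_at :: "'f :: field set \<Rightarrow> 'f \<Rightarrow> int" where
  "ord_at R z = (THE n. \<exists>t u. uniformizer R t \<and> u \<in> R - max_ideal R \<and> z = t powi n * u)"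

text \<open>
  The degree is the dimension of \<open>R / max_ideal R\<close> over the constants: \<open>bs\<close> is a list of
  representatives of a basis of that quotient.
\<close>

definition place_degree :: "('k :: field \<Rightarrow> 'f :: field) \<Rightarrow> 'f set \<Rightarrow> nat" where
  "place_degree \<kappa> R = (THE n. \<exists>bs. length bs = n \<and> set bs \<subseteq> R \<and>
     (\<forall>z\<in>R. \<exists>!cs. length cs = n \<and> z - (\<Sum>i<n. \<kappa> (cs ! i) * bs ! i) \<in> max_ideal R))"

text \<open>A divisor is an integer function on the places; its values elsewhere are ignored.\<close>

definition divisor_support :: "('k :: field \<Rightarrow> 'f :: field) \<Rightarrow> ('f set \<Rightarrow> int) \<Rightarrow> 'f set set" where
  "divisor_support \<kappa> D = {R. valuation_ring \<kappa> R \<and> D R \<noteq> 0}"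

definition is_divisor :: "('k :: field \<Rightarrow> 'f :: field) \<Rightarrow> ('f set \<Rightarrow> int) \<Rightarrow> bool" where
  "is_divisor \<kappa> D \<longleftrightarrow> finite (divisor_support \<kappa> D)"

definition divisor_degree :: "('k :: field \<Rightarrow> 'f :: field) \<Rightarrow> ('f set \<Rightarrow> int) \<Rightarrow> int" where
  "divisor_degree \<kappa> D = (\<Sum>R\<in>divisor_support \<kappa> D. D R * int (place_degree \<kappa> R))"

definition riemann_roch_space :: "('k :: field \<Rightarrow> 'f :: field) \<Rightarrow> ('f set \<Rightarrow> int) \<Rightarrow> 'f set" where
  "riemann_roch_space \<kappa> D =
     {z. z = 0 \<or> (\<forall>R. valuation_ring \<kappa> R \<longrightarrow> ord_at R z \<ge> - D R)}"

definition divisor_dim :: "('k :: field \<Rightarrow> 'f :: field) \<Rightarrow> ('f set \<Rightarrow> int) \<Rightarrow> nat" where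
  "divisor_dim \<kappa> D = vector_space.dim (scale_by \<kappa>) (riemann_roch_space \<kappa> D)"

definition genus :: "('k :: field \<Rightarrow> 'f :: field) \<Rightarrow> int" where
  "genus \<kappa> = (GREATEST g. \<exists>D. is_divisor \<kappa> D \<and>
     g = divisor_degree \<kappa> D - int (divisor_dim \<kappa> D) + 1)"


section \<open>Extensions of the rational function field\<close>

text \<open>
  From here on \<open>\<iota>\<close> embeds the rational function field \<open>'k poly fract\<close> into \<open>'f\<close>.
\<close>

definition emb_poly :: "('k :: field poly fract \<Rightarrow> 'f :: field) \<Rightarrow> 'k poly \<Rightarrow> 'f" where
  "emb_poly \<iota> p = \<iota> (to_fract p)"

definition emb_const :: "('k :: field poly fract \<Rightarrow> 'f :: field) \<Rightarrow> 'k \<Rightarrow> 'f" where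
  "emb_const \<iota> c = emb_poly \<iota> [:c:]"

definition ramification_index :: "('k :: field poly fract \<Rightarrow> 'f :: field) \<Rightarrow> 'f set \<Rightarrow> int" where
  "ramification_index \<iota> R = (THE e. \<forall>z. z \<noteq> 0 \<longrightarrow> ord_at R (\<iota> z) = e * ord_at (\<iota> -` R) z)"

text \<open>A place \<open>R\<close> of \<open>'f\<close> lies over the place \<open>S\<close> iff \<open>\<iota> -` R = S\<close>.\<close>

definition totally_ramified :: "('k :: field poly fract \<Rightarrow> 'f :: field) \<Rightarrow> 'k poly fract set \<Rightarrow> bool" where
  "totally_ramified \<iota> S \<longleftrightarrow> (\<exists>R. valuation_ring (emb_const \<iota>) R \<and> \<iota> -` R = S \<and>
     ramification_index \<iota> R = int (ext_degree \<iota>))"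

definition infinite_place :: "'k :: field poly fract set" where
  "infinite_place = {Fract f g | f g. g \<noteq> 0 \<and> Polynomial.degree f \<le> Polynomial.degree g}"

definition integral_closure :: "('k :: field poly fract \<Rightarrow> 'f :: field) \<Rightarrow> 'f set" where
  "integral_closure \<iota> = {z. \<exists>p :: 'k poly poly.
     Polynomial.lead_coeff p = 1 \<and> poly (map_poly (emb_poly \<iota>) p) z = 0}"

definition integral_basis :: "('k :: field poly fract \<Rightarrow> 'f :: field) \<Rightarrow> 'f ^ 'n \<Rightarrow> bool" where
  "integral_basis \<iota> b \<longleftrightarrow> (\<forall>i. b $ i \<in> integral_closure \<iota>) \<and>
     (\<forall>z\<in>integral_closure \<iota>. \<exists>!c :: 'k poly ^ 'n. z = (\<Sum>i\<in>UNIV. emb_poly \<iota> (c $ i) * b $ i))"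


section \<open>Cubic function fields in characteristic three\<close>

text \<open>In \<open>'k poly poly\<close> the outer variable is \<open>T\<close>, the inner one \<open>x\<close>.\<close>

definition cubic_poly :: "'k :: field poly \<Rightarrow> 'k poly \<Rightarrow> 'k poly poly" where
  "cubic_poly A B = [:B, - A, 0, 1:]"

definition absolutely_irreducible :: "'k :: field poly poly \<Rightarrow> bool" where
  "absolutely_irreducible p \<longleftrightarrow>
     Factorial_Ring.irreducible (map_poly (map_poly to_ac) p :: 'k alg_closure poly poly)"

text \<open>Zero polynomials have degree \<open>0\<close> here; \<open>B = 0\<close> never gives an irreducible cubic.\<close>

definition standard_form :: "'k :: field poly \<Rightarrow> 'k poly \<Rightarrow> bool" where
  "standard_form A B \<longleftrightarrow>
     \<not> (\<exists>Q i. Polynomial.degree Q > 0 \<and> Q ^ 2 dvd A \<and> Q ^ 3 dvd i ^ 3 - i * A + B) \<and>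
     (\<not> 3 dvd Polynomial.degree B \<and> 2 * Polynomial.degree B > 3 * Polynomial.degree A \<or>
      2 * Polynomial.degree B \<le> 3 * Polynomial.degree A)"

text \<open>
  The discriminant of an integral basis is determined up to squares of nonzero constants, so
  \<open>I\<close> is determined up to a nonzero constant.
\<close>

definition is_index :: "('k :: field poly fract \<Rightarrow> 'f :: field) \<Rightarrow> 'f \<Rightarrow> 'k poly \<Rightarrow> bool" where
  "is_index \<iota> y I \<longleftrightarrow> (\<exists>b :: 'f ^ 3. integral_basis \<iota> b \<and>
     discriminant \<iota> (vector [1, y, y ^ 2] :: 'f ^ 3) = to_fract I ^ 2 * discriminant \<iota> b)"

end

theory Submission
  imports Defs "HOL-Number_Theory.Residues"
begin

text \<open>
  Let \<open>k\<close> be the field of constants and \<open>b = deg B\<close>. Since infinity is totally ramified, there is one place \<open>P\<close> above it,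
  of degree 1, and the order at \<open>P\<close> of a nonzero polynomial of degree \<open>d\<close> is \<open>-3d\<close>. The
  equation forces \<open>y\<close> to have a pole of order \<open>b\<close>, prime to 3. Indeed, the only alternative that the
  standard form leaves open is \<open>2 deg B \<le> 3 deg A\<close>. In this case \<open>y\<close> would have a pole of order at
  most \<open>3/2 deg A\<close>; then the linear term of the cubic controls the orders of all \<open>y - r\<close> with
  \<open>r \<in> k(x)\<close>, they are divisible by 3, and \<open>y\<close> would be a limit of elements of \<open>k(x)\<close>, which
  is incompatible with ramification (\<open>ord_y_bound\<close>).

  Now \<open>1, y, y\<^sup>2\<close> have pole orders \<open>0, b, 2b\<close>, which represent all classes modulo 3. Let \<open>w\<^sub>i\<close> be an
  element of the integral closure \<open>\<O>\<close> of \<open>k[x]\<close> whose pole order \<open>d\<^sub>i\<close> is the smallest in the class of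
  \<open>ib\<close>. Cancelling leading terms shows that the \<open>w\<^sub>i\<close> form a \<open>k[x]\<close>-basis of \<open>\<O>\<close>
  (\<open>reduced_spans\<close>). As no cancellation is possible between different classes modulo 3, two things
  can be computed. The space \<open>L(nP)\<close>, that is, the elements of \<open>\<O>\<close> with pole order at most \<open>n\<close>, has
  dimension \<open>n + 1 - g\<close> for large multiples \<open>n\<close> of 3, where \<open>3g = d\<^sub>0 + d\<^sub>1 + d\<^sub>2 - 3\<close>
  (\<open>card_bounded_poles\<close>, \<open>sum_dimensions\<close>). The matrix that expresses \<open>1, y, y\<^sup>2\<close> in the \<open>w\<^sub>i\<close> has
  a determinant of degree \<open>(0 + b + 2b - d\<^sub>0 - d\<^sub>1 - d\<^sub>2) / 3\<close>, contributed by the diagonal, and this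
  determinant is the index up to a constant (\<open>degree_index\<close>). Eliminating \<open>d\<^sub>0 + d\<^sub>1 + d\<^sub>2\<close> gives
  \<open>g = b - deg I - 1\<close>.

  That \<open>g\<close> is the genus, the maximum of \<open>deg D - dim L(D) + 1\<close> over all divisors, requires the part of
  the theory of function fields that leads to Riemann's theorem. The
  quantity does not decrease when \<open>D\<close> grows (\<open>degree_minus_dim_mono\<close>), and every \<open>D\<close> lies below \<open>NP + (f)\<^sub>0\<close> for a
  polynomial \<open>f\<close> and large \<open>N\<close>. The space of this divisor is isomorphic to \<open>L((N + 3 deg f) P)\<close>,
  and its degree is at most \<open>N + 3 deg f\<close> because the zeros of \<open>f\<close> have total degree at most
  \<open>[F : k(f)]\<close> (\<open>sum_ord_degree_le\<close>, from weak approximation). That \<open>L(nP)\<close> consists of integral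
  elements is the existence theorem for valuation rings (\<open>valuation_ring_avoiding\<close>).

  The finiteness of \<open>k\<close> is used to replace linear algebra over \<open>k\<close> by counting. In particular, the
  bound on \<open>[F : k(f)]\<close>, in the form of \<open>dependent_over\<close>, is a pigeonhole argument
  (\<open>fractional_relation\<close>); this bound also implies that every place is discrete and has finite degree.
\<close>

section \<open>Field embeddings\<close>

definition eval_at :: "('k :: field \<Rightarrow> 'f :: field) \<Rightarrow> 'k poly \<Rightarrow> 'f \<Rightarrow> 'f" where
  "eval_at \<kappa> p z = poly (map_poly \<kappa> p) z"

locale field_embedding =
  fixes \<kappa> :: "'k :: field \<Rightarrow> 'f :: field"
  assumes hom: "field_hom \<kappa>"
begin

lemma hom_1 [simp]: "\<kappa> 1 = 1" and hom_add: "\<kappa> (a + b) = \<kappa> a + \<kappa> b"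
  and hom_mult: "\<kappa> (a * b) = \<kappa> a * \<kappa> b"
  using hom by (auto simp: field_hom_def)

lemma hom_0 [simp]: "\<kappa> 0 = 0"
  using hom_add[of 0 0] by (simp only: add_0_left) (metis add_cancel_right_right)

lemma hom_minus: "\<kappa> (- a) = - \<kappa> a"
  using hom_add[of a "- a"] by (simp add: eq_neg_iff_add_eq_0 add.commute)

lemma hom_diff: "\<kappa> (a - b) = \<kappa> a - \<kappa> b"
  using hom_add[of a "- b"] by (simp add: hom_minus)

lemma hom_eq_0_iff [simp]: "\<kappa> a = 0 \<longleftrightarrow> a = 0"
  using hom_mult[of a "inverse a"] by (cases "a = 0") auto

lemma hom_eq_iff [simp]: "\<kappa> a = \<kappa> b \<longleftrightarrow> a = b"
  using hom_eq_0_iff[of "a - b"] by (simp add: hom_diff del: hom_eq_0_iff)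

lemma hom_inverse: "\<kappa> (inverse a) = inverse (\<kappa> a)"
  using hom_mult[of a "inverse a"] by (cases "a = 0") (auto simp: inverse_unique)

lemma hom_divide: "\<kappa> (a / b) = \<kappa> a / \<kappa> b"
  by (simp add: divide_inverse hom_mult hom_inverse)

lemma hom_power: "\<kappa> (a ^ n) = \<kappa> a ^ n"
  by (induction n) (auto simp: hom_mult)

lemma eval_0 [simp]: "eval_at \<kappa> 0 z = 0"
  by (simp add: eval_at_def)

lemma eval_pCons [simp]: "eval_at \<kappa> (pCons a p) z = \<kappa> a + z * eval_at \<kappa> p z"
  by (cases "p = 0 \<and> a = 0") (auto simp: eval_at_def map_poly_pCons)

lemma eval_add: "eval_at \<kappa> (p + q) z = eval_at \<kappa> p z + eval_at \<kappa> q z"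
proof (induction p arbitrary: q)
  case (pCons a p)
  then show ?case by (cases q) (auto simp: hom_add algebra_simps)
qed simp

lemma eval_smult: "eval_at \<kappa> (smult c p) z = \<kappa> c * eval_at \<kappa> p z"
  by (induction p) (auto simp: hom_mult algebra_simps)

lemma eval_mult: "eval_at \<kappa> (p * q) z = eval_at \<kappa> p z * eval_at \<kappa> q z"
  by (induction p) (auto simp: eval_add eval_smult algebra_simps)

lemma eval_sum: "eval_at \<kappa> (sum g S) z = (\<Sum>i\<in>S. eval_at \<kappa> (g i) z)"
  by (induction S rule: infinite_finite_induct) (auto simp: eval_add)

lemma eval_monom: "eval_at \<kappa> (monom c n) z = \<kappa> c * z ^ n"
  by (induction n) (auto simp: monom_0 monom_Suc)

lemma eval_eq_sum:
  assumes "\<forall>i\<ge>n. coeff p i = 0"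
  shows "eval_at \<kappa> p z = (\<Sum>i<n. \<kappa> (coeff p i) * z ^ i)"
proof -
  have "p = (\<Sum>i<n. monom (coeff p i) i)"
    using assms by (intro poly_eqI) (auto simp: coeff_sum not_less)
  then have "eval_at \<kappa> p z = eval_at \<kappa> (\<Sum>i<n. monom (coeff p i) i) z" by simp
  then show ?thesis by (simp add: eval_sum eval_monom)
qed

lemma eval_split: "\<exists>r. p = [:coeff p 0:] + pCons 0 r"
  by (cases p) auto

end


section \<open>Discrete valuation rings\<close>

lemma max_ideal_iff: "z \<in> max_ideal R \<longleftrightarrow> z \<in> R \<and> (z = 0 \<or> inverse z \<notin> R)"
  by (auto simp: max_ideal_def)

locale val_ring =
  fixes R :: "'f :: field set"
  assumes one_mem [simp]: "1 \<in> R"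
    and diff_mem: "a \<in> R \<Longrightarrow> b \<in> R \<Longrightarrow> a - b \<in> R"
    and mult_mem: "a \<in> R \<Longrightarrow> b \<in> R \<Longrightarrow> a * b \<in> R"
    and total: "z \<in> R \<or> inverse z \<in> R"
    and proper: "R \<noteq> UNIV"
begin

lemma zero_mem [simp]: "0 \<in> R"
  using diff_mem[of 1 1] by simp

lemma minus_mem: "a \<in> R \<Longrightarrow> - a \<in> R"
  using diff_mem[of 0 a] by simp

lemma add_mem: "a \<in> R \<Longrightarrow> b \<in> R \<Longrightarrow> a + b \<in> R"
  using diff_mem[of a "- b"] minus_mem by simp

lemma power_mem: "a \<in> R \<Longrightarrow> a ^ n \<in> R"
  by (induction n) (auto intro: mult_mem)

lemma sum_mem: "(\<And>i. i \<in> S \<Longrightarrow> g i \<in> R) \<Longrightarrow> sum g S \<in> R"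
  by (induction S rule: infinite_finite_induct) (auto intro: add_mem)

abbreviation "\<mm> \<equiv> max_ideal R"

lemma max_ideal_sub: "z \<in> \<mm> \<Longrightarrow> z \<in> R"
  by (simp add: max_ideal_iff)

lemma one_notin_max: "1 \<notin> \<mm>"
  by (simp add: max_ideal_iff)

lemma not_mem_imp: "z \<notin> R \<Longrightarrow> inverse z \<in> \<mm> \<and> z \<noteq> 0"
  using total[of z] by (auto simp: max_ideal_iff)

lemma max_ideal_mult: "z \<in> \<mm> \<Longrightarrow> a \<in> R \<Longrightarrow> a * z \<in> \<mm>"
proof -
  assume z: "z \<in> \<mm>" and a: "a \<in> R"
  have "inverse z \<in> R" if "inverse (a * z) \<in> R" "a * z \<noteq> 0"
    using mult_mem[OF a that(1)] that(2) by (simp add: field_simps)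
  then show ?thesis using z a mult_mem by (auto simp: max_ideal_iff)
qed

lemma max_ideal_add:
  assumes "a \<in> \<mm>" "b \<in> \<mm>"
  shows "a + b \<in> \<mm>"
proof (cases "a = 0 \<or> b = 0")
  case True
  then show ?thesis using assms by auto
next
  case False
  have "a / b \<in> R \<or> b / a \<in> R" using total[of "a / b"] by simp
  then have "(1 + a / b) * b \<in> \<mm> \<or> (1 + b / a) * a \<in> \<mm>"
    using max_ideal_mult[OF assms(1)] max_ideal_mult[OF assms(2)] add_mem[OF one_mem] by blast
  then show ?thesis using False by (simp add: field_simps)
qed

lemma max_ideal_minus: "a \<in> \<mm> \<Longrightarrow> - a \<in> \<mm>"
  using max_ideal_mult[of a "-1"] minus_mem[of 1] by simp

lemma max_ideal_diff: "a \<in> \<mm> \<Longrightarrow> b \<in> \<mm> \<Longrightarrow> a - b \<in> \<mm>"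
  using max_ideal_add[of a "- b"] max_ideal_minus by simp

lemma max_ideal_zero [simp]: "0 \<in> \<mm>"
  by (simp add: max_ideal_iff)

lemma max_ideal_sum: "(\<And>i. i \<in> S \<Longrightarrow> g i \<in> \<mm>) \<Longrightarrow> sum g S \<in> \<mm>"
  by (induction S rule: infinite_finite_induct) (auto intro: max_ideal_add)

lemma unit_iff: "u \<in> R - \<mm> \<longleftrightarrow> u \<in> R \<and> inverse u \<in> R \<and> u \<noteq> 0"
  by (auto simp: max_ideal_iff)

end

locale dvr = val_ring +
  assumes discrete: "\<exists>t. t \<noteq> 0 \<and> uniformizer R t \<and> (\<forall>z. z \<noteq> 0 \<longrightarrow> (\<exists>n u. u \<in> R - \<mm> \<and> z = t powi n * u))"
begin

lemma unit_mult: "u \<in> R - \<mm> \<Longrightarrow> v \<in> R - \<mm> \<Longrightarrow> u * v \<in> R - \<mm>"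
  unfolding unit_iff by (auto simp: mult_mem)

lemma unit_inverse: "u \<in> R - \<mm> \<Longrightarrow> inverse u \<in> R - \<mm>"
  unfolding unit_iff by auto

lemma unit_power: "u \<in> R - \<mm> \<Longrightarrow> u ^ n \<in> R - \<mm>"
  by (induction n) (use unit_mult one_notin_max in auto)

lemma unit_powi: "u \<in> R - \<mm> \<Longrightarrow> u powi n \<in> R - \<mm>"
  unfolding power_int_def using unit_power unit_inverse by presburger

lemma uniformizer_mult_mem: "uniformizer R t \<Longrightarrow> a \<in> R \<Longrightarrow> t * a \<in> \<mm>"
  unfolding uniformizer_def by (elim ssubst) (rule imageI)

lemma uniformizer_dvd: "uniformizer R t \<Longrightarrow> z \<in> \<mm> \<Longrightarrow> \<exists>a\<in>R. z = t * a"
  by (auto simp: uniformizer_def)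

lemma uniformizer_nonzero: "uniformizer R t \<Longrightarrow> t \<noteq> 0 \<and> t \<in> \<mm>"
proof -
  assume t: "uniformizer R t"
  obtain s where s: "s \<noteq> 0" "uniformizer R s" using discrete by auto
  have "s \<in> \<mm>" using uniformizer_mult_mem[OF s(2) one_mem] by simp
  then obtain a where "s = t * a" using uniformizer_dvd[OF t] by blast
  moreover have "t \<in> \<mm>" using uniformizer_mult_mem[OF t one_mem] by simp
  ultimately show ?thesis using s(1) by auto
qed

lemma uniformizers_associated:
  assumes "uniformizer R t" "uniformizer R s"
  shows "\<exists>a. a \<in> R - \<mm> \<and> s = t * a"
proof -
  note t = uniformizer_nonzero[OF assms(1)] and s = uniformizer_nonzero[OF assms(2)]
  obtain a where a: "a \<in> R" "s = t * a" using uniformizer_dvd[OF assms(1)] s by blast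
  obtain b where b: "b \<in> R" "t = s * b" using uniformizer_dvd[OF assms(2)] t by blast
  have "a = s / t" "b = t / s" using a(2) b(2) t s by (simp_all add: field_simps)
  then have "a * b = 1" using t s by simp
  then have "a \<noteq> 0" "inverse a \<in> R" using b(1) by (auto simp: inverse_unique)
  then have "a \<in> R - \<mm>" using a(1) by (simp add: unit_iff del: Diff_iff)
  then show ?thesis using a(2) by blast
qed

lemma powi_unit_imp_0:
  assumes t: "uniformizer R t" and u: "t powi n \<in> R - \<mm>"
  shows "n = 0"
proof (rule ccontr)
  assume "n \<noteq> 0"
  have pos: "t ^ Suc k \<in> \<mm>" for k
    using uniformizer_nonzero[OF t] max_ideal_mult[of t "t ^ k"] power_mem[of t k] max_ideal_sub
    by (simp add: mult.commute)
  show False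
  proof (cases "n > 0")
    case True
    then obtain k where "nat n = Suc k" by (cases "nat n") auto
    then show False using pos[of k] u True by (auto simp: power_int_def)
  next
    case False
    then obtain k where k: "nat (- n) = Suc k" using \<open>n \<noteq> 0\<close> by (cases "nat (- n)") auto
    have "inverse (t powi n) \<in> R - \<mm>" using unit_inverse[OF u] .
    moreover have "inverse (t powi n) = t ^ Suc k" using k False by (auto simp: power_int_def power_inverse)
    ultimately show False using pos[of k] by simp
  qed
qed

lemma ord_eqI:
  assumes t: "uniformizer R t" and u: "u \<in> R - \<mm>"
  shows "ord_at R (t powi n * u) = n"
  unfolding ord_at_def
proof (rule the_equality)
  show "\<exists>t' u'. uniformizer R t' \<and> u' \<in> R - \<mm> \<and> t powi n * u = t' powi n * u'"
    using assms by blast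
next
  fix n'
  assume "\<exists>t' u'. uniformizer R t' \<and> u' \<in> R - \<mm> \<and> t powi n * u = t' powi n' * u'"
  then obtain t' u' where t': "uniformizer R t'" "u' \<in> R - \<mm>" and eq: "t powi n * u = t' powi n' * u'"
    by blast
  obtain a where a: "a \<in> R - \<mm>" "t' = t * a" using uniformizers_associated[OF t t'(1)] by blast
  have nz: "t \<noteq> 0" "a \<noteq> 0" "u \<noteq> 0"
    using uniformizer_nonzero[OF t] a u by (auto simp: unit_iff)
  have "t powi n = t powi n' * a powi n' * u' * inverse u"
    using eq nz unfolding a(2) by (simp add: power_int_mult_distrib field_simps)
  then have "t powi (n - n') = a powi n' * (u' * inverse u)"
    using nz by (simp add: power_int_diff field_simps)
  moreover have "a powi n' * (u' * inverse u) \<in> R - \<mm>"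
    by (intro unit_mult unit_inverse unit_powi a t' u)
  ultimately show "n' = n" using powi_unit_imp_0[OF t, of "n - n'"] by auto
qed

lemma ord_decomp:
  assumes "z \<noteq> 0" "uniformizer R t"
  shows "\<exists>u. u \<in> R - \<mm> \<and> z = t powi ord_at R z * u"
proof -
  obtain s where s: "uniformizer R s" and dec: "\<And>z. z \<noteq> 0 \<Longrightarrow> \<exists>n u. u \<in> R - \<mm> \<and> z = s powi n * u"
    using discrete by auto
  obtain n u where u: "u \<in> R - \<mm>" "z = s powi n * u" using dec assms by blast
  obtain a where a: "a \<in> R - \<mm>" "s = t * a" using uniformizers_associated[OF assms(2) s] by blast
  have "z = t powi n * (a powi n * u)" using u a by (simp add: power_int_mult_distrib)
  moreover have "a powi n * u \<in> R - \<mm>" by (intro unit_mult unit_powi a u)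
  ultimately show ?thesis using ord_eqI[OF assms(2)] by metis
qed

lemma uniformizer_ex: "\<exists>t. uniformizer R t"
  using discrete by auto

lemma ord_mult:
  assumes "a \<noteq> 0" "b \<noteq> 0"
  shows "ord_at R (a * b) = ord_at R a + ord_at R b"
proof -
  obtain t where t: "uniformizer R t" using uniformizer_ex by blast
  obtain u v where uv: "u \<in> R - \<mm>" "a = t powi ord_at R a * u" "v \<in> R - \<mm>" "b = t powi ord_at R b * v"
    using ord_decomp[OF assms(1) t] ord_decomp[OF assms(2) t] by blast
  have "a * b = t powi ord_at R a * u * (t powi ord_at R b * v)" using uv by metis
  also have "\<dots> = t powi (ord_at R a + ord_at R b) * (u * v)"
    using uniformizer_nonzero[OF t] by (simp add: power_int_add)
  finally show ?thesis using ord_eqI[OF t unit_mult[OF uv(1,3)]] by metis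
qed

lemma ord_unit: "u \<in> R - \<mm> \<Longrightarrow> ord_at R u = 0"
  using uniformizer_ex ord_eqI[of _ u 0] by auto

lemma ord_1 [simp]: "ord_at R 1 = 0"
  using ord_unit[of 1] one_notin_max by simp

lemma ord_uniformizer: "uniformizer R t \<Longrightarrow> ord_at R t = 1"
  using ord_eqI[of t 1 1] one_notin_max by simp

lemma ord_inverse: "a \<noteq> 0 \<Longrightarrow> ord_at R (inverse a) = - ord_at R a"
  using ord_mult[of a "inverse a"] by simp

lemma ord_divide: "a \<noteq> 0 \<Longrightarrow> b \<noteq> 0 \<Longrightarrow> ord_at R (a / b) = ord_at R a - ord_at R b"
  by (simp add: divide_inverse ord_mult ord_inverse)

lemma ord_power: "a \<noteq> 0 \<Longrightarrow> ord_at R (a ^ n) = int n * ord_at R a"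
  by (induction n) (auto simp: ord_mult algebra_simps)

lemma ord_powi: "a \<noteq> 0 \<Longrightarrow> ord_at R (a powi n) = n * ord_at R a"
  by (auto simp: power_int_def ord_power ord_inverse)

lemma max_ideal_iff_ord: "z \<noteq> 0 \<Longrightarrow> z \<in> \<mm> \<longleftrightarrow> ord_at R z > 0"
  and mem_iff_ord: "z \<noteq> 0 \<Longrightarrow> z \<in> R \<longleftrightarrow> ord_at R z \<ge> 0"
proof -
  have pos: "z \<in> \<mm>" if z: "z \<noteq> 0" "ord_at R z > 0" for z
  proof -
    obtain t where t: "uniformizer R t" using uniformizer_ex by blast
    obtain u where u: "u \<in> R - \<mm>" "z = t powi ord_at R z * u" using ord_decomp[OF z(1) t] by blast
    obtain k where k: "nat (ord_at R z) = Suc k" using z(2) by (cases "nat (ord_at R z)") auto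
    have "t powi ord_at R z = t ^ Suc k" using k z(2) by (metis power_int_def less_imp_le)
    then have "z = (t ^ k * u) * t" using u(2) by simp
    moreover have "t ^ k * u \<in> R"
      using u(1) uniformizer_nonzero[OF t] by (auto intro!: mult_mem power_mem simp: max_ideal_sub)
    ultimately show ?thesis using max_ideal_mult uniformizer_nonzero[OF t] by metis
  qed
  have unit: "z \<in> R - \<mm>" if z: "z \<noteq> 0" "ord_at R z = 0" for z
    using ord_decomp[OF z(1)] uniformizer_ex z(2) by (metis mult_1 power_int_0_right)
  have neg: "z \<notin> R" if z: "z \<noteq> 0" "ord_at R z < 0" for z
    using pos[of "inverse z"] z by (auto simp: ord_inverse max_ideal_iff)
  show "z \<noteq> 0 \<Longrightarrow> z \<in> \<mm> \<longleftrightarrow> ord_at R z > 0"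
    using pos unit neg max_ideal_sub by (metis Diff_iff linorder_cases)
  show "z \<noteq> 0 \<Longrightarrow> z \<in> R \<longleftrightarrow> ord_at R z \<ge> 0"
    using pos unit neg max_ideal_sub by (metis Diff_iff linorder_cases less_le_not_le linear order_le_less)
qed

text \<open>
  \<open>ord_at\<close> has no useful value at \<open>0\<close>. Lower bounds on the order, with \<open>0\<close> satisfying all of
  them, behave well under addition and multiplication without case distinctions.
\<close>
definition vge :: "int \<Rightarrow> 'a \<Rightarrow> bool" where
  "vge n z \<longleftrightarrow> z = 0 \<or> ord_at R z \<ge> n"

lemma vge_0 [simp]: "vge n 0"
  by (simp add: vge_def)

lemma vge_mem: "vge 0 z \<longleftrightarrow> z \<in> R"
  by (cases "z = 0") (auto simp: vge_def mem_iff_ord)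

lemma vge_max_ideal: "vge 1 z \<longleftrightarrow> z \<in> \<mm>"
  by (cases "z = 0") (auto simp: vge_def max_ideal_iff_ord)

lemma vge_mono: "vge n z \<Longrightarrow> m \<le> n \<Longrightarrow> vge m z"
  by (auto simp: vge_def)

lemma vge_mult: "vge n a \<Longrightarrow> vge m b \<Longrightarrow> vge (n + m) (a * b)"
  by (cases "a = 0 \<or> b = 0") (auto simp: vge_def ord_mult)

lemma vge_ord: "vge (ord_at R z) z"
  by (simp add: vge_def)

lemma vge_iff_divide: "w \<noteq> 0 \<Longrightarrow> vge n (z / w) \<longleftrightarrow> vge (n + ord_at R w) z"
  by (cases "z = 0") (auto simp: vge_def ord_divide)

lemma vge_add:
  assumes "vge n a" "vge n b"
  shows "vge n (a + b)"
proof -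
  obtain t where t: "uniformizer R t" using uniformizer_ex by blast
  have tn: "t powi n \<noteq> 0" "ord_at R (t powi n) = n"
    using uniformizer_nonzero[OF t] by (auto simp: ord_powi ord_uniformizer[OF t])
  have "a / t powi n \<in> R" "b / t powi n \<in> R"
    using assms tn by (auto simp: vge_mem[symmetric] vge_iff_divide)
  then have "(a + b) / t powi n \<in> R" using add_mem by (simp add: add_divide_distrib)
  then show ?thesis using tn by (simp add: vge_mem[symmetric] vge_iff_divide)
qed

lemma ord_neg_1 [simp]: "ord_at R (-1) = 0"
  using ord_mult[of "-1" "-1"] by simp

lemma ord_minus [simp]: "ord_at R (- z) = ord_at R z"
  using ord_mult[of "-1" z] by (cases "z = 0") auto

lemma vge_minus [simp]: "vge n (- a) \<longleftrightarrow> vge n a"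
  by (simp add: vge_def)

lemma vge_diff: "vge n a \<Longrightarrow> vge n b \<Longrightarrow> vge n (a - b)"
  using vge_add[of n a "- b"] by simp

lemma vge_sum: "(\<And>i. i \<in> S \<Longrightarrow> vge n (g i)) \<Longrightarrow> vge n (sum g S)"
  by (induction S rule: infinite_finite_induct) (auto intro: vge_add)

lemma ord_eq_of_vge:
  assumes "z \<noteq> 0" "vge (ord_at R z + 1) (w - z)"
  shows "w \<noteq> 0" "ord_at R w = ord_at R z"
proof -
  have *: "\<not> vge (ord_at R z + 1) w"
  proof
    assume "vge (ord_at R z + 1) w"
    from vge_diff[OF this assms(2)] show False using assms(1) by (simp add: vge_def)
  qed
  then show "w \<noteq> 0" by auto
  have "vge (ord_at R z) (w - z + z)"
    by (rule vge_add[OF vge_mono[OF assms(2)] vge_ord]) simp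
  then show "ord_at R w = ord_at R z" using * by (auto simp: vge_def)
qed

lemma ord_add_eq:
  assumes "a \<noteq> 0" "b = 0 \<or> ord_at R a < ord_at R b"
  shows "a + b \<noteq> 0" "ord_at R (a + b) = ord_at R a"
  using ord_eq_of_vge[of a "a + b"] assms by (auto simp: vge_def)

end

section \<open>Algebraic dependence over a one-variable polynomial ring\<close>

text \<open>
  For transcendental \<open>f\<close> this says that the field has dimension at most \<open>n\<close> over \<open>\<kappa>(f)\<close>: after clearing denominators
  and common factors \<open>f\<close>, a linear relation has coefficients in \<open>\<kappa>[f]\<close>, not all of them divisible by
  \<open>f\<close>. The last property is what makes relations useful modulo a prime that contains \<open>f\<close>.
\<close>
definition dependent_over :: "('k :: field \<Rightarrow> 'f :: field) \<Rightarrow> 'f \<Rightarrow> nat \<Rightarrow> bool" where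
  "dependent_over \<kappa> f n \<longleftrightarrow> f \<noteq> 0 \<and>
     (\<forall>h :: nat \<Rightarrow> 'f. \<exists>c. (\<exists>j\<le>n. coeff (c j) 0 \<noteq> 0) \<and> (\<Sum>j\<le>n. eval_at \<kappa> (c j) f * h j) = 0)"

context field_embedding
begin

text \<open>Divide a nontrivial relation by the largest possible power of \<open>f\<close>.\<close>
lemma relation_with_constant_term:
  fixes n :: nat
  assumes "f \<noteq> 0" "\<exists>j\<le>n. c j \<noteq> 0" "(\<Sum>j\<le>n. eval_at \<kappa> (c j) f * h j) = 0"
  shows "\<exists>c. (\<exists>j\<le>n. coeff (c j) 0 \<noteq> 0) \<and> (\<Sum>j\<le>n. eval_at \<kappa> (c j) f * h j) = 0"
  using assms(2,3)
proof (induction "\<Sum>j\<le>n. degree (c j)" arbitrary: c rule: less_induct)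
  case less
  show ?case
  proof (cases "\<exists>j\<le>n. coeff (c j) 0 \<noteq> 0")
    case False
    have "\<exists>r. c j = pCons 0 r" if "j \<le> n" for j
      using False that by (cases "c j") auto
    then obtain r where r: "\<And>j. j \<le> n \<Longrightarrow> c j = pCons 0 (r j)" by metis
    obtain j0 where j0: "j0 \<le> n" "c j0 \<noteq> 0" using less.prems(1) by blast
    have deg: "degree (c j) = (if r j = 0 then 0 else Suc (degree (r j)))" if "j \<le> n" for j
      using r[OF that] by simp
    have "(\<Sum>j\<le>n. degree (r j)) < (\<Sum>j\<le>n. degree (c j))"
    proof (rule sum_strict_mono_ex1)
      show "\<exists>a\<in>{..n}. degree (r a) < degree (c a)"
        using j0 r[OF j0(1)] by (intro bexI[of _ j0]) (auto simp: deg)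
      show "finite {..n}" by (rule finite_atMost)
    qed (auto simp: deg)
    moreover have "\<exists>j\<le>n. r j \<noteq> 0" using j0 r[OF j0(1)] by auto
    moreover have "(\<Sum>j\<le>n. eval_at \<kappa> (r j) f * h j) = 0"
    proof -
      have "f * (\<Sum>j\<le>n. eval_at \<kappa> (r j) f * h j) = (\<Sum>j\<le>n. eval_at \<kappa> (c j) f * h j)"
        unfolding sum_distrib_left by (rule sum.cong) (auto simp: r)
      then show ?thesis using less.prems(2) assms(1) by simp
    qed
    ultimately show ?thesis using less.hyps by blast
  qed (use less.prems in blast)
qed

lemma dependent_over_family:
  assumes "dependent_over \<kappa> f n" "finite J" "card J > n"
  shows "\<exists>c. (\<exists>j\<in>J. coeff (c j) 0 \<noteq> 0) \<and> (\<Sum>j\<in>J. eval_at \<kappa> (c j) f * h j) = 0"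
proof -
  obtain J' where J': "J' \<subseteq> J" "card J' = Suc n"
    using assms(3) obtain_subset_with_card_n[of "Suc n" J] by auto
  have fin: "finite J'" using J' assms(2) finite_subset by blast
  then obtain e where e: "bij_betw e {..n} J'"
    using ex_bij_betw_nat_finite[OF fin] by (auto simp: J'(2) atLeast0LessThan lessThan_Suc_atMost)
  obtain c where c: "\<exists>j\<le>n. coeff (c j) 0 \<noteq> 0" "(\<Sum>j\<le>n. eval_at \<kappa> (c j) f * h (e j)) = 0"
    using assms(1) unfolding dependent_over_def by (meson)
  define d where "d = (\<lambda>j. if j \<in> J' then c (inv_into {..n} e j) else 0)"
  have inj: "inj_on e {..n}" using e by (simp add: bij_betw_def)
  have im: "e ` {..n} = J'" using e by (simp add: bij_betw_def)
  have de: "d (e j) = c j" "e j \<in> J'" if "j \<le> n" for j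
    using that im inv_into_f_f[OF inj, of j] by (auto simp: d_def)
  have "(\<Sum>j\<in>J. eval_at \<kappa> (d j) f * h j) = (\<Sum>j\<in>J'. eval_at \<kappa> (d j) f * h j)"
    using J'(1) assms(2) by (intro sum.mono_neutral_right) (auto simp: d_def)
  also have "\<dots> = (\<Sum>j\<le>n. eval_at \<kappa> (d (e j)) f * h (e j))"
    by (rule sum.reindex_bij_betw[OF e, symmetric])
  also have "\<dots> = (\<Sum>j\<le>n. eval_at \<kappa> (c j) f * h (e j))"
    by (rule sum.cong) (auto simp: de)
  also note c(2)
  finally have "(\<Sum>j\<in>J. eval_at \<kappa> (d j) f * h j) = 0" .
  moreover have "\<exists>j\<in>J. coeff (d j) 0 \<noteq> 0" using c(1) de J'(1) by (metis subsetD)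
  ultimately show ?thesis by blast
qed

text \<open>
  Reversing the coefficients turns a polynomial in \<open>f\<close> into one in \<open>1/f\<close>, up to a power of \<open>f\<close>; in
  this way zeros and poles of \<open>f\<close> are handled alike.
\<close>
lemma eval_reflect:
  assumes "f \<noteq> 0" "degree p \<le> M"
  shows "eval_at \<kappa> (\<Sum>i\<le>M. monom (coeff p (M - i)) i) (inverse f) = inverse f ^ M * eval_at \<kappa> p f"
proof -
  have "eval_at \<kappa> (\<Sum>i\<le>M. monom (coeff p (M - i)) i) (inverse f) =
      (\<Sum>i\<le>M. \<kappa> (coeff p (M - i)) * inverse f ^ i)"
    by (simp add: eval_sum eval_monom)
  also have "\<dots> = (\<Sum>i\<le>M. \<kappa> (coeff p i) * inverse f ^ (M - i))"
    by (rule sum.reindex_bij_witness[of _ "\<lambda>i. M - i" "\<lambda>i. M - i"]) auto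
  also have "\<dots> = (\<Sum>i\<le>M. inverse f ^ M * (\<kappa> (coeff p i) * f ^ i))"
    using assms(1) by (intro sum.cong) (auto simp: power_diff field_simps)
  also have "\<dots> = inverse f ^ M * eval_at \<kappa> p f"
  proof -
    have "\<forall>i\<ge>Suc M. coeff p i = 0" using assms(2) coeff_eq_0 by (metis Suc_le_lessD le_less_trans)
    then show ?thesis
      by (simp only: eval_eq_sum[of "Suc M" p f] sum_distrib_left lessThan_Suc_atMost)
  qed
  finally show ?thesis .
qed

lemma dependent_over_inverse:
  assumes "dependent_over \<kappa> f n"
  shows "dependent_over \<kappa> (inverse f) n"
  unfolding dependent_over_def
proof (intro conjI allI)
  have f: "f \<noteq> 0" using assms by (simp add: dependent_over_def)
  then show "inverse f \<noteq> 0" by simp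
  fix h
  obtain c where c: "\<exists>j\<le>n. coeff (c j) 0 \<noteq> 0" "(\<Sum>j\<le>n. eval_at \<kappa> (c j) f * h j) = 0"
    using assms unfolding dependent_over_def by meson
  define M where "M = (\<Sum>j\<le>n. degree (c j))"
  have M: "degree (c j) \<le> M" if "j \<le> n" for j
    unfolding M_def using that by (intro member_le_sum) auto
  define d where "d j = (\<Sum>i\<le>M. monom (coeff (c j) (M - i)) i)" for j
  have d: "coeff (d j) i = coeff (c j) (M - i)" if "i \<le> M" for i j
    using that by (simp add: d_def coeff_sum)
  have "(\<Sum>j\<le>n. eval_at \<kappa> (d j) (inverse f) * h j) = (\<Sum>j\<le>n. inverse f ^ M * (eval_at \<kappa> (c j) f * h j))"
    unfolding d_def by (rule sum.cong) (auto simp: eval_reflect[OF f M])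
  also have "\<dots> = 0" by (simp add: sum_distrib_left[symmetric] c(2))
  finally have "(\<Sum>j\<le>n. eval_at \<kappa> (d j) (inverse f) * h j) = 0" .
  moreover have "\<exists>j\<le>n. d j \<noteq> 0"
    using c(1) d[of M] by (metis diff_self_eq_0 coeff_0 order_refl)
  ultimately show "\<exists>c. (\<exists>j\<le>n. coeff (c j) 0 \<noteq> 0) \<and> (\<Sum>j\<le>n. eval_at \<kappa> (c j) (inverse f) * h j) = 0"
    using relation_with_constant_term[of "inverse f" n d h] f by simp
qed

end


section \<open>Places of a function field are discrete\<close>

text \<open>
  The assumption replaces finiteness of the field over \<open>\<kappa>(z)\<close> for transcendental \<open>z\<close>. It asks for one element
  \<open>f\<close> below \<open>z\<close> only, which may depend on \<open>R\<close>; in a cubic extension of \<open>k(x)\<close> it can be taken in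
  \<open>k[x]\<close> or to be a power of \<open>1/x\<close>.
\<close>
locale function_field = field_embedding \<kappa>
  for \<kappa> :: "'k :: {field, finite} \<Rightarrow> 'f :: field" +
  assumes divides_dependent: "valuation_ring \<kappa> R \<Longrightarrow> z \<in> max_ideal R \<Longrightarrow> z \<noteq> 0 \<Longrightarrow>
    \<exists>f n. dependent_over \<kappa> f n \<and> f / z \<in> R"
begin

lemma val_ring: "valuation_ring \<kappa> R \<Longrightarrow> val_ring R"
proof
  assume R: "valuation_ring \<kappa> R"
  show "1 \<in> R" using R hom_1 unfolding valuation_ring_def by (metis psubsetE range_subsetD)
  show "a \<in> R \<Longrightarrow> b \<in> R \<Longrightarrow> a - b \<in> R" "a \<in> R \<Longrightarrow> b \<in> R \<Longrightarrow> a * b \<in> R" for a b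
    using R unfolding valuation_ring_def by blast+
  show "z \<in> R \<or> inverse z \<in> R" for z using R unfolding valuation_ring_def by blast
  show "R \<noteq> UNIV" using R unfolding valuation_ring_def by blast
qed

lemma const_mem: "valuation_ring \<kappa> R \<Longrightarrow> \<kappa> c \<in> R"
  unfolding valuation_ring_def by blast

lemma const_max_ideal_iff: "valuation_ring \<kappa> R \<Longrightarrow> \<kappa> c \<in> max_ideal R \<longleftrightarrow> c = 0"
  using const_mem[of R c] const_mem[of R "inverse c"] by (auto simp: max_ideal_iff hom_inverse[symmetric])

lemma eval_mem: "valuation_ring \<kappa> R \<Longrightarrow> f \<in> R \<Longrightarrow> eval_at \<kappa> p f \<in> R"
  by (induction p) (auto intro: const_mem val_ring.add_mem val_ring.mult_mem val_ring val_ring.zero_mem)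

lemma eval_split_mem:
  assumes "valuation_ring \<kappa> R" "f \<in> R"
  shows "\<exists>r\<in>R. eval_at \<kappa> p f = \<kappa> (coeff p 0) + f * r"
  using eval_mem[OF assms] by (cases p) auto

text \<open>
  A strictly increasing chain of principal ideals above \<open>f\<close> is bounded. Modulo \<open>f\<close>, a relation over
  \<open>\<kappa>[f]\<close> between too many generators is one with constant coefficients, not all zero, and its terms
  have pairwise different orders of vanishing, so they cannot cancel.
\<close>
lemma chain_bounded:
  assumes R: "valuation_ring \<kappa> R" and dep: "dependent_over \<kappa> f n"
    and f: "f / h 0 \<in> max_ideal R"
    and nz: "\<And>j. j \<le> n \<Longrightarrow> h j \<noteq> 0"
    and chain: "\<And>j. j < n \<Longrightarrow> h j / h (Suc j) \<in> max_ideal R"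
    and last: "h n \<in> R"
  shows False
proof -
  interpret val_ring R by (rule val_ring[OF R])
  have lt: "h i / h j \<in> \<mm>" if "i < j" "j \<le> n" for i j
    using that
  proof (induction j)
    case (Suc j)
    show ?case
    proof (cases "i = j")
      case False
      then have "h i / h j \<in> \<mm>" "h j / h (Suc j) \<in> \<mm>" using Suc chain by auto
      then have "h i / h j * (h j / h (Suc j)) \<in> \<mm>" using max_ideal_mult max_ideal_sub by blast
      then show ?thesis using nz[of j] Suc.prems by simp
    qed (use Suc chain in auto)
  qed simp
  have memR: "h j \<in> R" if "j \<le> n" for j
    using lt[of j n] mult_mem[of "h j / h n" "h n"] last that nz[of n] max_ideal_sub
    by (cases "j = n") auto
  have fj: "f / h j \<in> \<mm>" if "j \<le> n" for j
  proof (cases "j = 0")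
    case False
    then have "f / h 0 * (h 0 / h j) \<in> \<mm>" using f lt[of 0 j] that by (intro max_ideal_mult max_ideal_sub) auto
    then show ?thesis using nz[of 0] by simp
  qed (use f in simp)
  have fR: "f \<in> R"
    using mult_mem[of "f / h 0" "h 0"] f memR[of 0] nz[of 0] max_ideal_sub by simp
  obtain c where c: "\<exists>j\<le>n. coeff (c j) 0 \<noteq> 0" "(\<Sum>j\<le>n. eval_at \<kappa> (c j) f * h j) = 0"
    using dep unfolding dependent_over_def by meson
  define J where "J = {j. j \<le> n \<and> coeff (c j) 0 \<noteq> 0}"
  define m where "m = Max J"
  have "finite J" "J \<noteq> {}" using c(1) by (auto simp: J_def)
  then have m: "m \<le> n" "coeff (c m) 0 \<noteq> 0" and max: "\<And>j. j \<in> J \<Longrightarrow> j \<le> m"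
    using Max_in[of J] by (auto simp: m_def J_def)
  have other: "eval_at \<kappa> (c j) f * h j / h m \<in> \<mm>" if "j \<le> n" "j \<noteq> m" for j
  proof (cases "j < m")
    case True
    then show ?thesis
      using max_ideal_mult[OF lt[OF True m(1)] eval_mem[OF R fR, of "c j"]] by simp
  next
    case False
    then have "coeff (c j) 0 = 0" using max[of j] that by (auto simp: J_def)
    then obtain r where r: "r \<in> R" "eval_at \<kappa> (c j) f = f * r"
      using eval_split_mem[OF R fR, of "c j"] by auto
    have "r * h j * (f / h m) \<in> \<mm>"
      using fj[OF m(1)] r(1) memR[OF that(1)] by (intro max_ideal_mult mult_mem)
    then show ?thesis by (simp add: r(2) mult_ac)
  qed
  obtain r where r: "r \<in> R" "eval_at \<kappa> (c m) f = \<kappa> (coeff (c m) 0) + f * r"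
    using eval_split_mem[OF R fR, of "c m"] by auto
  have "0 = (\<Sum>j\<le>n. eval_at \<kappa> (c j) f * h j / h m)"
    using c(2) by (simp add: sum_divide_distrib[symmetric])
  also have "\<dots> = eval_at \<kappa> (c m) f * h m / h m + (\<Sum>j\<in>{..n} - {m}. eval_at \<kappa> (c j) f * h j / h m)"
    using m(1) by (subst sum.remove[of _ m]) auto
  finally have "eval_at \<kappa> (c m) f = - (\<Sum>j\<in>{..n} - {m}. eval_at \<kappa> (c j) f * h j / h m)"
    using nz[OF m(1)] by (simp add: eq_neg_iff_add_eq_0)
  also have "\<dots> \<in> \<mm>" by (intro max_ideal_minus max_ideal_sum other) auto
  finally have 1: "eval_at \<kappa> (c m) f \<in> \<mm>" .
  have "f * r \<in> \<mm>"
  proof -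
    have "(h m * r) * (f / h m) \<in> \<mm>" by (intro max_ideal_mult mult_mem fj memR m r(1))
    then show ?thesis using nz[OF m(1)] by (simp add: mult_ac)
  qed
  then have "\<kappa> (coeff (c m) 0) \<in> \<mm>"
    using max_ideal_diff[OF 1, of "f * r"] by (simp add: r(2))
  then show False using const_max_ideal_iff[OF R] m(2) by simp
qed

lemma max_ideal_nonzero:
  assumes R: "valuation_ring \<kappa> R"
  shows "\<exists>z\<in>max_ideal R. z \<noteq> 0"
proof -
  interpret val_ring R by (rule val_ring[OF R])
  obtain z where "z \<notin> R" using proper by blast
  then show ?thesis using not_mem_imp[of z] by (intro bexI[of _ "inverse z"]) auto
qed

lemma dependent_in_max_ideal:
  assumes R: "valuation_ring \<kappa> R" and "z \<in> max_ideal R" "z \<noteq> 0"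
  obtains f n where "dependent_over \<kappa> f n" "f / z \<in> R" "f \<in> max_ideal R" "f \<noteq> 0"
proof -
  interpret val_ring R by (rule val_ring[OF R])
  obtain f n where f: "dependent_over \<kappa> f n" "f / z \<in> R"
    using divides_dependent[OF assms] by blast
  have "f = f / z * z" using assms by simp
  then have "f \<in> \<mm>" using max_ideal_mult[OF assms(2) f(2)] by simp
  then show ?thesis using that f by (auto simp: dependent_over_def)
qed

text \<open>
  Start from an element of the maximal ideal and insert generators of larger and larger principal
  ideals; since such chains have bounded length, one ends at a generator of the maximal ideal.
\<close>
lemma uniformizer_exists:
  assumes R: "valuation_ring \<kappa> R"
  shows "\<exists>t. t \<noteq> 0 \<and> uniformizer R t"
proof -
  interpret val_ring R by (rule val_ring[OF R])
  obtain f n where dep: "dependent_over \<kappa> f n" and f: "f \<in> \<mm>" "f \<noteq> 0"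
    using max_ideal_nonzero[OF R] dependent_in_max_ideal[OF R] by metis
  define P where "P k \<longleftrightarrow> (\<exists>h. h 0 = f \<and> (\<forall>j\<le>k. h j \<noteq> 0) \<and>
    (\<forall>j<k. h j / h (Suc j) \<in> \<mm>) \<and> h k \<in> \<mm>)" for k
  have P0: "P 0" unfolding P_def using f by (intro exI[of _ "\<lambda>_. f"]) auto
  have bound: "k \<le> n" if Pk: "P k" for k
  proof (rule ccontr)
    assume k: "\<not> k \<le> n"
    obtain h where h: "h 0 = f" "\<And>j. j \<le> k \<Longrightarrow> h j \<noteq> 0" "\<And>j. j < k \<Longrightarrow> h j / h (Suc j) \<in> \<mm>" "h k \<in> \<mm>"
      using Pk unfolding P_def by blast
    define i where "i = k - Suc n"
    have i: "i + Suc n = k" using k by (simp add: i_def)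
    have "f / h i \<in> R" if "i \<le> k" for i
      using that
    proof (induction i)
      case 0 then show ?case using h(1) f by simp
    next
      case (Suc i)
      then have "f / h i * (h i / h (Suc i)) \<in> R" using h(3)[of i] max_ideal_sub by (intro mult_mem) auto
      then show ?case using h(2)[of i] Suc by simp
    qed
    then have "f / h i * (h i / h (Suc i)) \<in> \<mm>" using h(3)[of i] i by (intro max_ideal_mult) auto
    then have "f / h (Suc i) \<in> \<mm>" using h(2)[of i] i by simp
    then show False
      using chain_bounded[OF R dep, of "\<lambda>j. h (Suc i + j)"] h i max_ideal_sub by auto
  qed
  define k where "k = (GREATEST k. P k)"
  have k: "P k" unfolding k_def using GreatestI_nat[of P 0 n] P0 bound by blast
  have kmax: "\<not> P (Suc k)"
    using Greatest_le_nat[of P "Suc k" n] bound unfolding k_def by (metis Suc_n_not_le_n)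
  obtain h where h: "h 0 = f" "\<And>j. j \<le> k \<Longrightarrow> h j \<noteq> 0" "\<And>j. j < k \<Longrightarrow> h j / h (Suc j) \<in> \<mm>" "h k \<in> \<mm>"
    using k unfolding P_def by blast
  have gen: "z / h k \<in> R" if "z \<in> \<mm>" for z
  proof (rule ccontr)
    assume n: "z / h k \<notin> R"
    then have "z \<noteq> 0" by auto
    moreover have "h k / z \<in> \<mm>" using not_mem_imp[OF n] by simp
    ultimately have "P (Suc k)" unfolding P_def using h that
      by (intro exI[of _ "h(Suc k := z)"]) (auto simp: less_Suc_eq le_Suc_eq)
    then show False using kmax by blast
  qed
  have "\<mm> = (\<lambda>a. h k * a) ` R"
  proof (intro subset_antisym subsetI)
    fix z assume "z \<in> \<mm>"
    then show "z \<in> (\<lambda>a. h k * a) ` R" using gen h(2)[of k] by (intro image_eqI[of _ _ "z / h k"]) auto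
  next
    fix z assume "z \<in> (\<lambda>a. h k * a) ` R"
    then show "z \<in> \<mm>" using max_ideal_mult[OF h(4)] by (auto simp: mult.commute)
  qed
  then show ?thesis using h(2)[of k] unfolding uniformizer_def by blast
qed

text \<open>
  An element \<open>z\<close> divisible by all powers of a uniformizer would divide some \<open>f\<close> of bounded degree, and
  the powers of the uniformizer would be an unbounded chain above \<open>f\<close>.
\<close>
lemma dvr: assumes R: "valuation_ring \<kappa> R" shows "dvr R"
proof -
  interpret val_ring R by (rule val_ring[OF R])
  obtain t where t: "t \<noteq> 0" "uniformizer R t" using uniformizer_exists[OF R] by blast
  have tm: "a / t \<in> R \<longleftrightarrow> a \<in> \<mm>" for a
  proof
    assume "a / t \<in> R"
    then have "t * (a / t) \<in> \<mm>" using t(2) unfolding uniformizer_def by (elim ssubst) (rule imageI)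
    then show "a \<in> \<mm>" using t(1) by simp
  next
    assume "a \<in> \<mm>"
    then obtain b where "b \<in> R" "a = t * b" using t(2) by (auto simp: uniformizer_def)
    then show "a / t \<in> R" using t(1) by simp
  qed
  have "t / t \<in> R" using t(1) by simp
  then have t_mem: "t \<in> \<mm>" using tm by blast
  have tR: "t ^ k \<in> R" for k using power_mem max_ideal_sub[OF t_mem] by blast
  have *: "\<exists>n u. u \<in> R - \<mm> \<and> z = t powi n * u" if z: "z \<in> R" "z \<noteq> 0" for z
  proof (cases "z \<in> \<mm>")
    case False
    then show ?thesis using z by (intro exI[of _ "0::int"] exI[of _ z]) auto
  next
    case True
    obtain f n where f: "dependent_over \<kappa> f n" "f / z \<in> R" "f \<noteq> 0"
      using dependent_in_max_ideal[OF R True z(2)] by metis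
    have bound: "j \<le> n + 1" if "z / t ^ j \<in> R" for j
    proof (rule ccontr)
      assume j: "\<not> j \<le> n + 1"
      have "z / t ^ j * t ^ (j - (n + 2)) \<in> R" using that tR by (intro mult_mem)
      moreover have "t ^ j = t ^ (j - (n + 2)) * t ^ (n + 2)"
        unfolding power_add[symmetric] using j by (simp del: power_Suc add_2_eq_Suc')
      ultimately have "z / t ^ (n + 2) \<in> R" using t(1) by simp
      then have "f / z * (z / t ^ (n + 2)) * t \<in> \<mm>"
        using f(2) t_mem by (intro max_ideal_mult mult_mem)
      then have "f / t ^ Suc n \<in> \<mm>" using z(2) t(1) by simp
      then show False
        using t tR t_mem by (intro chain_bounded[OF R f(1), of "\<lambda>j. t ^ (Suc n - j)"])
          (auto simp: Suc_diff_le max_ideal_sub)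
    qed
    define k where "k = (GREATEST j. z / t ^ j \<in> R)"
    have k: "z / t ^ k \<in> R"
      unfolding k_def using GreatestI_nat[of "\<lambda>j. z / t ^ j \<in> R" 0 "n + 1"] bound z by simp
    have "z / t ^ Suc k \<notin> R"
      using Greatest_le_nat[of "\<lambda>j. z / t ^ j \<in> R" "Suc k" "n + 1"] bound unfolding k_def
      by (metis Suc_n_not_le_n)
    then have "z / t ^ k \<notin> \<mm>" using tm[of "z / t ^ k"] by (simp add: mult.commute)
    then show ?thesis using k t(1)
      by (intro exI[of _ "int k"] exI[of _ "z / t ^ k"]) auto
  qed
  have "\<exists>n u. u \<in> R - \<mm> \<and> z = t powi n * u" if z: "z \<noteq> 0" for z
  proof (cases "z \<in> R")
    case False
    then obtain n u where u: "u \<in> R - \<mm>" "inverse z = t powi n * u"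
      using *[of "inverse z"] total[of z] z by auto
    have "inverse u \<in> R - \<mm>" using u(1) unfolding unit_iff by auto
    moreover have "z = t powi (- n) * inverse u"
      using arg_cong[OF u(2), of inverse] by (simp add: power_int_minus)
    ultimately show ?thesis by blast
  qed (use * z in blast)
  then show ?thesis using t by unfold_locales blast
qed

end

section \<open>Residue fields\<close>

context function_field
begin

lemma card_const_gt_1: "CARD('k) > 1"
proof -
  have "card {0, 1 :: 'k} \<le> CARD('k)" by (rule card_mono) auto
  then show ?thesis by simp
qed

definition is_residue_basis :: "'f set \<Rightarrow> nat \<Rightarrow> 'f list \<Rightarrow> bool" where
  "is_residue_basis R n bs \<longleftrightarrow> length bs = n \<and> set bs \<subseteq> R \<and>
     (\<forall>z\<in>R. \<exists>!cs. length cs = n \<and> z - (\<Sum>i<n. \<kappa> (cs ! i) * bs ! i) \<in> max_ideal R)"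

text \<open>
  Elements of \<open>R\<close> with independent residues are independent over \<open>\<kappa>(f)\<close> for \<open>f\<close> in the maximal
  ideal, so there is a longest list of them, and this is a basis.
\<close>
lemma residue_basis_exists:
  assumes R: "valuation_ring \<kappa> R"
  shows "\<exists>n bs. is_residue_basis R n bs"
proof -
  interpret dvr R by (rule dvr[OF R])
  obtain f N where f: "dependent_over \<kappa> f N" "f \<in> \<mm>"
    using max_ideal_nonzero[OF R] dependent_in_max_ideal[OF R] by metis
  define indep where "indep bs \<longleftrightarrow> set bs \<subseteq> R \<and>
    (\<forall>c. (\<Sum>i<length bs. \<kappa> (c i) * bs ! i) \<in> \<mm> \<longrightarrow> (\<forall>i<length bs. c i = 0))" for bs
  have bound: "length bs \<le> N" if bs: "indep bs" for bs
  proof (rule ccontr)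
    assume "\<not> length bs \<le> N"
    then obtain c where c: "\<exists>j\<in>{..<length bs}. coeff (c j) 0 \<noteq> 0"
      "(\<Sum>j<length bs. eval_at \<kappa> (c j) f * bs ! j) = 0"
      using dependent_over_family[OF f(1), of "{..<length bs}" "(!) bs"] by auto
    have mem: "bs ! j \<in> R" if "j < length bs" for j using bs that unfolding indep_def by auto
    have *: "eval_at \<kappa> (c j) f * bs ! j - \<kappa> (coeff (c j) 0) * bs ! j \<in> \<mm>" if "j < length bs" for j
    proof -
      obtain r where r: "r \<in> R" "eval_at \<kappa> (c j) f = \<kappa> (coeff (c j) 0) + f * r"
        using eval_split_mem[OF R max_ideal_sub[OF f(2)], of "c j"] by auto
      have "(r * bs ! j) * f \<in> \<mm>" using f(2) r(1) mem[OF that] by (intro max_ideal_mult mult_mem)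
      then show ?thesis unfolding r(2) by (simp add: algebra_simps)
    qed
    have "(\<Sum>j<length bs. eval_at \<kappa> (c j) f * bs ! j - \<kappa> (coeff (c j) 0) * bs ! j) \<in> \<mm>"
      by (rule max_ideal_sum) (use * in auto)
    then have "(\<Sum>j<length bs. \<kappa> (coeff (c j) 0) * bs ! j) \<in> \<mm>"
      using c(2) max_ideal_minus by (fastforce simp: sum_subtractf)
    then show False using bs c(1) unfolding indep_def by auto
  qed
  have "indep []" by (simp add: indep_def)
  define n where "n = (GREATEST n. \<exists>bs. indep bs \<and> length bs = n)"
  have "\<exists>bs. indep bs \<and> length bs = n"
    unfolding n_def
  proof (rule GreatestI_nat)
    show "\<exists>bs. indep bs \<and> length bs = 0" using \<open>indep []\<close> by (intro exI[of _ "[]"]) simp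
    show "k \<le> N" if "\<exists>bs. indep bs \<and> length bs = k" for k using that bound by blast
  qed
  then obtain bs where bs: "indep bs" "length bs = n" by blast
  have max: "\<not> indep (bs @ [z])" for z
  proof
    assume "indep (bs @ [z])"
    then have "\<exists>bs. indep bs \<and> length bs = Suc n" using bs(2) by (intro exI[of _ "bs @ [z]"]) simp
    then have "Suc n \<le> n" unfolding n_def by (rule Greatest_le_nat) (use bound in blast)
    then show False by simp
  qed
  have ex: "\<exists>cs. length cs = n \<and> z - (\<Sum>i<n. \<kappa> (cs ! i) * bs ! i) \<in> \<mm>" if z: "z \<in> R" for z
  proof -
    have "set (bs @ [z]) \<subseteq> R" using bs(1) z by (auto simp: indep_def)
    then obtain c where c: "(\<Sum>i<Suc n. \<kappa> (c i) * (bs @ [z]) ! i) \<in> \<mm>" "\<exists>i<Suc n. c i \<noteq> 0"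
      using max[of z] bs(2) unfolding indep_def by auto
    have "(\<Sum>i<n. \<kappa> (c i) * (bs @ [z]) ! i) = (\<Sum>i<n. \<kappa> (c i) * bs ! i)"
      by (rule sum.cong) (auto simp: nth_append bs(2))
    then have 1: "(\<Sum>i<n. \<kappa> (c i) * bs ! i) + \<kappa> (c n) * z \<in> \<mm>"
      using c(1) by (simp add: nth_append bs(2))
    have cn: "c n \<noteq> 0"
    proof
      assume "c n = 0"
      then have "\<forall>i<n. c i = 0" using 1 bs unfolding indep_def by auto
      then show False using c(2) \<open>c n = 0\<close> less_Suc_eq by metis
    qed
    have "\<kappa> (inverse (c n)) * ((\<Sum>i<n. \<kappa> (c i) * bs ! i) + \<kappa> (c n) * z) \<in> \<mm>"
      using 1 const_mem[OF R] by (intro max_ideal_mult)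
    then have "z - (\<Sum>i<n. \<kappa> (- (inverse (c n) * c i)) * bs ! i) \<in> \<mm>"
      using cn by (simp add: algebra_simps hom_mult[symmetric] sum_distrib_left hom_minus sum_negf)
    then show ?thesis by (intro exI[of _ "map (\<lambda>i. - (inverse (c n) * c i)) [0..<n]"]) simp
  qed
  have indepD: "\<forall>i<n. c i = 0" if "(\<Sum>i<n. \<kappa> (c i) * bs ! i) \<in> \<mm>" for c
    using bs that unfolding indep_def by simp
  have un: "cs = ds" if "length cs = n" "length ds = n" "z - (\<Sum>i<n. \<kappa> (cs ! i) * bs ! i) \<in> \<mm>"
    "z - (\<Sum>i<n. \<kappa> (ds ! i) * bs ! i) \<in> \<mm>" for cs ds z
  proof -
    have "(\<Sum>i<n. \<kappa> (cs ! i - ds ! i) * bs ! i) \<in> \<mm>"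
      using max_ideal_diff[OF that(4,3)] by (simp add: hom_diff sum_subtractf left_diff_distrib)
    then have "\<forall>i<n. cs ! i - ds ! i = 0" by (rule indepD)
    then show ?thesis using that(1,2) by (auto intro: nth_equalityI)
  qed
  have "\<exists>!cs. length cs = n \<and> z - (\<Sum>i<n. \<kappa> (cs ! i) * bs ! i) \<in> \<mm>" if z: "z \<in> R" for z
  proof (rule ex_ex1I[OF ex[OF z]])
    fix cs ds
    assume "length cs = n \<and> z - (\<Sum>i<n. \<kappa> (cs ! i) * bs ! i) \<in> \<mm>"
      and "length ds = n \<and> z - (\<Sum>i<n. \<kappa> (ds ! i) * bs ! i) \<in> \<mm>"
    then show "cs = ds" using un[of cs ds z] by simp
  qed
  moreover have "set bs \<subseteq> R" using bs(1) by (simp add: indep_def)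
  ultimately have "is_residue_basis R n bs"
    unfolding is_residue_basis_def using bs(2) by simp
  then show ?thesis by blast
qed

text \<open>
  Residue classes correspond to coefficient lists, so their number determines the length.
\<close>
lemma residue_basis_length_le:
  assumes R: "valuation_ring \<kappa> R" and bs: "is_residue_basis R n bs" and bs': "is_residue_basis R n' bs'"
  shows "n \<le> n'"
proof -
  interpret dvr R by (rule dvr[OF R])
  define L where "L n = {xs :: 'k list. set xs \<subseteq> UNIV \<and> length xs = n}" for n
  have cardL: "card (L n) = CARD('k) ^ n" for n unfolding L_def by (rule card_lists_length_eq) simp
  define z where "z cs = (\<Sum>i<n. \<kappa> (cs ! i) * bs ! i)" for cs
  have zR: "z cs \<in> R" for cs
    using bs const_mem[OF R] unfolding z_def is_residue_basis_def
    by (intro sum_mem mult_mem) auto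
  have "\<exists>ds. length ds = n' \<and> z cs - (\<Sum>i<n'. \<kappa> (ds ! i) * bs' ! i) \<in> \<mm>" for cs
    using bs' zR[of cs] unfolding is_residue_basis_def by blast
  then obtain \<phi> where \<phi>: "\<And>cs. length (\<phi> cs) = n'" "\<And>cs. z cs - (\<Sum>i<n'. \<kappa> (\<phi> cs ! i) * bs' ! i) \<in> \<mm>"
    by metis
  have "inj_on \<phi> (L n)"
  proof (rule inj_onI)
    fix cs ds assume *: "cs \<in> L n" "ds \<in> L n" "\<phi> cs = \<phi> ds"
    have "z cs - z ds \<in> \<mm>" using max_ideal_diff[OF \<phi>(2)[of cs] \<phi>(2)[of ds]] *(3) by simp
    moreover have "z cs - z cs \<in> \<mm>" by simp
    moreover have "\<exists>!as. length as = n \<and> z cs - z as \<in> \<mm>"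
      using bs zR[of cs] unfolding is_residue_basis_def z_def by blast
    ultimately show "cs = ds" using * by (auto simp: L_def)
  qed
  moreover have "\<phi> ` L n \<subseteq> L n'" using \<phi>(1) by (auto simp: L_def)
  moreover have "finite (L n')" unfolding L_def by (rule finite_lists_length_eq) simp
  ultimately have "CARD('k) ^ n \<le> CARD('k) ^ n'" using card_inj_on_le cardL by metis
  then show ?thesis using card_const_gt_1 power_le_imp_le_exp by blast
qed

lemma residue_basis:
  assumes R: "valuation_ring \<kappa> R"
  shows "\<exists>bs. is_residue_basis R (place_degree \<kappa> R) bs"
proof -
  obtain n bs where bs: "is_residue_basis R n bs" using residue_basis_exists[OF R] by blast
  have "place_degree \<kappa> R = n"
    unfolding place_degree_def is_residue_basis_def[symmetric]
    using bs residue_basis_length_le[OF R] by (intro the_equality) (auto intro: le_antisym)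
  then show ?thesis using bs by blast
qed

lemma residue_representatives:
  assumes R: "valuation_ring \<kappa> R"
  obtains b where "\<And>i. i < place_degree \<kappa> R \<Longrightarrow> b i \<in> R"
    "\<And>c. (\<Sum>i<place_degree \<kappa> R. \<kappa> (c i) * b i) \<in> max_ideal R \<Longrightarrow> \<forall>i<place_degree \<kappa> R. c i = 0"
    "\<And>z. z \<in> R \<Longrightarrow> \<exists>c. z - (\<Sum>i<place_degree \<kappa> R. \<kappa> (c i) * b i) \<in> max_ideal R"
proof -
  interpret dvr R by (rule dvr[OF R])
  define d where "d = place_degree \<kappa> R"
  obtain bs where bs: "is_residue_basis R d bs" using residue_basis[OF R] d_def by blast
  have "\<forall>i<d. c i = 0" if c: "(\<Sum>i<d. \<kappa> (c i) * bs ! i) \<in> \<mm>" for c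
  proof -
    have "\<exists>!cs. length cs = d \<and> 0 - (\<Sum>i<d. \<kappa> (cs ! i) * bs ! i) \<in> \<mm>"
      using bs zero_mem unfolding is_residue_basis_def by blast
    moreover have "0 - (\<Sum>i<d. \<kappa> (map c [0..<d] ! i) * bs ! i) \<in> \<mm>"
      using max_ideal_minus[OF c] by simp
    moreover have "0 - (\<Sum>i<d. \<kappa> (replicate d 0 ! i) * bs ! i) \<in> \<mm>"
      by simp
    ultimately have "map c [0..<d] = replicate d 0" by (metis length_map length_replicate diff_zero length_upt)
    then show ?thesis by (metis add_0 diff_zero length_upt nth_map nth_replicate nth_upt)
  qed
  moreover have "\<exists>c. z - (\<Sum>i<d. \<kappa> (c i) * bs ! i) \<in> \<mm>" if "z \<in> R" for z
    using bs that unfolding is_residue_basis_def by blast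
  moreover have "bs ! i \<in> R" if "i < d" for i
    using bs that unfolding is_residue_basis_def by auto
  ultimately show ?thesis using that[of "(!) bs"] unfolding d_def by blast
qed

lemma place_degree_pos: "valuation_ring \<kappa> R \<Longrightarrow> place_degree \<kappa> R > 0"
proof (rule ccontr)
  assume R: "valuation_ring \<kappa> R" and 0: "\<not> place_degree \<kappa> R > 0"
  interpret dvr R by (rule dvr[OF R])
  obtain b where "\<And>z. z \<in> R \<Longrightarrow> \<exists>c. z - (\<Sum>i<place_degree \<kappa> R. \<kappa> (c i) * b i) \<in> \<mm>"
    using residue_representatives[OF R] by metis
  from this[OF one_mem] show False using 0 one_notin_max by simp
qed

lemma residue_map:
  assumes R: "valuation_ring \<kappa> R"
  obtains \<rho> :: "'f \<Rightarrow> 'k list" where "\<And>z. length (\<rho> z) = place_degree \<kappa> R"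
    "\<And>z w. z \<in> R \<Longrightarrow> w \<in> R \<Longrightarrow> \<rho> z = \<rho> w \<Longrightarrow> z - w \<in> max_ideal R"
proof -
  interpret dvr R by (rule dvr[OF R])
  let ?d = "place_degree \<kappa> R"
  obtain b where "\<And>z. z \<in> R \<Longrightarrow> \<exists>c. z - (\<Sum>i<?d. \<kappa> (c i) * b i) \<in> \<mm>"
    using residue_representatives[OF R] by metis
  then obtain c where c: "\<And>z. z \<in> R \<Longrightarrow> z - (\<Sum>i<?d. \<kappa> (c z i) * b i) \<in> \<mm>" by metis
  have "z - w \<in> \<mm>" if "z \<in> R" "w \<in> R" "map (c z) [0..<?d] = map (c w) [0..<?d]" for z w
  proof -
    have "(\<Sum>i<?d. \<kappa> (c z i) * b i) = (\<Sum>i<?d. \<kappa> (c w i) * b i)"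
      using that(3) by (intro sum.cong) auto
    then show ?thesis using max_ideal_diff[OF c[OF that(1)] c[OF that(2)]] by simp
  qed
  then show ?thesis using that[of "\<lambda>z. map (c z) [0..<?d]"] by auto
qed


section \<open>Weak approximation and the degree of a zero divisor\<close>

text \<open>
  An overring of \<open>R\<close> with one element of negative order at \<open>R\<close> has all its powers, and these
  absorb the poles of every other element.
\<close>
lemma valuation_ring_maximal:
  assumes R: "valuation_ring \<kappa> R" and R': "valuation_ring \<kappa> R'" and "R \<subseteq> R'"
  shows "R = R'"
proof (rule ccontr)
  assume "R \<noteq> R'"
  then obtain z where z: "z \<in> R'" "z \<notin> R" using assms(3) by blast
  interpret dvr R by (rule dvr[OF R])
  interpret R': val_ring R' by (rule val_ring[OF R'])
  have z0: "z \<noteq> 0" "ord_at R z < 0" using z(2) mem_iff_ord[of z] by (cases "z = 0", auto)+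
  have "w \<in> R'" for w
  proof (cases "w = 0")
    case False
    define k where "k = nat \<bar>ord_at R w\<bar>"
    have "int k * ord_at R z \<le> int k * (-1)" using z0 by (intro mult_left_mono) auto
    then have "ord_at R (w / z ^ k) \<ge> 0"
      using False z0 by (simp add: ord_divide ord_power k_def)
    then have "w / z ^ k \<in> R'" using mem_iff_ord[of "w / z ^ k"] False z0 assms(3) by auto
    then have "w / z ^ k * z ^ k \<in> R'" using R'.mult_mem R'.power_mem z(1) by blast
    then show ?thesis using z0 by simp
  qed simp
  then show False using R'.proper by blast
qed

lemma separate_two:
  assumes R: "valuation_ring \<kappa> R" and R': "valuation_ring \<kappa> R'" and "R \<noteq> R'"
  shows "\<exists>z. z \<in> max_ideal R \<and> z \<notin> R'"
proof -
  interpret val_ring R by (rule val_ring[OF R])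
  interpret R': val_ring R' by (rule val_ring[OF R'])
  obtain a b where ab: "a \<in> R" "a \<notin> R'" "b \<in> R'" "b \<notin> R"
    using valuation_ring_maximal[OF R R'] valuation_ring_maximal[OF R' R] assms(3) by blast
  have b: "inverse b \<in> \<mm>" "b \<noteq> 0" using not_mem_imp[OF ab(4)] by auto
  have "a * inverse b \<in> \<mm>" using max_ideal_mult b ab by blast
  moreover have "a * inverse b \<notin> R'"
    using R'.mult_mem[of "a * inverse b" b] ab b by (auto simp: mult.assoc)
  ultimately show ?thesis by blast
qed

text \<open>
  Induction on the number of places: a large power of an element with poles at the old places is
  added to an element with a pole at the new one.
\<close>
lemma separate:
  assumes "finite S" "valuation_ring \<kappa> R" "\<And>R'. R' \<in> S \<Longrightarrow> valuation_ring \<kappa> R' \<and> R' \<noteq> R"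
  shows "\<exists>z. z \<in> max_ideal R \<and> (\<forall>R'\<in>S. z \<notin> R')"
  using assms(1,3)
proof (induction S)
  case empty
  show ?case using max_ideal_nonzero[OF assms(2)] by blast
next
  case (insert R2 S)
  interpret dvr R by (rule dvr[OF assms(2)])
  obtain z where z: "z \<in> \<mm>" "\<forall>R'\<in>S. z \<notin> R'" using insert by blast
  have R2: "valuation_ring \<kappa> R2" "R2 \<noteq> R" using insert by auto
  interpret R2: dvr R2 by (rule dvr[OF R2(1)])
  show ?case
  proof (cases "z \<in> R2")
    case False
    then show ?thesis using z by blast
  next
    case True
    obtain u where u: "u \<in> \<mm>" "u \<notin> R2" using separate_two[OF assms(2) R2(1)] R2(2) by blast
    define N where "N = Suc (\<Sum>R'\<in>S. nat \<bar>ord_at R' u\<bar>)"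
    define w where "w = z ^ N + u"
    have "z ^ N \<in> \<mm>"
      using max_ideal_mult[OF z(1), of "z ^ (N - 1)"] power_mem max_ideal_sub[OF z(1)]
      by (simp add: N_def mult.commute)
    then have "w \<in> \<mm>" unfolding w_def using u(1) max_ideal_add by blast
    moreover have "w \<notin> R2"
      using R2.diff_mem[of w "z ^ N"] R2.power_mem[OF True] u(2) by (auto simp: w_def)
    moreover have "w \<notin> R'" if "R' \<in> S" for R'
    proof -
      have "valuation_ring \<kappa> R'" using insert that by blast
      then interpret R': dvr R' by (rule dvr)
      have z0: "z \<noteq> 0" using z(2) that by (metis R'.zero_mem)
      have u0: "u \<noteq> 0" using u(2) by auto
      have neg: "ord_at R' z \<le> -1" using R'.mem_iff_ord[OF z0] z(2) that by auto
      have "nat \<bar>ord_at R' u\<bar> \<le> (\<Sum>R'\<in>S. nat \<bar>ord_at R' u\<bar>)"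
        using that insert.hyps by (intro member_le_sum) auto
      then have N: "\<bar>ord_at R' u\<bar> < int N" unfolding N_def by linarith
      have "int N * ord_at R' z \<le> int N * (-1)" using neg by (intro mult_left_mono) auto
      then have lt: "ord_at R' (z ^ N) < ord_at R' u" "ord_at R' (z ^ N) < 0"
        using N R'.ord_power[OF z0, of N] by linarith+
      have "w \<noteq> 0" "ord_at R' w = ord_at R' (z ^ N)"
        unfolding w_def using R'.ord_add_eq[of "z ^ N" u] z0 lt by auto
      then show ?thesis using lt(2) R'.mem_iff_ord[of w] by simp
    qed
    ultimately show ?thesis by blast
  qed
qed

text \<open>
  If \<open>w\<close> vanishes at \<open>R\<close> and has poles at the other places, \<open>1 / (1 + w)\<close> is close to \<open>1\<close> at \<open>R\<close> and
  close to \<open>0\<close> elsewhere.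
\<close>
lemma approximate_indicator:
  assumes "finite S" "valuation_ring \<kappa> R" "\<And>R'. R' \<in> S \<Longrightarrow> valuation_ring \<kappa> R' \<and> R' \<noteq> R"
  shows "\<exists>e. dvr.vge R (int n) (1 - e) \<and> (\<forall>R'\<in>S. dvr.vge R' (int n) e)"
proof -
  interpret dvr R by (rule dvr[OF assms(2)])
  obtain z where z: "z \<in> \<mm>" "\<forall>R'\<in>S. z \<notin> R'" using separate[OF assms] by blast
  define w where "w = z ^ Suc n"
  define e where "e = inverse (1 + w)"
  have w: "w \<in> \<mm>" unfolding w_def
    using max_ideal_mult[OF z(1), of "z ^ n"] power_mem max_ideal_sub[OF z(1)]
    by (simp add: mult.commute)
  have w1: "1 + w \<notin> \<mm>" using max_ideal_diff[of "1 + w" w] w one_notin_max by auto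
  then have nz: "1 + w \<noteq> 0" by auto
  have unit: "1 + w \<in> R - \<mm>" using w1 w by (auto intro: add_mem max_ideal_sub)
  have "1 - e = w / (1 + w)" using nz by (simp add: e_def field_simps)
  moreover have "vge (int n) (w / (1 + w))"
  proof (cases "z = 0")
    case False
    have "ord_at R z \<ge> 1" using max_ideal_iff_ord[OF False] z(1) by simp
    then have "int n * 1 \<le> int (Suc n) * ord_at R z" by (intro mult_mono) auto
    then have "int n \<le> int (Suc n) * ord_at R z" by simp
    then show ?thesis using False nz ord_unit[OF unit] ord_power[OF False, of "Suc n"]
      by (simp add: vge_def ord_divide w_def del: power_Suc)
  qed (simp add: w_def)
  moreover have "dvr.vge R' (int n) e" if "R' \<in> S" for R'
  proof -
    have "valuation_ring \<kappa> R'" using assms(3) that by blast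
    then interpret R': dvr R' by (rule dvr)
    have z0: "z \<noteq> 0" using z(2) that by (metis R'.zero_mem)
    have neg: "ord_at R' z \<le> -1" using R'.mem_iff_ord[OF z0] z(2) that by auto
    then have "int (Suc n) * ord_at R' z \<le> int (Suc n) * (-1)" by (intro mult_left_mono) auto
    then have ow: "ord_at R' w \<le> - int (Suc n)" using R'.ord_power[OF z0, of "Suc n"] by (simp add: w_def)
    have "ord_at R' (w + 1) = ord_at R' w"
      using R'.ord_add_eq[of w 1] ow z0 by (simp add: w_def)
    then have "ord_at R' e = - ord_at R' w" unfolding e_def using nz by (simp add: R'.ord_inverse add.commute)
    then show ?thesis using ow unfolding R'.vge_def by simp
  qed
  ultimately show ?thesis by (intro exI[of _ e]) simp
qed

lemma weak_approximation:
  assumes "finite S" "\<And>R. R \<in> S \<Longrightarrow> valuation_ring \<kappa> R"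
  shows "\<exists>z. \<forall>R\<in>S. dvr.vge R n (z - a R)"
proof -
  define N where "N = nat \<bar>n\<bar> + (\<Sum>R\<in>S. \<Sum>R'\<in>S. nat \<bar>ord_at R' (a R)\<bar>)"
  have "\<exists>e. dvr.vge R (int N) (1 - e) \<and> (\<forall>R'\<in>S - {R}. dvr.vge R' (int N) e)" if "R \<in> S" for R
    using approximate_indicator[of "S - {R}" R N] assms that by auto
  then obtain e where e: "\<And>R. R \<in> S \<Longrightarrow> dvr.vge R (int N) (1 - e R)"
    "\<And>R R'. R \<in> S \<Longrightarrow> R' \<in> S \<Longrightarrow> R' \<noteq> R \<Longrightarrow> dvr.vge R' (int N) (e R)"
    by (metis DiffI singletonD)
  define z where "z = (\<Sum>R\<in>S. e R * a R)"
  have "dvr.vge R n (z - a R)" if RS: "R \<in> S" for R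
  proof -
    interpret dvr R using dvr assms(2) RS by blast
    have big: "int N + ord_at R (a R') \<ge> n" if "R' \<in> S" for R'
    proof -
      have "nat \<bar>ord_at R (a R')\<bar> \<le> (\<Sum>R2\<in>S. nat \<bar>ord_at R2 (a R')\<bar>)"
        using RS assms(1) by (intro member_le_sum) auto
      also have "\<dots> \<le> (\<Sum>R1\<in>S. \<Sum>R2\<in>S. nat \<bar>ord_at R2 (a R1)\<bar>)"
        using that assms(1) by (intro member_le_sum) auto
      finally show ?thesis unfolding N_def by linarith
    qed
    have 1: "vge n (e R' * a R')" if "R' \<in> S - {R}" for R'
      using vge_mono[OF vge_mult[OF e(2)[of R' R] vge_ord] big] that RS by auto
    have 2: "vge n (- ((1 - e R) * a R))"
      using vge_mono[OF vge_mult[OF e(1)[OF RS] vge_ord] big[OF RS]] by simp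
    have "z - a R = - ((1 - e R) * a R) + (\<Sum>R'\<in>S - {R}. e R' * a R')"
      unfolding z_def using RS assms(1) by (simp add: sum.remove[of S R] algebra_simps)
    then show ?thesis using vge_add[OF 2 vge_sum[of "S - {R}", OF 1]] by simp
  qed
  then show ?thesis by blast
qed

text \<open>
  The residue classes \<open>t^j b_i\<close> at the zeros of \<open>f\<close> lift, by weak approximation, to elements
  that are independent modulo \<open>f\<close> and hence over \<open>\<kappa>[f]\<close>.
\<close>
lemma sum_ord_degree_le:
  assumes dep: "dependent_over \<kappa> f n" and S: "finite S" "\<And>R. R \<in> S \<Longrightarrow> valuation_ring \<kappa> R \<and> f \<in> max_ideal R"
  shows "(\<Sum>R\<in>S. nat (ord_at R f) * place_degree \<kappa> R) \<le> n"
proof (rule ccontr)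
  assume contra: "\<not> ?thesis"
  have f0: "f \<noteq> 0" using dep by (simp add: dependent_over_def)
  have val: "valuation_ring \<kappa> R" if "R \<in> S" for R using S that by blast
  let ?d = "place_degree \<kappa>" and ?e = "\<lambda>R. nat (ord_at R f)"
  have "\<exists>b. (\<forall>i<?d R. b i \<in> R) \<and> (\<forall>c. (\<Sum>i<?d R. \<kappa> (c i) * b i) \<in> max_ideal R \<longrightarrow> (\<forall>i<?d R. c i = 0))"
    if "R \<in> S" for R
    using residue_representatives[OF val[OF that]] by metis
  then obtain b where b: "\<And>R i. R \<in> S \<Longrightarrow> i < ?d R \<Longrightarrow> b R i \<in> R"
    "\<And>R c i. R \<in> S \<Longrightarrow> (\<Sum>i<?d R. \<kappa> (c i) * b R i) \<in> max_ideal R \<Longrightarrow> i < ?d R \<Longrightarrow> c i = 0"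
    by metis
  obtain t where t: "\<And>R. R \<in> S \<Longrightarrow> uniformizer R (t R)"
    using dvr.uniformizer_ex[OF dvr[OF val]] by metis
  define J where "J = (SIGMA R:S. {..<?e R} \<times> {..<?d R})"
  have "card J = (\<Sum>R\<in>S. ?e R * ?d R)" unfolding J_def using S(1) by (simp add: card_SigmaI)
  then have card: "card J > n" using contra by simp
  have finJ: "finite J" unfolding J_def using S(1) by auto
  define N where "N = (\<Sum>R\<in>S. \<bar>ord_at R f\<bar>)"
  have N: "ord_at R f \<le> N" if "R \<in> S" for R
  proof -
    have "\<bar>ord_at R f\<bar> \<le> N" unfolding N_def using that S(1) by (intro member_le_sum) auto
    then show ?thesis by linarith
  qed
  have "\<exists>g. \<forall>p\<in>J. case p of (R, j, i) \<Rightarrow>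
      \<forall>R'\<in>S. dvr.vge R' N (g p - (if R' = R then t R ^ j * b R i else 0))"
  proof (intro bchoice ballI)
    fix p assume "p \<in> J"
    obtain R j i where p: "p = (R, j, i)" by (cases p)
    show "\<exists>g. case p of (R, j, i) \<Rightarrow>
      \<forall>R'\<in>S. dvr.vge R' N (g - (if R' = R then t R ^ j * b R i else 0))"
      using weak_approximation[OF S(1) val, of N "\<lambda>R'. if R' = R then t R ^ j * b R i else 0"]
      by (simp add: p)
  qed
  then obtain g where g: "\<And>R j i R'. (R, j, i) \<in> J \<Longrightarrow> R' \<in> S \<Longrightarrow>
      dvr.vge R' N (g (R, j, i) - (if R' = R then t R ^ j * b R i else 0))"
    by fastforce
  obtain c where c: "\<exists>p\<in>J. coeff (c p) 0 \<noteq> 0" "(\<Sum>p\<in>J. eval_at \<kappa> (c p) f * g p) = 0"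
    using dependent_over_family[OF dep finJ card] by blast
  obtain R j1 i1 where p1: "(R, j1, i1) \<in> J" "coeff (c (R, j1, i1)) 0 \<noteq> 0" using c(1) by (metis prod_cases3)
  have RS: "R \<in> S" using p1 by (simp add: J_def)
  define j0 where "j0 = (LEAST j. \<exists>i. (R, j, i) \<in> J \<and> coeff (c (R, j, i)) 0 \<noteq> 0)"
  have "\<exists>i. (R, j0, i) \<in> J \<and> coeff (c (R, j0, i)) 0 \<noteq> 0"
    unfolding j0_def by (rule LeastI_ex) (use p1 in blast)
  then obtain i0 where i0: "(R, j0, i0) \<in> J" "coeff (c (R, j0, i0)) 0 \<noteq> 0" by blast
  have least: "coeff (c (R, j, i)) 0 = 0" if "j < j0" "(R, j, i) \<in> J" for j i
    using not_less_Least[of j] that unfolding j0_def by blast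
  interpret dvr R by (rule dvr[OF val[OF RS]])
  let ?t = "t R" and ?k = "\<lambda>p. \<kappa> (coeff (c p) 0)"
  have t0: "?t \<noteq> 0" "?t \<in> \<mm>" using uniformizer_nonzero[OF t[OF RS]] by auto
  have tj: "vge (int j) (?t ^ j)" for j
    using t0 by (simp add: vge_def ord_power ord_uniformizer[OF t[OF RS]])
  have bR: "vge 0 (b R i)" if "i < ?d R" for i using b(1)[OF RS that] vge_mem by blast
  have kR: "vge 0 (\<kappa> a)" for a using const_mem[OF val[OF RS]] vge_mem by blast
  have fR: "f \<in> R" using S(2)[OF RS] max_ideal_sub by blast
  have j0e: "int j0 + 1 \<le> ord_at R f" using i0(1) by (auto simp: J_def)
  then have vf: "vge (int j0 + 1) f" by (simp add: vge_def)
  have j0N: "int j0 + 1 \<le> N" using j0e N[OF RS] by linarith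
  have N0: "0 \<le> N" using j0N by linarith
  have gR: "g p \<in> R" if "p \<in> J" for p
  proof -
    obtain R' j i where p: "p = (R', j, i)" by (cases p)
    have "vge 0 (g p - (if R = R' then t R' ^ j * b R' i else 0))"
      using g[of R' j i R] that RS p vge_mono N0 by blast
    moreover have "vge 0 (if R = R' then t R' ^ j * b R' i else 0)"
      using that vge_mono[OF vge_mult[OF tj bR, of i j], of 0] by (auto simp: p J_def)
    ultimately have "vge 0 (g p)" using vge_add by fastforce
    then show ?thesis by (simp add: vge_mem)
  qed
  define lead where "lead p = (case p of (R', j, i) \<Rightarrow> if R' = R \<and> j = j0 then ?k p * (?t ^ j0 * b R i) else 0)" for p
  have 1: "vge (int j0 + 1) (eval_at \<kappa> (c p) f * g p - ?k p * g p)" if "p \<in> J" for p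
  proof -
    obtain r where r: "r \<in> R" "eval_at \<kappa> (c p) f = ?k p + f * r"
      using eval_split_mem[OF val[OF RS] fR, of "c p"] by auto
    have "vge (int j0 + 1 + 0) (f * (r * g p))"
      by (intro vge_mult vf) (use r gR[OF that] mult_mem vge_mem in blast)
    then show ?thesis unfolding r(2) by (simp add: algebra_simps)
  qed
  have 2: "vge (int j0 + 1) (?k p * g p - lead p)" if "p \<in> J" for p
  proof -
    obtain R' j i where p: "p = (R', j, i)" by (cases p)
    have gp: "vge (int j0 + 1) (g p - (if R = R' then t R' ^ j * b R' i else 0))"
      using g[of R' j i R] that RS p vge_mono j0N by blast
    show ?thesis
    proof (cases "R' = R \<and> j \<le> j0")
      case False
      have "vge (int j0 + 1) (if R = R' then t R' ^ j * b R' i else 0)"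
        using that vge_mono[OF vge_mult[OF tj bR, of i j], of "int j0 + 1"] False by (auto simp: p J_def)
      then have "vge (int j0 + 1) (g p)" using vge_add[OF gp] by fastforce
      then have "vge (0 + (int j0 + 1)) (?k p * g p)" by (intro vge_mult kR)
      then show ?thesis using False by (auto simp: lead_def p)
    next
      case True
      show ?thesis
      proof (cases "j = j0")
        case True
        then have "vge (0 + (int j0 + 1)) (?k p * (g p - ?t ^ j0 * b R i))"
          using gp \<open>R' = R \<and> j \<le> j0\<close> by (intro vge_mult kR) auto
        then show ?thesis using True \<open>R' = R \<and> j \<le> j0\<close> by (simp add: lead_def p algebra_simps)
      next
        case False
        then show ?thesis using least[of j i] that \<open>R' = R \<and> j \<le> j0\<close> by (auto simp: lead_def p)
      qed
    qed
  qed
  have "vge (int j0 + 1) (\<Sum>p\<in>J. eval_at \<kappa> (c p) f * g p - lead p)"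
  proof (rule vge_sum)
    fix p assume "p \<in> J"
    from vge_add[OF 1[OF this] 2[OF this]]
    show "vge (int j0 + 1) (eval_at \<kappa> (c p) f * g p - lead p)" by simp
  qed
  then have "vge (int j0 + 1) (- (\<Sum>p\<in>J. lead p))" by (simp add: sum_subtractf c(2))
  then have v: "vge (int j0 + 1) (\<Sum>p\<in>J. lead p)" by simp
  have "(\<Sum>p\<in>J. lead p) = (\<Sum>p\<in>(\<lambda>i. (R, j0, i)) ` {..<?d R}. lead p)"
    using i0(1) finJ by (intro sum.mono_neutral_right) (auto simp: J_def lead_def)
  also have "\<dots> = (\<Sum>i<?d R. lead (R, j0, i))"
    by (subst sum.reindex) (auto simp: inj_on_def)
  also have "\<dots> = (\<Sum>i<?d R. \<kappa> (coeff (c (R, j0, i)) 0) * b R i) * ?t ^ j0"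
    unfolding sum_distrib_right by (rule sum.cong) (auto simp: lead_def mult_ac)
  finally have "vge 1 ((\<Sum>i<?d R. \<kappa> (coeff (c (R, j0, i)) 0) * b R i) * ?t ^ j0 / ?t ^ j0)"
    using v t0 by (subst vge_iff_divide) (auto simp: ord_power ord_uniformizer[OF t[OF RS]] add.commute)
  then have "(\<Sum>i<?d R. \<kappa> (coeff (c (R, j0, i)) 0) * b R i) \<in> \<mm>"
    using t0 by (simp add: vge_max_ideal)
  then show False using b(2)[OF RS, of "\<lambda>i. coeff (c (R, j0, i)) 0" i0] i0 by (auto simp: J_def)
qed

end

section \<open>Riemann--Roch spaces over a finite field\<close>

context field_embedding
begin

lemma vector_space_scale: "vector_space (scale_by \<kappa>)"
  by unfold_locales (auto simp: scale_by_def hom_add hom_mult algebra_simps)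

end

context function_field
begin

text \<open>
  Over a finite field dimensions are read off from cardinalities, which need no bases and behave
  well under maps.
\<close>
lemma subspace_card:
  assumes fin: "finite V" and sub: "module.subspace (scale_by \<kappa>) V"
  shows "card V = CARD('k) ^ vector_space.dim (scale_by \<kappa>) V"
proof -
  interpret vs: vector_space "scale_by \<kappa>" by (rule vector_space_scale)
  obtain B where B: "B \<subseteq> V" "vs.independent B" "V \<subseteq> vs.span B" "card B = vs.dim V"
    by (rule vs.basis_exists)
  have finB: "finite B" using B(1) fin finite_subset by blast
  have spanB: "vs.span B = V" using B(1,3) sub vs.span_minimal by blast
  define \<phi> where "\<phi> c = (\<Sum>b\<in>B. scale_by \<kappa> (c b) b)" for c
  have "bij_betw \<phi> (B \<rightarrow>\<^sub>E UNIV) V"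
    unfolding bij_betw_def
  proof
    show "inj_on \<phi> (B \<rightarrow>\<^sub>E UNIV)"
    proof (rule inj_onI)
      fix c d assume cd: "c \<in> B \<rightarrow>\<^sub>E UNIV" "d \<in> B \<rightarrow>\<^sub>E UNIV" "\<phi> c = \<phi> d"
      have "(\<Sum>b\<in>B. scale_by \<kappa> (c b - d b) b) = 0"
        using cd(3) by (simp add: \<phi>_def vs.scale_left_diff_distrib sum_subtractf)
      then have "c b - d b = 0" if "b \<in> B" for b
        using vs.independentD[OF B(2) finB order_refl, of "\<lambda>b. c b - d b"] that by blast
      then show "c = d" using cd by (intro PiE_ext[of c B "\<lambda>_. UNIV"]) auto
    qed
    show "\<phi> ` (B \<rightarrow>\<^sub>E UNIV) = V"
    proof -
      have "\<phi> ` (B \<rightarrow>\<^sub>E UNIV) = range \<phi>"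
      proof (intro subset_antisym subsetI)
        fix z assume "z \<in> range \<phi>"
        then obtain c where "z = \<phi> c" by blast
        then have "z = \<phi> (restrict c B)" by (simp add: \<phi>_def cong: sum.cong)
        then show "z \<in> \<phi> ` (B \<rightarrow>\<^sub>E UNIV)" by auto
      qed blast
      then show ?thesis using vs.span_finite[OF finB] spanB by (simp add: \<phi>_def)
    qed
  qed
  then have "card V = card (B \<rightarrow>\<^sub>E (UNIV :: 'k set))" using bij_betw_same_card by fastforce
  also have "\<dots> = CARD('k) ^ card B" using finB by (simp add: card_PiE)
  finally show ?thesis using B(4) by simp
qed

lemma riemann_roch_space_iff:
  "z \<in> riemann_roch_space \<kappa> D \<longleftrightarrow> (\<forall>R. valuation_ring \<kappa> R \<longrightarrow> dvr.vge R (- D R) z)"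
proof (cases "z = 0")
  case True
  then show ?thesis using dvr.vge_0[OF dvr] by (auto simp: riemann_roch_space_def)
next
  case False
  then show ?thesis using dvr.vge_def[OF dvr] by (auto simp: riemann_roch_space_def)
qed

lemma riemann_roch_space_subspace: "module.subspace (scale_by \<kappa>) (riemann_roch_space \<kappa> D)"
proof -
  interpret vs: vector_space "scale_by \<kappa>" by (rule vector_space_scale)
  show ?thesis
  proof (rule vs.subspaceI)
    show "0 \<in> riemann_roch_space \<kappa> D" by (simp add: riemann_roch_space_def)
  next
    fix x y assume *: "x \<in> riemann_roch_space \<kappa> D" "y \<in> riemann_roch_space \<kappa> D"
    then show "x + y \<in> riemann_roch_space \<kappa> D"
      unfolding riemann_roch_space_iff using dvr.vge_add[OF dvr] by blast
  next
    fix c x assume *: "x \<in> riemann_roch_space \<kappa> D"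
    have "dvr.vge R (0 + - D R) (\<kappa> c * x)" if R: "valuation_ring \<kappa> R" for R
    proof -
      interpret dvr R by (rule dvr[OF R])
      show ?thesis using * R const_mem[OF R]
        by (intro vge_mult) (auto simp: riemann_roch_space_iff vge_mem)
    qed
    then show "scale_by \<kappa> c x \<in> riemann_roch_space \<kappa> D"
      by (simp add: riemann_roch_space_iff scale_by_def)
  qed
qed

lemma card_riemann_roch_space:
  "finite (riemann_roch_space \<kappa> D) \<Longrightarrow> card (riemann_roch_space \<kappa> D) = CARD('k) ^ divisor_dim \<kappa> D"
  unfolding divisor_dim_def by (rule subspace_card[OF _ riemann_roch_space_subspace])

lemma card_le_fibres:
  fixes V U :: "'f set" and g :: "'f \<Rightarrow> 'b"
  assumes "finite V" "finite U" "finite Q" "g ` V \<subseteq> Q"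
    and diff: "\<And>z w. z \<in> V \<Longrightarrow> w \<in> V \<Longrightarrow> g z = g w \<Longrightarrow> z - w \<in> U"
  shows "card V \<le> card U * card Q"
proof -
  have "card {z \<in> V. g z = c} \<le> card U" if "c \<in> Q" for c
  proof (cases "\<exists>w\<in>V. g w = c")
    case True
    then obtain w where w: "w \<in> V" "g w = c" by blast
    show ?thesis using assms(2) diff w
      by (intro card_inj_on_le[of "\<lambda>z. z - w"]) (auto simp: inj_on_def)
  next
    case False
    then have "{z \<in> V. g z = c} = {}" by auto
    then show ?thesis by (simp only: card.empty)
  qed
  then have "(\<Sum>c\<in>Q. card {z \<in> V. g z = c}) \<le> (\<Sum>c\<in>Q. card U)" by (rule sum_mono)
  moreover have "card V = (\<Sum>c\<in>Q. card {z \<in> V. g z = c})"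
  proof -
    have "V = (\<Union>c\<in>Q. {z \<in> V. g z = c})" using assms(4) by auto
    then have "card V = card (\<Union>c\<in>Q. {z \<in> V. g z = c})" by simp
    also have "\<dots> = (\<Sum>c\<in>Q. card {z \<in> V. g z = c})"
      using assms(1,3) by (intro card_UN_disjoint) auto
    finally show ?thesis .
  qed
  ultimately show ?thesis by (simp add: mult.commute)
qed

lemma riemann_roch_space_mono:
  assumes "\<And>R. valuation_ring \<kappa> R \<Longrightarrow> D R \<le> D' R"
  shows "riemann_roch_space \<kappa> D \<subseteq> riemann_roch_space \<kappa> D'"
  using assms dvr.vge_mono[OF dvr] unfolding subset_iff riemann_roch_space_iff by (meson neg_le_iff_le)

text \<open>
  The leading coefficient at \<open>R\<close>, a residue class, vanishes exactly on the smaller space.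
\<close>
lemma card_riemann_roch_space_step:
  assumes R: "valuation_ring \<kappa> R" and fin: "finite (riemann_roch_space \<kappa> D)"
  shows "card (riemann_roch_space \<kappa> D) \<le>
    card (riemann_roch_space \<kappa> (D(R := D R - 1))) * CARD('k) ^ place_degree \<kappa> R"
proof -
  interpret dvr R by (rule dvr[OF R])
  let ?D' = "D(R := D R - 1)" and ?Q = "{xs :: 'k list. set xs \<subseteq> UNIV \<and> length xs = place_degree \<kappa> R}"
  obtain \<rho> :: "'f \<Rightarrow> 'k list" where \<rho>: "\<And>z. length (\<rho> z) = place_degree \<kappa> R"
    "\<And>z w. z \<in> R \<Longrightarrow> w \<in> R \<Longrightarrow> \<rho> z = \<rho> w \<Longrightarrow> z - w \<in> \<mm>"
    using residue_map[OF R] by metis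
  obtain t where t: "uniformizer R t" using uniformizer_ex by blast
  have t0: "t \<noteq> 0" using uniformizer_nonzero[OF t] by blast
  let ?s = "t powi (- D R)"
  have s: "?s \<noteq> 0" "ord_at R ?s = - D R"
    using t0 by (auto simp: ord_powi ord_uniformizer[OF t])
  have "card (riemann_roch_space \<kappa> D) \<le> card (riemann_roch_space \<kappa> ?D') * card ?Q"
  proof (rule card_le_fibres[where g = "\<lambda>z. \<rho> (z / ?s)"])
    show "finite (riemann_roch_space \<kappa> D)" by (rule fin)
    then show "finite (riemann_roch_space \<kappa> ?D')"
      by (rule finite_subset[rotated]) (rule riemann_roch_space_mono, simp)
    show "finite ?Q" by (rule finite_lists_length_eq) simp
    show "(\<lambda>z. \<rho> (z / ?s)) ` riemann_roch_space \<kappa> D \<subseteq> ?Q" using \<rho>(1) by auto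
    fix z w assume zw: "z \<in> riemann_roch_space \<kappa> D" "w \<in> riemann_roch_space \<kappa> D" "\<rho> (z / ?s) = \<rho> (w / ?s)"
    have mem: "v / ?s \<in> R" if "v \<in> riemann_roch_space \<kappa> D" for v
    proof -
      have "vge (0 + ord_at R ?s) v" using that R unfolding riemann_roch_space_iff s(2) by simp
      then show ?thesis using vge_iff_divide[OF s(1), of 0 v] by (simp only: vge_mem)
    qed
    have "z / ?s - w / ?s \<in> \<mm>" using \<rho>(2) mem zw by blast
    then have "vge 1 ((z - w) / ?s)" by (simp add: vge_max_ideal diff_divide_distrib)
    then have "vge (1 - D R) (z - w)" using s by (simp add: vge_iff_divide)
    moreover have "dvr.vge R' (- D R') (z - w)" if "valuation_ring \<kappa> R'" for R'
      using zw(1,2) that dvr.vge_diff[OF dvr] unfolding riemann_roch_space_iff by blast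
    ultimately show "z - w \<in> riemann_roch_space \<kappa> ?D'"
      unfolding riemann_roch_space_iff by simp
  qed
  also have "card ?Q = CARD('k) ^ place_degree \<kappa> R" by (rule card_lists_length_eq) simp
  finally show ?thesis .
qed

lemma card_riemann_roch_space_le:
  assumes T: "finite T" "\<And>R. R \<in> T \<Longrightarrow> valuation_ring \<kappa> R"
    and le: "\<And>R. R \<in> T \<Longrightarrow> D R \<le> D' R" and eq: "\<And>R. valuation_ring \<kappa> R \<Longrightarrow> R \<notin> T \<Longrightarrow> D R = D' R"
    and fin: "finite (riemann_roch_space \<kappa> D')"
  shows "card (riemann_roch_space \<kappa> D') \<le>
    card (riemann_roch_space \<kappa> D) * CARD('k) ^ (\<Sum>R\<in>T. nat (D' R - D R) * place_degree \<kappa> R)"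
  using le eq fin
proof (induction "\<Sum>R\<in>T. nat (D' R - D R)" arbitrary: D')
  case 0
  then have "D R = D' R" if "valuation_ring \<kappa> R" for R
  proof (cases "R \<in> T")
    case True
    have "\<forall>R\<in>T. nat (D' R - D R) = 0" using 0(1)[symmetric] by (simp only: sum_eq_0_iff[OF T(1)])
    then have "nat (D' R - D R) = 0" using True by blast
    then show ?thesis using 0(2)[OF True] by simp
  qed (use 0(3) that in blast)
  then have "riemann_roch_space \<kappa> D = riemann_roch_space \<kappa> D'"
    unfolding riemann_roch_space_def by auto
  moreover have "CARD('k) ^ (\<Sum>R\<in>T. nat (D' R - D R) * place_degree \<kappa> R) \<ge> 1"
    using card_const_gt_1 by simp
  ultimately show ?case by simp
next
  case (Suc n)
  have "(\<Sum>R\<in>T. nat (D' R - D R)) \<noteq> 0" using Suc.hyps(2) by linarith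
  then obtain R where R: "R \<in> T" "nat (D' R - D R) \<noteq> 0"
    by (rule sum.not_neutral_contains_not_neutral)
  let ?D' = "D'(R := D' R - 1)"
  have Rv: "valuation_ring \<kappa> R" using T(2) R by blast
  have split: "(\<Sum>R\<in>T. nat (D' R - D R) * g R) = (\<Sum>R\<in>T. nat (?D' R - D R) * g R) + g R" for g
  proof -
    have "(\<Sum>R\<in>T - {R}. nat (?D' R - D R) * g R) = (\<Sum>R\<in>T - {R}. nat (D' R - D R) * g R)"
      by (rule sum.cong) auto
    moreover have "nat (D' R - D R) = Suc (nat (D' R - 1 - D R))" using R(2) by linarith
    ultimately show ?thesis using R(1) T(1) by (simp add: sum.remove[of T R])
  qed
  have "n = (\<Sum>R\<in>T. nat (?D' R - D R))" using split[of "\<lambda>_. 1"] Suc.hyps(2) by simp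
  moreover have "finite (riemann_roch_space \<kappa> ?D')"
    by (rule finite_subset[OF _ Suc.prems(3)]) (rule riemann_roch_space_mono, simp)
  moreover have "D R' \<le> ?D' R'" if "R' \<in> T" for R'
    using Suc.prems(1)[OF that] R by (auto simp: fun_upd_def)
  moreover have "D R' = ?D' R'" if "valuation_ring \<kappa> R'" "R' \<notin> T" for R'
    using Suc.prems(2)[OF that] R that by auto
  ultimately have "card (riemann_roch_space \<kappa> ?D') \<le>
      card (riemann_roch_space \<kappa> D) * CARD('k) ^ (\<Sum>R\<in>T. nat (?D' R - D R) * place_degree \<kappa> R)"
    using Suc.hyps(1)[of ?D'] by blast
  then have "card (riemann_roch_space \<kappa> ?D') * CARD('k) ^ place_degree \<kappa> R \<le>
      card (riemann_roch_space \<kappa> D) * CARD('k) ^ (\<Sum>R\<in>T. nat (?D' R - D R) * place_degree \<kappa> R)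
        * CARD('k) ^ place_degree \<kappa> R"
    by (rule mult_le_mono1)
  from order_trans[OF card_riemann_roch_space_step[OF Rv Suc.prems(3)] this] show ?case
    by (simp only: split[of "place_degree \<kappa>"] power_add mult.assoc)
qed

lemma divisor_degree_eq:
  assumes "finite T" "divisor_support \<kappa> D \<subseteq> T" "\<And>R. R \<in> T \<Longrightarrow> valuation_ring \<kappa> R"
  shows "divisor_degree \<kappa> D = (\<Sum>R\<in>T. D R * int (place_degree \<kappa> R))"
  unfolding divisor_degree_def using assms
  by (intro sum.mono_neutral_left) (auto simp: divisor_support_def)

text \<open>
  Passing from \<open>D\<close> to \<open>D + R\<close> raises the degree by \<open>deg R\<close> and the dimension by at most that. Hence
  the maximum in the definition of the genus may be taken over arbitrarily large divisors.
\<close>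
lemma degree_minus_dim_mono:
  assumes D: "is_divisor \<kappa> D" and D': "is_divisor \<kappa> D'"
    and le: "\<And>R. valuation_ring \<kappa> R \<Longrightarrow> D R \<le> D' R"
    and fin: "finite (riemann_roch_space \<kappa> D')"
  shows "divisor_degree \<kappa> D - int (divisor_dim \<kappa> D) \<le> divisor_degree \<kappa> D' - int (divisor_dim \<kappa> D')"
proof -
  define T where "T = divisor_support \<kappa> D \<union> divisor_support \<kappa> D'"
  have T: "finite T" "\<And>R. R \<in> T \<Longrightarrow> valuation_ring \<kappa> R"
    using D D' by (auto simp: T_def is_divisor_def divisor_support_def)
  have fin': "finite (riemann_roch_space \<kappa> D)"
    by (rule finite_subset[OF riemann_roch_space_mono fin]) (rule le)
  define e where "e = (\<Sum>R\<in>T. nat (D' R - D R) * place_degree \<kappa> R)"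
  have "card (riemann_roch_space \<kappa> D') \<le> card (riemann_roch_space \<kappa> D) * CARD('k) ^ e"
    unfolding e_def
  proof (rule card_riemann_roch_space_le[OF T _ _ fin])
    show "D R \<le> D' R" if "R \<in> T" for R using le T(2) that by blast
    show "D R = D' R" if "valuation_ring \<kappa> R" "R \<notin> T" for R
      using that by (simp add: T_def divisor_support_def)
  qed
  then have "CARD('k) ^ divisor_dim \<kappa> D' \<le> CARD('k) ^ (divisor_dim \<kappa> D + e)"
    by (simp add: card_riemann_roch_space fin fin' power_add)
  then have "divisor_dim \<kappa> D' \<le> divisor_dim \<kappa> D + e"
    using card_const_gt_1 power_le_imp_le_exp by blast
  moreover have "int e = divisor_degree \<kappa> D' - divisor_degree \<kappa> D"
  proof -
    have "int e = (\<Sum>R\<in>T. (D' R - D R) * int (place_degree \<kappa> R))"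
      unfolding e_def of_nat_sum by (rule sum.cong) (use le T(2) in auto)
    also have "\<dots> = divisor_degree \<kappa> D' - divisor_degree \<kappa> D"
      using divisor_degree_eq[OF T(1) _ T(2), of D] divisor_degree_eq[OF T(1) _ T(2), of D']
      by (simp add: T_def left_diff_distrib sum_subtractf)
    finally show ?thesis .
  qed
  ultimately show ?thesis by linarith
qed

end

section \<open>Cubic extensions of the rational function field\<close>

text \<open>
  The bound is put on the coefficients because the zero polynomial has degree \<open>0\<close>; this makes the
  case \<open>M = 0\<close> correct, too.
\<close>
definition polys_below :: "nat \<Rightarrow> 'k :: zero poly set" where
  "polys_below M = {p. \<forall>i\<ge>M. coeff p i = 0}"

lemma card_polys_below:
  "card (polys_below M :: 'k :: {field, finite} poly set) = CARD('k) ^ M"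
  "finite (polys_below M :: 'k :: {field, finite} poly set)"
proof -
  let ?L = "{xs :: 'k list. set xs \<subseteq> UNIV \<and> length xs = M}"
  have bij: "bij_betw Poly ?L (polys_below M)"
  proof (rule bij_betwI[where g = "\<lambda>p. map (coeff p) [0..<M]"])
    show "Poly \<in> ?L \<rightarrow> polys_below M"
      by (auto simp: polys_below_def coeff_Poly_eq nth_default_def)
    show "(\<lambda>p. map (coeff p) [0..<M]) \<in> polys_below M \<rightarrow> ?L" by auto
    show "map (coeff (Poly xs)) [0..<M] = xs" if "xs \<in> ?L" for xs
      using that by (intro nth_equalityI) (auto simp: coeff_Poly_eq nth_default_def)
    show "Poly (map (coeff p) [0..<M]) = p" if "p \<in> polys_below M" for p :: "'k poly"
      using that by (intro poly_eqI) (auto simp: coeff_Poly_eq nth_default_def polys_below_def)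
  qed
  then show "card (polys_below M :: 'k poly set) = CARD('k) ^ M"
    using bij_betw_same_card[OF bij] card_lists_length_eq[of "UNIV :: 'k set" M] by simp
  show "finite (polys_below M :: 'k poly set)"
    using bij_betw_finite[OF bij] finite_lists_length_eq[of "UNIV :: 'k set" M] by simp
qed

lemma polys_below_degree: "degree p < M \<Longrightarrow> p \<in> polys_below M"
  by (auto simp: polys_below_def coeff_eq_0)

lemma degree_polys_below: "p \<in> polys_below M \<Longrightarrow> p = 0 \<or> degree p < M"
  unfolding polys_below_def by (metis (mono_tags) leading_coeff_0_iff linorder_not_le mem_Collect_eq)

lemma polys_below_sum:
  fixes g :: "'b \<Rightarrow> 'a :: comm_monoid_add poly"
  shows "(\<And>i. i \<in> S \<Longrightarrow> g i \<in> polys_below M) \<Longrightarrow> sum g S \<in> polys_below M"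
  by (auto simp: polys_below_def coeff_sum)

locale rational_extension = field_embedding \<iota>
  for \<iota> :: "'k :: {field, finite} poly fract \<Rightarrow> 'f :: field"
begin

abbreviation "E \<equiv> emb_poly \<iota>"
abbreviation "\<kappa> \<equiv> emb_const \<iota>"
abbreviation "\<xi> \<equiv> E [:0, 1:]"

lemma E_0 [simp]: "E 0 = 0" and E_1 [simp]: "E 1 = 1"
  and E_add: "E (a + b) = E a + E b" and E_mult: "E (a * b) = E a * E b"
  and E_minus: "E (- a) = - E a" and E_diff: "E (a - b) = E a - E b"
  and E_eq_0_iff [simp]: "E a = 0 \<longleftrightarrow> a = 0" and E_eq_iff [simp]: "E a = E b \<longleftrightarrow> a = b"
  by (auto simp: emb_poly_def hom_add hom_mult hom_minus hom_diff)

lemma E_power: "E (a ^ n) = E a ^ n"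
  by (induction n) (auto simp: E_mult)

lemma E_sum: "E (sum g S) = (\<Sum>i\<in>S. E (g i))"
  by (induction S rule: infinite_finite_induct) (auto simp: E_add)

sublocale const: field_embedding \<kappa>
proof
  have "[:a + b:] = [:a:] + [:b:]" "[:a * b:] = [:a:] * [:b:]" for a b :: 'k by simp_all
  then show "field_hom \<kappa>"
    unfolding field_hom_def emb_const_def
    by (metis E_1 E_add E_mult one_pCons)
qed

lemma E_const: "E [:a:] = \<kappa> a"
  by (simp only: emb_const_def)

lemma eval_E: "eval_at \<kappa> p (E r) = E (pcompose p r)"
  by (induction p) (simp_all add: pcompose_pCons E_add E_mult E_const)

lemma eval_xi: "eval_at \<kappa> p \<xi> = E p"
  by (simp add: eval_E)

lemma E_monom: "E (monom c n) = \<kappa> c * \<xi> ^ n"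
  using const.eval_monom[of c n \<xi>] by (simp only: eval_xi)

lemma xi_nonzero [simp]: "\<xi> \<noteq> 0"
  by simp

lemma fract_cases:
  obtains n d :: "'k poly" where "a = to_fract n / to_fract d" "d \<noteq> 0"
  by (cases a) (auto simp: Fract_conv_to_fract)

lemma \<iota>_to_fract: "\<iota> (to_fract p) = E p"
  by (simp add: emb_poly_def)

lemma eval_inverse_xi_eq_0: "eval_at \<kappa> p (inverse \<xi>) = 0 \<Longrightarrow> p = 0"
proof -
  assume 0: "eval_at \<kappa> p (inverse \<xi>) = 0"
  define r where "r = (\<Sum>i\<le>degree p. monom (coeff p (degree p - i)) i)"
  have "eval_at \<kappa> r (inverse (inverse \<xi>)) = 0"
    unfolding r_def by (subst const.eval_reflect) (auto simp: 0)
  then have "r = 0" by (simp add: eval_xi)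
  moreover have "coeff r 0 = lead_coeff p" by (simp add: r_def coeff_sum)
  ultimately show "p = 0" by simp
qed

end

locale cubic_extension = rational_extension \<iota>
  for \<iota> :: "'k :: {field, finite} poly fract \<Rightarrow> 'f :: field" +
  fixes A B :: "'k poly" and y :: 'f
  assumes cubic: "y ^ 3 - emb_poly \<iota> A * y + emb_poly \<iota> B = 0"
    and generated: "generated_by \<iota> y"
    and no_root: "r ^ 3 - to_fract A * r + to_fract B \<noteq> 0"
begin

lemma y3: "y ^ 3 = E A * y - E B"
  using cubic by (simp add: algebra_simps eq_neg_iff_add_eq_0)

lemma y_notin_base: "y \<noteq> \<iota> r"
proof
  assume "y = \<iota> r"
  then have "\<iota> (r ^ 3 - to_fract A * r + to_fract B) = 0"
    using cubic by (simp add: hom_add hom_diff hom_mult hom_power \<iota>_to_fract)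
  then show False using no_root by simp
qed

text \<open>
  A quadratic equation for \<open>y\<close> with leading coefficient \<open>1\<close> and linear coefficient \<open>u\<close> would divide the
  cubic, and the third root would be \<open>u\<close>.
\<close>
lemma independent:
  assumes 0: "\<iota> a + \<iota> b * y + \<iota> c * y ^ 2 = 0"
  shows "a = 0 \<and> b = 0 \<and> c = 0"
proof -
  have lin: "a = 0 \<and> b = 0" if "\<iota> a + \<iota> b * y = 0" for a b
  proof (cases "b = 0")
    case False
    then have "y = \<iota> (- a / b)" using that
      by (simp add: hom_divide hom_minus field_simps eq_neg_iff_add_eq_0)
    then show ?thesis using y_notin_base by blast
  qed (use that in simp)
  show ?thesis
  proof (cases "c = 0")
    case False
    define u v where "u = b / c" and "v = a / c"
    have y2: "y ^ 2 = - (\<iota> u * y) - \<iota> v"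
      using 0 False by (simp add: u_def v_def hom_divide field_simps eq_neg_iff_add_eq_0)
    have "y ^ 3 = y * y ^ 2" by (simp add: power3_eq_cube power2_eq_square)
    also have "\<dots> = - (\<iota> u * y ^ 2) - \<iota> v * y"
      unfolding y2[unfolded power2_eq_square] by (simp add: power2_eq_square algebra_simps)
         (simp add: y2[unfolded power2_eq_square] algebra_simps)
    also have "\<dots> = \<iota> (u ^ 2 - v) * y + \<iota> (u * v)"
      unfolding y2 by (simp add: hom_diff hom_mult hom_power power2_eq_square algebra_simps)
    finally have "y ^ 3 - E A * y + E B = \<iota> (u * v + to_fract B) + \<iota> (u ^ 2 - v - to_fract A) * y"
      by (simp add: hom_add hom_diff \<iota>_to_fract algebra_simps)
    then have "\<iota> (u * v + to_fract B) + \<iota> (u ^ 2 - v - to_fract A) * y = 0"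
      using cubic by simp
    from lin[OF this] have *: "u * v + to_fract B = 0" "v = u ^ 2 - to_fract A"
      by (auto simp: algebra_simps)
    have "u ^ 3 - to_fract A * u + to_fract B = 0"
      using *(1) unfolding *(2) by (simp add: power3_eq_cube power2_eq_square algebra_simps)
    then show ?thesis using no_root by blast
  qed (use lin[of a b] 0 in simp)
qed

definition combo :: "'k poly \<Rightarrow> 'k poly \<Rightarrow> 'k poly \<Rightarrow> 'f" where
  "combo a b c = E a + E b * y + E c * y ^ 2"

lemma combo_add: "combo a b c + combo a' b' c' = combo (a + a') (b + b') (c + c')"
  by (simp add: combo_def E_add algebra_simps)

lemma combo_smult: "E d * combo a b c = combo (d * a) (d * b) (d * c)"
  by (simp add: combo_def E_mult algebra_simps)

lemma combo_sum: "(\<Sum>i\<in>S. combo (f i) (g i) (h i)) = combo (sum f S) (sum g S) (sum h S)"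
  by (simp add: combo_def E_sum sum.distrib sum_distrib_right)

lemma combo_mult:
  "combo a b c * combo a' b' c' = combo (a * a' - B * (b * c' + c * b'))
     (a * b' + b * a' + A * (b * c' + c * b') - B * (c * c')) (a * c' + b * b' + c * a' + A * (c * c'))"
proof -
  have y4: "y ^ 4 = E A * y ^ 2 - E B * y"
  proof -
    have "y ^ 4 = y * y ^ 3" by (simp add: numeral_eq_Suc)
    then show ?thesis by (simp add: y3 power2_eq_square algebra_simps)
  qed
  have "combo a b c * combo a' b' c' = E a * E a' + (E a * E b' + E b * E a') * y +
      (E a * E c' + E b * E b' + E c * E a') * y ^ 2 + (E b * E c' + E c * E b') * y ^ 3 +
      E c * E c' * y ^ 4"
    unfolding combo_def by (simp add: algebra_simps numeral_eq_Suc)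
  then show ?thesis unfolding y3 y4 combo_def
    by (simp add: E_add E_mult E_diff algebra_simps)
qed

text \<open>
  This is the \<open>k(x)\<close>-span of \<open>1, y, y\<^sup>2\<close>. It is a subfield, for a nonzero element satisfies a relation
  over \<open>k[x]\<close> with nonzero constant term, and so it is everything.
\<close>
definition fractional :: "'f set" where
  "fractional = {z. \<exists>a b c d. d \<noteq> 0 \<and> E d * z = combo a b c}"

lemma fractionalI: "d \<noteq> 0 \<Longrightarrow> E d * z = combo a b c \<Longrightarrow> z \<in> fractional"
  unfolding fractional_def by blast

lemma fractional_add: "z \<in> fractional \<Longrightarrow> w \<in> fractional \<Longrightarrow> z + w \<in> fractional"
proof -
  assume "z \<in> fractional" "w \<in> fractional"
  then obtain a b c d a' b' c' d' where d: "d \<noteq> 0" "E d * z = combo a b c"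
    and d': "d' \<noteq> 0" "E d' * w = combo a' b' c'" unfolding fractional_def by blast
  have "E (d * d') * (z + w) = E d' * combo a b c + E d * combo a' b' c'"
    unfolding d(2)[symmetric] d'(2)[symmetric] by (simp add: E_mult algebra_simps)
  then show ?thesis using d(1) d'(1)
    by (intro fractionalI[of "d * d'"]) (auto simp: combo_smult combo_add)
qed

lemma fractional_mult: "z \<in> fractional \<Longrightarrow> w \<in> fractional \<Longrightarrow> z * w \<in> fractional"
proof -
  assume "z \<in> fractional" "w \<in> fractional"
  then obtain a b c d a' b' c' d' where d: "d \<noteq> 0" "E d * z = combo a b c"
    and d': "d' \<noteq> 0" "E d' * w = combo a' b' c'" unfolding fractional_def by blast
  have "E (d * d') * (z * w) = combo a b c * combo a' b' c'"
    unfolding d(2)[symmetric] d'(2)[symmetric] by (simp add: E_mult algebra_simps)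
  then show ?thesis using d(1) d'(1)
    by (intro fractionalI[of "d * d'"]) (auto simp: combo_mult)
qed

lemma fractional_combo: "combo a b c \<in> fractional"
  by (rule fractionalI[of 1]) auto

lemma fractional_base: "\<iota> a \<in> fractional"
proof -
  obtain n d where nd: "a = to_fract n / to_fract d" "d \<noteq> 0" by (rule fract_cases)
  have "E d * \<iota> a = combo n 0 0" using nd by (simp add: hom_divide \<iota>_to_fract combo_def)
  then show ?thesis using nd(2) by (rule fractionalI[rotated])
qed

lemma fractional_power: "z \<in> fractional \<Longrightarrow> z ^ n \<in> fractional"
  using fractional_base[of 1] by (induction n) (auto intro: fractional_mult)

text \<open>
  Let \<open>q\<close> be the number of constants. The \<open>q^((3d+1)M)\<close> tuples of polynomials of degree below \<open>M\<close> in \<open>p\<close>, where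
  \<open>d = degree p\<close>, are mapped linearly to at most \<open>q^(3dM + const)\<close> values, so for large \<open>M\<close> two
  of them agree.
\<close>
lemma fractional_relation:
  assumes p: "p \<noteq> 0" and h: "\<And>j. j \<le> 3 * degree p \<Longrightarrow> h j \<in> fractional"
  shows "\<exists>c. (\<exists>j\<le>3 * degree p. coeff (c j) 0 \<noteq> 0) \<and> (\<Sum>j\<le>3 * degree p. eval_at \<kappa> (c j) (E p) * h j) = 0"
proof -
  define n where "n = 3 * degree p"
  have "\<exists>a b c d. d \<noteq> 0 \<and> E d * h j = combo a b c" if "j \<le> n" for j
    using h that unfolding n_def fractional_def by blast
  then obtain a b c d where d: "\<And>j. j \<le> n \<Longrightarrow> d j \<noteq> 0"
    and abc: "\<And>j. j \<le> n \<Longrightarrow> E (d j) * h j = combo (a j) (b j) (c j)" by metis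
  define dd where "dd = (\<Prod>j\<le>n. d j)"
  define e where "e j = (\<Prod>i\<in>{..n} - {j}. d i)" for j
  have dd: "dd \<noteq> 0" using d by (simp add: dd_def)
  have e: "dd = e j * d j" if "j \<le> n" for j
    unfolding dd_def e_def using that by (subst prod.remove[of _ j]) (auto simp: mult.commute)
  define a' b' c' where "a' j = e j * a j" and "b' j = e j * b j" and "c' j = e j * c j" for j
  have abc': "E dd * h j = combo (a' j) (b' j) (c' j)" if "j \<le> n" for j
    using abc[OF that] by (simp add: e[OF that] E_mult a'_def b'_def c'_def combo_smult[symmetric] mult.assoc)
  define C where "C = (\<Sum>j\<le>n. degree (a' j) + degree (b' j) + degree (c' j))"
  have C: "degree (a' j) \<le> C" "degree (b' j) \<le> C" "degree (c' j) \<le> C" if "j \<le> n" for j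
  proof -
    have "degree (a' j) + degree (b' j) + degree (c' j) \<le> C"
      unfolding C_def using that by (intro member_le_sum) auto
    then show "degree (a' j) \<le> C" "degree (b' j) \<le> C" "degree (c' j) \<le> C" by linarith+
  qed
  define M where "M = 3 * C + 4"
  define D where "D = M * degree p + C + 1"
  define S :: "(nat \<Rightarrow> 'k poly) set" where "S = {..n} \<rightarrow>\<^sub>E polys_below M"
  define \<Phi> where "\<Phi> \<gamma> = (\<Sum>j\<le>n. pcompose (\<gamma> j) p * a' j, \<Sum>j\<le>n. pcompose (\<gamma> j) p * b' j,
      \<Sum>j\<le>n. pcompose (\<gamma> j) p * c' j)" for \<gamma>
  define T :: "('k poly \<times> 'k poly \<times> 'k poly) set" where "T = polys_below D \<times> polys_below D \<times> polys_below D"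
  have cardS: "card S = CARD('k) ^ (M * Suc n)"
    unfolding S_def by (simp add: card_PiE card_polys_below power_mult power_add)
  have cardT: "card T = CARD('k) ^ (3 * D)" "finite T"
    unfolding T_def by (simp_all add: card_polys_below card_cartesian_product numeral_3_eq_3 power_add)
  have below: "(\<Sum>j\<le>n. pcompose (\<gamma> j) p * g j) \<in> polys_below D"
    if \<gamma>: "\<gamma> \<in> S" and g: "\<And>j. j \<le> n \<Longrightarrow> degree (g j) \<le> C" for \<gamma> g
  proof (rule polys_below_sum)
    fix j assume "j \<in> {..n}"
    then have j: "j \<le> n" and "\<gamma> j \<in> polys_below M" using \<gamma> by (auto simp: S_def)
    then have "degree (\<gamma> j) \<le> M" using degree_polys_below by fastforce
    then have "degree (pcompose (\<gamma> j) p) \<le> M * degree p"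
      using degree_pcompose_le[of "\<gamma> j" p] by (meson mult_le_mono1 order_trans)
    then have "degree (pcompose (\<gamma> j) p * g j) < D"
      using degree_mult_le[of "pcompose (\<gamma> j) p" "g j"] g[OF j] unfolding D_def by linarith
    then show "pcompose (\<gamma> j) p * g j \<in> polys_below D" by (rule polys_below_degree)
  qed
  have "\<Phi> ` S \<subseteq> T" unfolding \<Phi>_def T_def using below C by auto
  moreover have "card T < card S"
  proof -
    have "3 * D < M * Suc n" unfolding D_def M_def n_def by (simp add: algebra_simps)
    moreover have "CARD('k) > 1"
    proof -
      have "card {0, 1 :: 'k} \<le> CARD('k)" by (rule card_mono) auto
      then show ?thesis by simp
    qed
    ultimately show ?thesis unfolding cardS cardT by (rule power_strict_increasing)
  qed
  ultimately have "\<not> inj_on \<Phi> S" using card_inj_on_le[of \<Phi> S T] cardT(2) by auto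
  then obtain \<gamma> \<delta> where gd: "\<gamma> \<in> S" "\<delta> \<in> S" "\<Phi> \<gamma> = \<Phi> \<delta>" "\<gamma> \<noteq> \<delta>" unfolding inj_on_def by blast
  define r where "r j = \<gamma> j - \<delta> j" for j
  have "\<exists>j\<le>n. r j \<noteq> 0"
    using gd PiE_ext[of \<gamma> "{..n}" _ \<delta>] unfolding S_def r_def by (metis atMost_iff eq_iff_diff_eq_0)
  moreover have "(\<Sum>j\<le>n. eval_at \<kappa> (r j) (E p) * h j) = 0"
  proof -
    have zero: "(\<Sum>j\<le>n. pcompose (r j) p * g j) = 0"
      if "(\<Sum>j\<le>n. pcompose (\<gamma> j) p * g j) = (\<Sum>j\<le>n. pcompose (\<delta> j) p * g j)" for g
      using that by (simp add: r_def pcompose_diff left_diff_distrib sum_subtractf)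
    have "E dd * (\<Sum>j\<le>n. eval_at \<kappa> (r j) (E p) * h j) = (\<Sum>j\<le>n. E (pcompose (r j) p) * (E dd * h j))"
      unfolding sum_distrib_left eval_E by (rule sum.cong) (auto simp: mult_ac)
    also have "\<dots> = (\<Sum>j\<le>n. combo (pcompose (r j) p * a' j) (pcompose (r j) p * b' j) (pcompose (r j) p * c' j))"
      by (rule sum.cong) (auto simp: abc' combo_smult)
    also have "\<dots> = combo 0 0 0"
      unfolding combo_sum using gd(3) by (simp add: \<Phi>_def zero)
    also have "\<dots> = 0" by (simp add: combo_def)
    finally show ?thesis using dd by simp
  qed
  ultimately have "\<exists>c. (\<exists>j\<le>n. coeff (c j) 0 \<noteq> 0) \<and> (\<Sum>j\<le>n. eval_at \<kappa> (c j) (E p) * h j) = 0"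
    using p by (intro const.relation_with_constant_term) auto
  then show ?thesis unfolding n_def .
qed

text \<open>
  Dividing a relation between powers of \<open>w\<close> by the smallest power that occurs.
\<close>
lemma shift_relation:
  assumes "w \<noteq> 0" "\<exists>j\<le>3. c j \<noteq> 0" "(\<Sum>j\<le>3. eval_at \<kappa> (c j) f * w ^ j) = 0"
  shows "\<exists>c0 c1 c2 c3. c0 \<noteq> 0 \<and> eval_at \<kappa> c0 f =
    - w * (eval_at \<kappa> c1 f + eval_at \<kappa> c2 f * w + eval_at \<kappa> c3 f * w ^ 2)"
proof -
  let ?e = "\<lambda>j. eval_at \<kappa> (c j) f"
  have s: "?e 0 + ?e 1 * w + ?e 2 * w ^ 2 + ?e 3 * w ^ 3 = 0"
    using assms(3) by (simp add: numeral_eq_Suc algebra_simps)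
  consider "c 0 \<noteq> 0" | "c 0 = 0" "c 1 \<noteq> 0" | "c 0 = 0" "c 1 = 0" "c 2 \<noteq> 0"
    | "c 0 = 0" "c 1 = 0" "c 2 = 0" "c 3 \<noteq> 0"
  proof -
    obtain j where "j \<le> 3" "c j \<noteq> 0" using assms(2) by blast
    then have "c 0 \<noteq> 0 \<or> c 1 \<noteq> 0 \<or> c 2 \<noteq> 0 \<or> c 3 \<noteq> 0"
      by (cases "j = 0"; cases "j = 1"; cases "j = 2"; cases "j = 3") auto
    then show ?thesis using that by blast
  qed
  then show ?thesis
  proof cases
    case 1
    have "?e 0 = - w * (?e 1 + ?e 2 * w + ?e 3 * w ^ 2)"
      using s by (simp add: eq_neg_iff_add_eq_0 algebra_simps numeral_eq_Suc)
    then show ?thesis using 1 by blast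
  next
    case 2
    have "w * (?e 1 + ?e 2 * w + ?e 3 * w ^ 2) = 0"
      using s 2 by (simp add: algebra_simps numeral_eq_Suc)
    then have "?e 1 + ?e 2 * w + ?e 3 * w ^ 2 = 0" using assms(1) by (simp only: mult_eq_0_iff) simp
    then have "?e 1 = - w * (?e 2 + ?e 3 * w + eval_at \<kappa> 0 f * w ^ 2)"
      by (simp add: eq_neg_iff_add_eq_0 algebra_simps numeral_eq_Suc)
    then show ?thesis using 2 by blast
  next
    case 3
    have "w ^ 2 * (?e 2 + ?e 3 * w) = 0"
      using s 3 by (simp add: algebra_simps numeral_eq_Suc)
    then have "?e 2 + ?e 3 * w = 0" using assms(1) by (simp only: mult_eq_0_iff) simp
    then have "?e 2 = - w * (?e 3 + eval_at \<kappa> 0 f * w + eval_at \<kappa> 0 f * w ^ 2)"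
      by (simp add: eq_neg_iff_add_eq_0 algebra_simps)
    then show ?thesis using 3 by blast
  next
    case 4
    then have "?e 3 = - w * (eval_at \<kappa> 0 f + eval_at \<kappa> 0 f * w + eval_at \<kappa> 0 f * w ^ 2)"
      using s assms(1) by simp
    then show ?thesis using 4 by blast
  qed
qed

lemma fractional_inverse: "w \<in> fractional \<Longrightarrow> inverse w \<in> fractional"
proof (cases "w = 0")
  case False
  assume w: "w \<in> fractional"
  obtain c where c: "\<exists>j\<le>3. coeff (c j) 0 \<noteq> 0" "(\<Sum>j\<le>3. eval_at \<kappa> (c j) \<xi> * w ^ j) = 0"
    using fractional_relation[of "[:0, 1:]" "\<lambda>j. w ^ j"] fractional_power[OF w] by auto
  have "\<exists>j\<le>3. c j \<noteq> 0" using c(1) by fastforce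
  then obtain c0 c1 c2 c3 where c0: "c0 \<noteq> 0" "E c0 = - w * (E c1 + E c2 * w + E c3 * w ^ 2)"
    using shift_relation[OF False _ c(2)] by (auto simp: eval_xi)
  then have eq: "inverse w = \<iota> (- 1) * (E c1 + E c2 * w + E c3 * w ^ 2) * inverse (E c0)"
    using False by (simp add: hom_minus field_simps eq_neg_iff_add_eq_0)
  have inv: "inverse (E c0) \<in> fractional"
    using fractional_base[of "inverse (to_fract c0)"] by (simp add: hom_inverse \<iota>_to_fract)
  have E: "E c \<in> fractional" for c using fractional_base \<iota>_to_fract by metis
  show ?thesis unfolding eq
    by (intro fractional_mult fractional_add fractional_power fractional_base inv E w)
qed (use fractional_base[of 0] in simp)

lemma fractional_UNIV: "z \<in> fractional"
proof -
  obtain p q where z: "z = eval_at \<iota> p y / eval_at \<iota> q y"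
    using generated unfolding generated_by_def eval_at_def by blast
  have "y \<in> fractional" using fractional_combo[of 0 1 0] by (simp add: combo_def)
  then have "eval_at \<iota> p y \<in> fractional" for p
    using fractional_base[of 0]
    by (induction p) (auto intro: fractional_add fractional_mult fractional_base)
  then show ?thesis unfolding z divide_inverse by (intro fractional_mult fractional_inverse)
qed

lemma fractional_form:
  obtains a b c d where "d \<noteq> 0" "E d * z = combo a b c"
  using fractional_UNIV[of z] unfolding fractional_def by blast

lemma dependent_over_E: "p \<noteq> 0 \<Longrightarrow> dependent_over \<kappa> (E p) (3 * degree p)"
  unfolding dependent_over_def using fractional_relation fractional_UNIV by simp

lemma dependent_over_xi: "dependent_over \<kappa> \<xi> 3"
  using dependent_over_E[of "[:0, 1:]"] by simp

lemma algebraic: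
  assumes "f = \<xi> \<or> f = inverse \<xi>" "w \<noteq> 0"
  shows "\<exists>c0 c1 c2 c3. eval_at \<kappa> c0 f \<noteq> 0 \<and> eval_at \<kappa> c0 f =
    - w * (eval_at \<kappa> c1 f + eval_at \<kappa> c2 f * w + eval_at \<kappa> c3 f * w ^ 2)"
proof -
  have "dependent_over \<kappa> f 3"
    using assms(1) dependent_over_xi const.dependent_over_inverse by blast
  then obtain c where c: "\<exists>j\<le>3. coeff (c j) 0 \<noteq> 0" "(\<Sum>j\<le>3. eval_at \<kappa> (c j) f * w ^ j) = 0"
    unfolding dependent_over_def by meson
  have "\<exists>j\<le>3. c j \<noteq> 0" using c(1) by fastforce
  then obtain c0 c1 c2 c3 where c0: "c0 \<noteq> 0" "eval_at \<kappa> c0 f =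
    - w * (eval_at \<kappa> c1 f + eval_at \<kappa> c2 f * w + eval_at \<kappa> c3 f * w ^ 2)"
    using shift_relation[OF assms(2) _ c(2)] by metis
  moreover have "eval_at \<kappa> c0 f \<noteq> 0" using c0(1) assms(1) eval_inverse_xi_eq_0 by (auto simp: eval_xi)
  ultimately show ?thesis by blast
qed

sublocale function_field \<kappa>
proof
  fix R z
  assume R: "valuation_ring \<kappa> R" and z: "z \<in> max_ideal R" "z \<noteq> 0"
  have c: "range \<kappa> \<subseteq> R" using R unfolding valuation_ring_def by blast
  interpret val_ring R
  proof
    show "1 \<in> R" using c const.hom_1 by (metis range_subsetD)
    show "a \<in> R \<Longrightarrow> b \<in> R \<Longrightarrow> a - b \<in> R" "a \<in> R \<Longrightarrow> b \<in> R \<Longrightarrow> a * b \<in> R" for a b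
      using R unfolding valuation_ring_def by blast+
    show "z \<in> R \<or> inverse z \<in> R" for z using R unfolding valuation_ring_def by blast
    show "R \<noteq> UNIV" using R unfolding valuation_ring_def by blast
  qed
  have ev: "eval_at \<kappa> p f \<in> R" if "f \<in> R" for p f
    using that c by (induction p) (auto intro!: add_mem mult_mem)
  have step: "\<exists>c0. eval_at \<kappa> c0 f \<noteq> 0 \<and> eval_at \<kappa> c0 f / z \<in> R"
    if f: "f = \<xi> \<or> f = inverse \<xi>" "f \<in> R" for f
  proof -
    obtain c0 c1 c2 c3 where c0: "eval_at \<kappa> c0 f \<noteq> 0" "eval_at \<kappa> c0 f =
      - z * (eval_at \<kappa> c1 f + eval_at \<kappa> c2 f * z + eval_at \<kappa> c3 f * z ^ 2)"
      using algebraic[OF f(1) z(2)] by metis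
    have "eval_at \<kappa> c0 f / z = - (eval_at \<kappa> c1 f + eval_at \<kappa> c2 f * z + eval_at \<kappa> c3 f * z ^ 2)"
      using z(2) unfolding c0(2) by simp
    moreover have "\<dots> \<in> R"
      by (intro minus_mem add_mem mult_mem power_mem ev f max_ideal_sub z)
    ultimately show ?thesis using c0(1) by metis
  qed
  show "\<exists>f n. dependent_over \<kappa> f n \<and> f / z \<in> R"
  proof (cases "\<xi> \<in> R")
    case True
    then obtain c0 where "E c0 \<noteq> 0" "E c0 / z \<in> R" using step[of \<xi>] by (auto simp: eval_xi)
    then show ?thesis using dependent_over_E[of c0] by auto
  next
    case False
    then have iX: "inverse \<xi> \<in> \<mm>" using not_mem_imp by blast
    then obtain c0 where c0: "eval_at \<kappa> c0 (inverse \<xi>) \<noteq> 0" "eval_at \<kappa> c0 (inverse \<xi>) / z \<in> R"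
      using step[of "inverse \<xi>"] max_ideal_sub by auto
    \<comment> \<open>up to a unit of \<open>R\<close>, a polynomial in \<open>1/x\<close> is a power of \<open>1/x\<close>\<close>
    have "\<exists>s r. coeff r 0 \<noteq> 0 \<and> c0 = monom 1 s * r"
    proof -
      have "c0 \<noteq> 0" using c0(1) by auto
      then obtain r where r: "c0 = [:- 0, 1:] ^ order 0 c0 * r" "\<not> [:- 0, 1:] dvd r"
        using order_decomp[of c0 0] by blast
      have "coeff r 0 \<noteq> 0" using r(2) by (simp add: dvd_iff_poly_eq_0 poly_0_coeff_0)
      moreover have "[:- 0, 1 :: 'k:] ^ order 0 c0 = monom 1 (order 0 c0)" by (simp add: monom_altdef)
      ultimately show ?thesis using r(1) by metis
    qed
    then obtain s r where r: "coeff r 0 \<noteq> 0" "c0 = monom 1 s * r" by blast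
    define u where "u = eval_at \<kappa> r (inverse \<xi>)"
    have u: "u \<in> R" "u \<notin> \<mm>"
    proof -
      show "u \<in> R" unfolding u_def by (intro ev max_ideal_sub iX)
      show "u \<notin> \<mm>"
      proof
        assume "u \<in> \<mm>"
        obtain r' where r': "r = [:coeff r 0:] + pCons 0 r'" using const.eval_split by blast
        have "eval_at \<kappa> r' (inverse \<xi>) * inverse \<xi> \<in> \<mm>"
          by (intro max_ideal_mult iX ev max_ideal_sub)
        moreover have "u = \<kappa> (coeff r 0) + inverse \<xi> * eval_at \<kappa> r' (inverse \<xi>)"
          unfolding u_def by (subst r') (simp only: const.eval_add const.eval_pCons const.eval_0 const.hom_0, simp)
        ultimately have "\<kappa> (coeff r 0) \<in> \<mm>"
          using max_ideal_diff[OF \<open>u \<in> \<mm>\<close>, of "eval_at \<kappa> r' (inverse \<xi>) * inverse \<xi>"]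
          by (simp only: mult.commute) simp
        then show False using r(1) c by (auto simp: max_ideal_iff const.hom_inverse[symmetric])
      qed
    qed
    have "u * (inverse \<xi> ^ s) / z \<in> R"
      using c0(2) by (simp add: r(2) const.eval_mult const.eval_monom u_def mult.commute)
    moreover have "inverse u \<in> R" "u \<noteq> 0" using u by (auto simp: max_ideal_iff)
    ultimately have "inverse u * (u * (inverse \<xi> ^ s) / z) \<in> R" using mult_mem by blast
    moreover have "inverse u * (u * (inverse \<xi> ^ s) / z) = inverse \<xi> ^ s / z"
      using \<open>u \<noteq> 0\<close> by (simp add: divide_inverse mult.assoc[symmetric])
    ultimately have "inverse \<xi> ^ s / z \<in> R" by metis
    moreover have "dependent_over \<kappa> (inverse (E ([:0, 1:] ^ s))) (3 * degree ([:0, 1 :: 'k:] ^ s))"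
      by (intro const.dependent_over_inverse dependent_over_E) simp
    ultimately show ?thesis by (auto simp: E_power power_inverse)
  qed
qed

end

section \<open>Integral closure and valuation rings\<close>

locale field_subring =
  fixes S :: "'f :: field set"
  assumes one_mem: "1 \<in> S" and diff_mem: "a \<in> S \<Longrightarrow> b \<in> S \<Longrightarrow> a - b \<in> S"
    and mult_mem: "a \<in> S \<Longrightarrow> b \<in> S \<Longrightarrow> a * b \<in> S"
begin

lemma zero_mem: "0 \<in> S"
  using diff_mem[OF one_mem one_mem] by simp

lemma minus_mem: "a \<in> S \<Longrightarrow> - a \<in> S"
  using diff_mem[OF zero_mem, of a] by simp

lemma add_mem: "a \<in> S \<Longrightarrow> b \<in> S \<Longrightarrow> a + b \<in> S"
  using diff_mem[of a "- b"] minus_mem by simp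

lemma power_mem: "a \<in> S \<Longrightarrow> a ^ n \<in> S"
  by (induction n) (auto intro: mult_mem one_mem)

lemma sum_mem: "(\<And>i. i \<in> T \<Longrightarrow> g i \<in> S) \<Longrightarrow> sum g T \<in> S"
  by (induction T rule: infinite_finite_induct) (auto intro: add_mem zero_mem)

definition adjoin :: "'f \<Rightarrow> 'f set" where
  "adjoin w = {poly p w | p. \<forall>i. coeff p i \<in> S}"

lemma adjoin_subring: "field_subring (adjoin w)"
proof
  have "1 = poly 1 w" "\<forall>i. coeff 1 i \<in> S" by (auto simp: coeff_1 one_mem zero_mem)
  then show "1 \<in> adjoin w" unfolding adjoin_def by blast
next
  fix a b assume "a \<in> adjoin w" "b \<in> adjoin w"
  then obtain p q where pq: "a = poly p w" "b = poly q w" "\<forall>i. coeff p i \<in> S" "\<forall>i. coeff q i \<in> S"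
    unfolding adjoin_def by blast
  have "a - b = poly (p - q) w" "\<forall>i. coeff (p - q) i \<in> S" using pq by (auto simp: diff_mem)
  then show "a - b \<in> adjoin w" unfolding adjoin_def by blast
  have "a * b = poly (p * q) w" "\<forall>i. coeff (p * q) i \<in> S"
    using pq by (auto simp: coeff_mult intro!: sum_mem mult_mem)
  then show "a * b \<in> adjoin w" unfolding adjoin_def by blast
qed

lemma adjoin_mem: "w \<in> adjoin w" "S \<subseteq> adjoin w"
proof -
  have "w = poly [:0, 1:] w" "\<forall>i. coeff [:0, 1 :: 'f:] i \<in> S"
    by (auto simp: coeff_pCons one_mem zero_mem split: nat.split)
  then show "w \<in> adjoin w" unfolding adjoin_def by blast
  show "S \<subseteq> adjoin w"
  proof
    fix a assume "a \<in> S"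
    then have "a = poly [:a:] w" "\<forall>i. coeff [:a:] i \<in> S"
      by (auto simp: coeff_pCons zero_mem split: nat.split)
    then show "a \<in> adjoin w" unfolding adjoin_def by blast
  qed
qed

end

text \<open>
  Lowering the degree of an expression of \<open>z\<close> in \<open>w\<close>, by eliminating the leading power of \<open>w\<close>
  with an expression of \<open>z\<close> in \<open>1/w\<close>.
\<close>
lemma (in field_subring) lower_degree:
  assumes w: "w \<noteq> 0" and z: "z \<noteq> 0" "inverse z \<in> S"
    and unit: "\<And>b. b \<in> S \<Longrightarrow> inverse (1 - inverse z * b) \<in> S \<and> 1 - inverse z * b \<noteq> 0"
    and p: "\<forall>i. coeff p i \<in> S" "degree p \<le> Suc n" "poly p w = z"
    and q: "\<forall>i. coeff q i \<in> S" "degree q \<le> Suc n" "poly q (inverse w) = z"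
  shows "\<exists>r. (\<forall>i. coeff r i \<in> S) \<and> degree r \<le> n \<and> poly r w = z"
proof -
  define c where "c = inverse (1 - inverse z * coeff q 0)"
  have c: "c \<in> S" "c * (1 - inverse z * coeff q 0) = 1" using unit[of "coeff q 0"] q(1) by (auto simp: c_def)
  have sum_poly: "poly p x = (\<Sum>i\<le>m. coeff p i * x ^ i)" if "degree p \<le> m" for p :: "'f poly" and x m
  proof -
    have "poly p x = (\<Sum>i\<le>degree p. coeff p i * x ^ i)" by (rule poly_altdef)
    also have "\<dots> = (\<Sum>i\<le>m. coeff p i * x ^ i)"
      using that by (intro sum.mono_neutral_left) (auto simp: coeff_eq_0)
    finally show ?thesis .
  qed
  have "z = coeff q 0 + (\<Sum>j\<le>n. coeff q (Suc j) * inverse w ^ Suc j)"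
    using sum_poly[OF q(2), of "inverse w"] unfolding q(3) sum.atMost_Suc_shift by simp
  then have "1 - inverse z * coeff q 0 = inverse z * (\<Sum>j\<le>n. coeff q (Suc j) * inverse w ^ Suc j)"
    using z(1) by (simp add: field_simps)
  then have "1 = c * (inverse z * (\<Sum>j\<le>n. coeff q (Suc j) * inverse w ^ Suc j))"
    using c(2) by simp
  then have "w ^ Suc n = c * (inverse z * (\<Sum>j\<le>n. coeff q (Suc j) * inverse w ^ Suc j)) * w ^ Suc n"
    by simp
  also have "\<dots> = (\<Sum>j\<le>n. c * inverse z * coeff q (Suc j) * w ^ (n - j))"
    unfolding sum_distrib_left sum_distrib_right
  proof (rule sum.cong)
    fix j assume "j \<in> {..n}"
    then have "w ^ Suc n = w ^ Suc j * w ^ (n - j)" by (simp flip: power_add)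
    then have "inverse w ^ Suc j * w ^ Suc n = w ^ (n - j)"
      using w by (simp add: power_inverse field_simps)
    then show "c * (inverse z * (coeff q (Suc j) * inverse w ^ Suc j)) * w ^ Suc n =
        c * inverse z * coeff q (Suc j) * w ^ (n - j)"
      by (simp only: mult.assoc)
  qed simp
  also have "\<dots> = (\<Sum>i\<le>n. c * inverse z * coeff q (Suc (n - i)) * w ^ i)"
    by (rule sum.reindex_bij_witness[of _ "\<lambda>i. n - i" "\<lambda>i. n - i"]) auto
  finally have wn: "w ^ Suc n = (\<Sum>i\<le>n. c * inverse z * coeff q (Suc (n - i)) * w ^ i)" .
  define r where "r = (\<Sum>i\<le>n. monom (coeff p i + coeff p (Suc n) * (c * inverse z * coeff q (Suc (n - i)))) i)"
  have "z = (\<Sum>i\<le>n. coeff p i * w ^ i) + coeff p (Suc n) * w ^ Suc n"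
    using sum_poly[OF p(2), of w] p(3) by simp
  also have "\<dots> = poly r w"
    unfolding wn r_def by (simp add: poly_sum poly_monom distrib_right sum.distrib sum_distrib_left mult.assoc)
  finally have "poly r w = z" by simp
  moreover have "\<forall>i. coeff r i \<in> S"
    using p(1) q(1) c(1) z(2) by (auto simp: r_def coeff_sum intro!: sum_mem add_mem mult_mem zero_mem)
  moreover have "degree r \<le> n"
    unfolding r_def by (intro degree_sum_le) (auto intro: order_trans[OF degree_monom_le])
  ultimately show ?thesis by blast
qed

text \<open>
  The existence theorem for valuations: among the subrings containing \<open>S\<^sub>0\<close> but not \<open>z\<close>, a
  maximal one is a valuation ring.
\<close>
lemma valuation_ring_avoiding:
  fixes S0 :: "'f :: field set"
  assumes S0: "field_subring S0" "inverse z \<in> S0" "z \<notin> S0"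
  shows "\<exists>S. field_subring S \<and> S0 \<subseteq> S \<and> z \<notin> S \<and> (\<forall>w. w \<in> S \<or> inverse w \<in> S)"
proof -
  define F where "F = {S. field_subring S \<and> S0 \<subseteq> S \<and> z \<notin> S}"
  have "\<exists>S\<in>F. \<forall>S'\<in>F. S \<subseteq> S' \<longrightarrow> S' = S"
  proof (rule subset_Zorn_nonempty)
    show "F \<noteq> {}" using S0 by (auto simp: F_def)
    fix C assume C: "C \<noteq> {}" "subset.chain F C"
    then have CF: "\<And>S. S \<in> C \<Longrightarrow> S \<in> F" by (auto simp: subset.chain_def)
    have common: "\<exists>S\<in>C. a \<in> S \<and> b \<in> S" if ab: "a \<in> \<Union>C" "b \<in> \<Union>C" for a b
    proof -
      obtain S T where ST: "S \<in> C" "a \<in> S" "T \<in> C" "b \<in> T" using ab by blast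
      then have "S \<subseteq> T \<or> T \<subseteq> S" using C(2) by (auto simp: subset.chain_def)
      then show ?thesis using ST by blast
    qed
    have "field_subring (\<Union>C)"
    proof
      show "1 \<in> \<Union>C" using C(1) CF field_subring.one_mem by (fastforce simp: F_def)
      fix a b assume "a \<in> \<Union>C" "b \<in> \<Union>C"
      from common[OF this] obtain S where S: "S \<in> C" "a \<in> S" "b \<in> S" by blast
      then have "field_subring S" using CF by (auto simp: F_def)
      then show "a - b \<in> \<Union>C" "a * b \<in> \<Union>C"
        using S field_subring.diff_mem field_subring.mult_mem by blast+
    qed
    then show "\<Union>C \<in> F" using C(1) CF by (auto simp: F_def)
  qed
  then obtain S where S: "field_subring S" "S0 \<subseteq> S" "z \<notin> S"
    and max: "\<And>S'. field_subring S' \<Longrightarrow> S \<subseteq> S' \<Longrightarrow> z \<notin> S' \<Longrightarrow> S' = S"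
    unfolding F_def by auto
  interpret field_subring S by (rule S(1))
  let ?u = "inverse z"
  have z0: "z \<noteq> 0" using S(3) zero_mem by auto
  have u: "?u \<in> S" using S0 S by blast
  have unit: "inverse (1 - ?u * b) \<in> S \<and> 1 - ?u * b \<noteq> 0" if b: "b \<in> S" for b
  proof
    let ?s = "1 - ?u * b"
    show s0: "?s \<noteq> 0"
    proof
      assume "?s = 0"
      then have "z = b" using z0 by (simp add: field_simps)
      then show False using b S(3) by simp
    qed
    have sS: "?s \<in> S" using b u by (intro diff_mem mult_mem one_mem)
    have pow: "\<exists>d\<in>S. ?s ^ n = 1 - ?u * d" for n
    proof (induction n)
      case 0
      then show ?case using zero_mem by auto
    next
      case (Suc n)
      then obtain d where d: "d \<in> S" "?s ^ n = 1 - ?u * d" by blast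
      have "?s ^ Suc n = 1 - ?u * (d + b - ?u * b * d)" unfolding power_Suc d(2) by (simp add: algebra_simps)
      then show ?case using d(1) b u by (meson add_mem diff_mem mult_mem)
    qed
    define S' where "S' = {c / ?s ^ n | c n. c \<in> S}"
    have "field_subring S'"
    proof
      have "1 = 1 / ?s ^ 0" by simp
      then show "1 \<in> S'" unfolding S'_def using one_mem by blast
      fix x y assume "x \<in> S'" "y \<in> S'"
      then obtain c n d m where cd: "x = c / ?s ^ n" "c \<in> S" "y = d / ?s ^ m" "d \<in> S"
        unfolding S'_def by blast
      have "x - y = (c * ?s ^ m - d * ?s ^ n) / ?s ^ (n + m)"
        using s0 unfolding cd(1,3) power_add by (simp add: diff_frac_eq)
      moreover have "c * ?s ^ m - d * ?s ^ n \<in> S" by (rule diff_mem) (rule mult_mem[OF cd(2) power_mem[OF sS]], rule mult_mem[OF cd(4) power_mem[OF sS]])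
      ultimately show "x - y \<in> S'" unfolding S'_def by blast
      have "x * y = (c * d) / ?s ^ (n + m)" unfolding cd(1,3) power_add by simp
      then show "x * y \<in> S'" unfolding S'_def using cd mult_mem by blast
    qed
    moreover have "S \<subseteq> S'"
    proof
      fix c assume "c \<in> S"
      moreover have "c = c / ?s ^ 0" by simp
      ultimately show "c \<in> S'" unfolding S'_def by blast
    qed
    moreover have "z \<notin> S'"
    proof
      assume "z \<in> S'"
      then obtain c n where c: "z = c / ?s ^ n" "c \<in> S" unfolding S'_def by blast
      obtain d where d: "d \<in> S" "?s ^ n = 1 - ?u * d" using pow by blast
      have "c = z * ?s ^ n" 
        by (rule sym, rule iffD1[OF nonzero_eq_divide_eq c(1)]) (rule power_not_zero[OF s0])
      then have "z = c + d" unfolding d(2) using z0 by (simp add: algebra_simps)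
      then show False using S(3) add_mem[OF c(2) d(1)] by simp
    qed
    ultimately have "S' = S" by (rule max)
    moreover have "inverse ?s = 1 / ?s ^ 1" by (simp add: divide_inverse)
    then have "inverse ?s \<in> S'" unfolding S'_def using one_mem by blast
    ultimately show "inverse ?s \<in> S" by simp
  qed
  have "w \<in> S \<or> inverse w \<in> S" for w
  proof (rule ccontr)
    assume "\<not> ?thesis"
    then have w: "w \<notin> S" "inverse w \<notin> S" by auto
    then have w0: "w \<noteq> 0" using zero_mem by auto
    define rep where "rep x n \<longleftrightarrow> (\<exists>p. (\<forall>i. coeff p i \<in> S) \<and> degree p \<le> n \<and> poly p x = z)" for x n
    have ex: "\<exists>n. rep x n" if "x \<notin> S" for x
    proof -
      have "adjoin x \<noteq> S" using adjoin_mem(1) that by blast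
      then have "z \<in> adjoin x" using max[OF adjoin_subring adjoin_mem(2)] by blast
      then show ?thesis unfolding adjoin_def rep_def by blast
    qed
    define n m where "n = (LEAST n. rep w n)" and "m = (LEAST n. rep (inverse w) n)"
    have n: "rep w n" and m: "rep (inverse w) m"
      unfolding n_def m_def using ex w LeastI_ex by metis+
    have nonzero: "\<not> rep x 0" for x
    proof
      assume "rep x 0"
      then obtain p where p: "\<forall>i. coeff p i \<in> S" "degree p \<le> 0" "poly p x = z" unfolding rep_def by blast
      then obtain a where "p = [:a:]" using degree_eq_zeroE by auto
      then show False using p(1)[rule_format, of 0] p(3) S(3) by simp
    qed
    have lower: "rep x k" if reps: "rep x (Suc k)" "rep (inverse x) j" "j \<le> Suc k" "x \<noteq> 0" for x k j
    proof -
      have "rep (inverse x) (Suc k)" using reps(2,3) order_trans unfolding rep_def by blast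
      then obtain p q where "\<forall>i. coeff p i \<in> S" "degree p \<le> Suc k" "poly p x = z"
        "\<forall>i. coeff q i \<in> S" "degree q \<le> Suc k" "poly q (inverse x) = z"
        using reps(1) unfolding rep_def by blast
      from lower_degree[OF reps(4) z0 u unit this] show ?thesis unfolding rep_def by blast
    qed
    obtain n' m' where nm: "n = Suc n'" "m = Suc m'" using n m nonzero by (metis not0_implies_Suc)
    show False
    proof (cases "m \<le> n")
      case True
      then have "rep w n'" using lower[of w n' m] n m w0 nm by simp
      then show False using not_less_Least[of n' "rep w"] nm unfolding n_def by simp
    next
      case False
      then have "rep (inverse w) m'" using lower[of "inverse w" m' n] n m w0 nm by simp
      then show False using not_less_Least[of m' "rep (inverse w)"] nm unfolding m_def by simp
    qed
  qed
  then show ?thesis using S by blast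
qed

context rational_extension
begin

lemma poly_map_E: "poly (map_poly E p) z = (\<Sum>i\<le>degree p. E (coeff p i) * z ^ i)"
proof -
  have "poly (map_poly E p) z = (\<Sum>i\<le>degree (map_poly E p). coeff (map_poly E p) i * z ^ i)"
    by (rule poly_altdef)
  then show ?thesis by (simp add: degree_map_poly coeff_map_poly)
qed

end

context cubic_extension
begin

lemma E_mem: "valuation_ring \<kappa> R \<Longrightarrow> \<xi> \<in> R \<Longrightarrow> E p \<in> R"
  using eval_mem[of R \<xi> p] by (simp only: eval_xi)

lemma integral_closure_subset:
  assumes z: "z \<in> integral_closure \<iota>" and R: "valuation_ring \<kappa> R" "\<xi> \<in> R"
  shows "z \<in> R"
proof (rule ccontr)
  assume nz: "z \<notin> R"
  interpret val_ring R by (rule val_ring[OF R(1)])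
  have u: "inverse z \<in> \<mm>" "z \<noteq> 0" using not_mem_imp[OF nz] by auto
  obtain p where p: "lead_coeff p = 1" "poly (map_poly E p) z = 0"
    using z unfolding integral_closure_def by blast
  define n where "n = degree p"
  have "0 = inverse z ^ n * (\<Sum>i\<le>n. E (coeff p i) * z ^ i)"
    using p(2) unfolding poly_map_E n_def by simp
  also have "\<dots> = (\<Sum>i\<le>n. E (coeff p i) * inverse z ^ (n - i))"
    unfolding sum_distrib_left using u(2)
    by (intro sum.cong) (auto simp: power_diff field_simps)
  also have "\<dots> = (\<Sum>i<n. E (coeff p i) * inverse z ^ (n - i)) + 1"
    using p(1) by (simp add: lessThan_Suc_atMost[symmetric] n_def)
  finally have one: "1 = - (\<Sum>i<n. E (coeff p i) * inverse z ^ (n - i))"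
    by (simp add: eq_neg_iff_add_eq_0 add.commute)
  have "E (coeff p i) * inverse z ^ (n - i) \<in> \<mm>" if "i < n" for i
  proof -
    obtain k where k: "n - i = Suc k" using \<open>i < n\<close> by (metis Suc_diff_Suc)
    have "E (coeff p i) * inverse z ^ k \<in> R"
      by (rule mult_mem[OF E_mem[OF R] power_mem[OF max_ideal_sub[OF u(1)]]])
    then have "(E (coeff p i) * inverse z ^ k) * inverse z \<in> \<mm>"
      by (rule max_ideal_mult[OF u(1)])
    then show ?thesis by (simp add: k mult_ac)
  qed
  then have "- (\<Sum>i<n. E (coeff p i) * inverse z ^ (n - i)) \<in> \<mm>"
    by (intro max_ideal_minus max_ideal_sum) simp
  then have "1 \<in> \<mm>" by (simp only: one[symmetric])
  then show False using one_notin_max by blast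
qed

lemma integral_closure_superset:
  assumes z: "\<And>R. valuation_ring \<kappa> R \<Longrightarrow> \<xi> \<in> R \<Longrightarrow> z \<in> R"
  shows "z \<in> integral_closure \<iota>"
proof (rule ccontr)
  assume nint: "z \<notin> integral_closure \<iota>"
  have int: "z \<in> integral_closure \<iota>"
    if "z ^ Suc n = (\<Sum>i\<le>n. E (a i) * z ^ i)" for n a
  proof -
    define p where "p = monom 1 (Suc n) - (\<Sum>i\<le>n. monom (a i) i)"
    have cf: "coeff p i = (if i = Suc n then 1 else if i \<le> n then - a i else 0)" for i
      by (auto simp: p_def coeff_sum)
    have deg: "degree p = Suc n"
      by (rule antisym) (auto intro: degree_le le_degree simp: cf)
    have "poly (map_poly E p) z = (\<Sum>i\<le>n. E (coeff p i) * z ^ i) + z ^ Suc n"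
      unfolding poly_map_E deg by (simp add: cf)
    also have "(\<Sum>i\<le>n. E (coeff p i) * z ^ i) = - (\<Sum>i\<le>n. E (a i) * z ^ i)"
      unfolding sum_negf[symmetric] by (rule sum.cong) (auto simp: cf E_minus)
    finally have "poly (map_poly E p) z = 0" using that by simp
    moreover have "lead_coeff p = 1" using deg cf by simp
    ultimately show ?thesis unfolding integral_closure_def by blast
  qed
  have z0: "z \<noteq> 0" using int[of 0 "\<lambda>_. 0"] nint by auto
  interpret base: field_subring "range E"
  proof
    show "1 \<in> range E" by (rule range_eqI[of _ _ 1]) simp
    show "a - b \<in> range E" "a * b \<in> range E" if "a \<in> range E" "b \<in> range E" for a b
      using that by (auto simp: E_diff[symmetric] E_mult[symmetric])
  qed
  have "z \<notin> base.adjoin (inverse z)"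
  proof
    assume "z \<in> base.adjoin (inverse z)"
    then obtain p where p: "z = poly p (inverse z)" "\<forall>i. coeff p i \<in> range E"
      unfolding base.adjoin_def by blast
    have "\<forall>i. \<exists>a. coeff p i = E a" using p(2) by blast
    then obtain a where a: "\<And>i. coeff p i = E (a i)" by (auto dest: choice)
    define n where "n = degree p"
    have "z ^ Suc n = z ^ n * poly p (inverse z)" using p(1) by simp
    also have "\<dots> = (\<Sum>i\<le>n. E (a i) * z ^ (n - i))"
      unfolding poly_altdef sum_distrib_left n_def[symmetric] using z0
      by (intro sum.cong) (auto simp: power_diff field_simps a)
    also have "\<dots> = (\<Sum>i\<le>n. E (a (n - i)) * z ^ i)"
      by (rule sum.reindex_bij_witness[of _ "\<lambda>i. n - i" "\<lambda>i. n - i"]) auto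
    finally have "z \<in> integral_closure \<iota>" by (rule int)
    then show False using nint by blast
  qed
  then obtain R where R: "field_subring R" "base.adjoin (inverse z) \<subseteq> R" "z \<notin> R" "\<forall>w. w \<in> R \<or> inverse w \<in> R"
    using valuation_ring_avoiding[OF base.adjoin_subring base.adjoin_mem(1)] by blast
  have E: "E p \<in> R" for p using R(2) base.adjoin_mem(2) by blast
  have "\<xi> \<notin> range \<kappa>"
  proof
    assume "\<xi> \<in> range \<kappa>"
    then obtain c where "\<xi> = \<kappa> c" by blast
    then have "\<xi> = E [:c:]" by (simp only: E_const)
    then show False by simp
  qed
  then have "valuation_ring \<kappa> R"
    unfolding valuation_ring_def using R E field_subring.diff_mem[OF R(1)] field_subring.mult_mem[OF R(1)]
    by (auto simp: psubset_eq emb_const_def)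
  then show False using z R(3) E by blast
qed

lemma integral_closure_iff:
  "z \<in> integral_closure \<iota> \<longleftrightarrow> (\<forall>R. valuation_ring \<kappa> R \<longrightarrow> \<xi> \<in> R \<longrightarrow> z \<in> R)"
  using integral_closure_subset integral_closure_superset by blast

lemma integral_closure_E: "E p \<in> integral_closure \<iota>"
  by (simp add: integral_closure_iff E_mem)

lemma integral_closure_add: "a \<in> integral_closure \<iota> \<Longrightarrow> b \<in> integral_closure \<iota> \<Longrightarrow> a + b \<in> integral_closure \<iota>"
  and integral_closure_diff: "a \<in> integral_closure \<iota> \<Longrightarrow> b \<in> integral_closure \<iota> \<Longrightarrow> a - b \<in> integral_closure \<iota>"
  and integral_closure_mult: "a \<in> integral_closure \<iota> \<Longrightarrow> b \<in> integral_closure \<iota> \<Longrightarrow> a * b \<in> integral_closure \<iota>"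
  unfolding integral_closure_iff
  by (meson val_ring val_ring.add_mem val_ring.diff_mem val_ring.mult_mem)+

lemma integral_closure_power: "a \<in> integral_closure \<iota> \<Longrightarrow> a ^ n \<in> integral_closure \<iota>"
  using integral_closure_E[of 1] by (induction n) (auto intro: integral_closure_mult)

lemma integral_closure_sum: "(\<And>i. i \<in> S \<Longrightarrow> g i \<in> integral_closure \<iota>) \<Longrightarrow> sum g S \<in> integral_closure \<iota>"
  using integral_closure_E[of 0] by (induction S rule: infinite_finite_induct) (auto intro: integral_closure_add)

lemma y_integral: "y \<in> integral_closure \<iota>"
proof -
  have "poly (map_poly E [:B, - A, 0, 1:]) y = 0"
    using cubic by (simp add: poly_map_E numeral_eq_Suc coeff_pCons E_minus algebra_simps)
  then show ?thesis unfolding integral_closure_def by (intro CollectI exI[of _ "[:B, - A, 0, 1:]"]) simp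
qed

end

section \<open>The totally ramified place at infinity\<close>

context dvr
begin

text \<open>The term of smallest order is unique, so it cannot be cancelled by the others.\<close>
lemma ord_sum_distinct:
  assumes S: "finite S" and inj: "\<And>i j. i \<in> S \<Longrightarrow> j \<in> S \<Longrightarrow> g i \<noteq> 0 \<Longrightarrow> g j \<noteq> 0 \<Longrightarrow>
      ord_at R (g i) = ord_at R (g j) \<Longrightarrow> i = j"
    and k: "k \<in> S" "g k \<noteq> 0"
  shows "sum g S \<noteq> 0 \<and> ord_at R (sum g S) \<le> ord_at R (g k) \<and>
    (\<exists>i\<in>S. g i \<noteq> 0 \<and> ord_at R (sum g S) = ord_at R (g i))"
proof -
  let ?T = "{i \<in> S. g i \<noteq> 0}"
  obtain i where i: "i \<in> ?T" "\<And>j. j \<in> ?T \<Longrightarrow> ord_at R (g i) \<le> ord_at R (g j)"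
    using arg_min_if_finite[of ?T "\<lambda>i. ord_at R (g i)"] S k by (metis (mono_tags, lifting) empty_iff finite_subset linorder_not_less mem_Collect_eq subsetI)
  have "vge (ord_at R (g i) + 1) (g j)" if "j \<in> S - {i}" for j
  proof (cases "g j = 0")
    case False
    then have "ord_at R (g i) \<noteq> ord_at R (g j)" using inj[of i j] that i(1) by auto
    moreover have "ord_at R (g i) \<le> ord_at R (g j)" using i(2) that False by simp
    ultimately show ?thesis by (simp add: vge_def)
  qed simp
  then have "vge (ord_at R (g i) + 1) (sum g S - g i)"
    using vge_sum[of "S - {i}"] S i(1) by (simp add: sum.remove[of S i])
  then show ?thesis using ord_eq_of_vge[of "g i" "sum g S"] i k by auto
qed

end

locale ramified_cubic = cubic_extension \<iota> A B y
  for \<iota> :: "'k :: {field, finite} poly fract \<Rightarrow> 'f :: field" and A B y +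
  fixes P :: "'f set"
  assumes P: "valuation_ring (emb_const \<iota>) P"
    and over: "\<iota> -` P = infinite_place"
    and ram: "ramification_index \<iota> P = 3"
    and char3: "(3 :: 'k) = 0"
begin

sublocale P: dvr P
  by (rule dvr[OF P])

abbreviation "v \<equiv> ord_at P"

lemma infinite_place_iff: "z \<in> infinite_place \<longleftrightarrow> \<iota> z \<in> P"
  using over by blast

lemma fraction_in_infinite_place:
  assumes "n \<noteq> 0" "d \<noteq> 0"
  shows "to_fract n / to_fract d \<in> (infinite_place :: 'k poly fract set) \<longleftrightarrow> degree n \<le> degree d"
proof
  assume "to_fract n / to_fract d \<in> (infinite_place :: 'k poly fract set)"
  then obtain f g where fg: "to_fract n / to_fract d = Fract f g" "g \<noteq> 0" "degree f \<le> degree g"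
    unfolding infinite_place_def by blast
  then have "to_fract (n * g) = to_fract (f * d)" using assms by (simp add: Fract_conv_to_fract field_simps)
  then have eq: "n * g = f * d" by (simp only: to_fract_eq_iff)
  then have "f \<noteq> 0" using assms fg by auto
  then have "degree n + degree g = degree f + degree d"
    using arg_cong[OF eq, of degree] assms fg(2) by (simp add: degree_mult_eq)
  then show "degree n \<le> degree d" using fg(3) by linarith
next
  assume "degree n \<le> degree d"
  then show "to_fract n / to_fract d \<in> (infinite_place :: 'k poly fract set)"
    unfolding infinite_place_def using assms by (auto simp: Fract_conv_to_fract[symmetric])
qed

sublocale inf: val_ring "infinite_place :: 'k poly fract set"
proof
  show "(1 :: 'k poly fract) \<in> infinite_place" by (simp add: infinite_place_iff)
  show "a \<in> infinite_place \<Longrightarrow> b \<in> infinite_place \<Longrightarrow> a - b \<in> infinite_place"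
    "a \<in> infinite_place \<Longrightarrow> b \<in> infinite_place \<Longrightarrow> a * b \<in> infinite_place" for a b :: "'k poly fract"
    by (auto simp: infinite_place_iff hom_diff hom_mult P.diff_mem P.mult_mem)
  show "z \<in> infinite_place \<or> inverse z \<in> infinite_place" for z :: "'k poly fract"
    using P.total by (simp add: infinite_place_iff hom_inverse)
  have "to_fract [:0, 1:] / to_fract 1 \<notin> (infinite_place :: 'k poly fract set)"
    by (subst fraction_in_infinite_place) auto
  then show "(infinite_place :: 'k poly fract set) \<noteq> UNIV" by blast
qed

lemma max_ideal_infinite_place: "z \<in> max_ideal infinite_place \<longleftrightarrow> \<iota> z \<in> max_ideal P"
  by (simp add: max_ideal_iff infinite_place_iff hom_inverse[symmetric])

abbreviation "t\<^sub>0 \<equiv> inverse (to_fract [:0, 1 :: 'k:])"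

lemma t0_max: "t\<^sub>0 \<in> max_ideal infinite_place" and t0_nonzero: "t\<^sub>0 \<noteq> 0"
proof -
  have "to_fract [:0, 1:] / to_fract 1 \<notin> (infinite_place :: 'k poly fract set)"
    by (subst fraction_in_infinite_place) auto
  then have "to_fract [:0, 1 :: 'k:] \<notin> infinite_place" by simp
  from inf.not_mem_imp[OF this] show "t\<^sub>0 \<in> max_ideal infinite_place" "t\<^sub>0 \<noteq> 0" by auto
qed

lemma infinite_decomp:
  assumes "n \<noteq> 0" "d \<noteq> 0"
  shows "\<exists>u. u \<in> infinite_place - max_ideal infinite_place \<and>
    to_fract n / to_fract d = t\<^sub>0 powi (int (degree d) - int (degree n)) * u"
proof -
  let ?x = "[:0, 1 :: 'k:]"
  have unit: "to_fract n / to_fract d \<in> infinite_place - max_ideal infinite_place"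
    if "n \<noteq> 0" "d \<noteq> 0" "degree n = degree d" for n d :: "'k poly"
    using that fraction_in_infinite_place[of n d] fraction_in_infinite_place[of d n]
    by (simp add: max_ideal_iff)
  have deg: "degree (p * ?x ^ k) = degree p + k" if "p \<noteq> 0" for p k
    using that by (simp add: degree_mult_eq degree_power_eq)
  show ?thesis
  proof (cases "degree n \<le> degree d")
    case True
    define k where "k = degree d - degree n"
    have pw: "t\<^sub>0 powi (int (degree d) - int (degree n)) = inverse (to_fract ?x ^ k)"
      using True by (simp add: k_def power_int_def power_inverse nat_diff_distrib')
    have "to_fract (n * ?x ^ k) / to_fract d \<in> infinite_place - max_ideal infinite_place"
      using assms True by (intro unit) (auto simp: deg k_def)
    moreover have "to_fract (?x ^ k) = to_fract ?x ^ k" for k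
      by (induction k) (simp_all only: power_0 power_Suc to_fract_1 to_fract_mult)
    ultimately show ?thesis using t0_nonzero unfolding pw
      by (intro exI[of _ "to_fract (n * ?x ^ k) / to_fract d"]) auto
  next
    case False
    define k where "k = degree n - degree d"
    have pw: "t\<^sub>0 powi (int (degree d) - int (degree n)) = to_fract ?x ^ k"
    proof -
      have "nat (int (degree n) - int (degree d)) = k" using False by (simp add: k_def)
      then show ?thesis using False by (simp add: power_int_def)
    qed
    have "to_fract n / to_fract (d * ?x ^ k) \<in> infinite_place - max_ideal infinite_place"
      using assms False by (intro unit) (auto simp: deg k_def)
    moreover have "to_fract (?x ^ k) = to_fract ?x ^ k" for k
      by (induction k) (simp_all only: power_0 power_Suc to_fract_1 to_fract_mult)
    ultimately show ?thesis using t0_nonzero unfolding pw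
      by (intro exI[of _ "to_fract n / to_fract (d * ?x ^ k)"]) auto
  qed
qed

lemma fract_nonzero_cases:
  assumes "z \<noteq> 0"
  obtains n d :: "'k poly" where "z = to_fract n / to_fract d" "n \<noteq> 0" "d \<noteq> 0"
proof -
  obtain n d :: "'k poly" where "z = to_fract n / to_fract d" "d \<noteq> 0" by (rule fract_cases)
  then show ?thesis using assms that by (cases "n = 0") auto
qed

lemma uniformizer_t0: "uniformizer infinite_place t\<^sub>0"
  unfolding uniformizer_def
proof (intro subset_antisym subsetI)
  fix z assume "z \<in> (\<lambda>a. t\<^sub>0 * a) ` infinite_place"
  then show "z \<in> max_ideal infinite_place" using inf.max_ideal_mult[OF t0_max] by (auto simp: mult.commute)
next
  fix z :: "'k poly fract" assume z: "z \<in> max_ideal infinite_place"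
  have "z / t\<^sub>0 \<in> infinite_place"
  proof (cases "z = 0")
    case False
    then obtain n d where nd: "z = to_fract n / to_fract d" "n \<noteq> 0" "d \<noteq> 0" by (rule fract_nonzero_cases)
    have "inverse z \<notin> infinite_place" using z False by (simp add: max_ideal_iff)
    then have "degree n < degree d" using fraction_in_infinite_place[of d n] nd by simp
    then have "to_fract (n * [:0, 1:]) / to_fract d \<in> (infinite_place :: 'k poly fract set)"
      using nd by (subst fraction_in_infinite_place) (auto simp: degree_mult_eq)
    moreover have "to_fract (n * [:0, 1:]) / to_fract d = z / t\<^sub>0"
      unfolding nd(1) to_fract_mult by (simp add: divide_inverse mult_ac)
    ultimately show ?thesis by (simp only:)
  qed simp
  then show "z \<in> (\<lambda>a. t\<^sub>0 * a) ` infinite_place"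
    using t0_nonzero by (intro image_eqI[of _ _ "z / t\<^sub>0"]) auto
qed

sublocale inf: dvr "infinite_place :: 'k poly fract set"
proof
  have "\<exists>n u. u \<in> infinite_place - max_ideal infinite_place \<and> z = t\<^sub>0 powi n * u"
    if "z \<noteq> 0" for z
    using fract_nonzero_cases[OF that] infinite_decomp by metis
  then show "\<exists>t. t \<noteq> 0 \<and> uniformizer infinite_place t \<and> (\<forall>z. z \<noteq> 0 \<longrightarrow>
      (\<exists>n u. u \<in> infinite_place - max_ideal infinite_place \<and> z = (t :: 'k poly fract) powi n * u))"
    using uniformizer_t0 t0_nonzero by blast
qed

lemma hom_powi: "\<iota> (a powi n) = \<iota> a powi n"
  by (simp add: power_int_def hom_power hom_inverse)

text \<open>
  Every element of \<open>k(x)\<close> is a power of \<open>1/x\<close> times a unit at infinity, so the ramification index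
  is the order of \<open>1/x\<close> at \<open>P\<close>.
\<close>
lemma ord_base:
  assumes "n \<noteq> 0" "d \<noteq> 0"
  shows "v (\<iota> (to_fract n / to_fract d)) = 3 * (int (degree d) - int (degree n))"
proof -
  have mult: "v (\<iota> z) = v (\<iota> t\<^sub>0) * ord_at infinite_place z" if z: "z \<noteq> 0" for z
  proof -
    obtain u where u: "u \<in> infinite_place - max_ideal infinite_place" "z = t\<^sub>0 powi ord_at infinite_place z * u"
      using inf.ord_decomp[OF z uniformizer_t0] by blast
    have u': "\<iota> u \<in> P - max_ideal P" "u \<noteq> 0"
      using u(1) by (auto simp: max_ideal_infinite_place infinite_place_iff)
    have "v (\<iota> z) = v (\<iota> t\<^sub>0 powi ord_at infinite_place z * \<iota> u)"
      using arg_cong[OF u(2), of "\<lambda>z. v (\<iota> z)"] by (simp only: hom_mult hom_powi)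
    also have "\<dots> = ord_at infinite_place z * v (\<iota> t\<^sub>0) + v (\<iota> u)"
      using t0_nonzero u'(2) by (subst P.ord_mult) (auto simp: P.ord_powi)
    finally show ?thesis using P.ord_unit[OF u'(1)] by simp
  qed
  have "ramification_index \<iota> P = v (\<iota> t\<^sub>0)"
    unfolding ramification_index_def over
  proof (rule the_equality)
    show "\<forall>z. z \<noteq> 0 \<longrightarrow> v (\<iota> z) = v (\<iota> t\<^sub>0) * ord_at infinite_place z" using mult by blast
    fix e assume "\<forall>z. z \<noteq> 0 \<longrightarrow> v (\<iota> z) = e * ord_at infinite_place z"
    then have "v (\<iota> t\<^sub>0) = e * ord_at infinite_place t\<^sub>0" using t0_nonzero by blast
    then show "e = v (\<iota> t\<^sub>0)" using inf.ord_uniformizer[OF uniformizer_t0] by simp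
  qed
  moreover have "ord_at infinite_place (to_fract n / to_fract d) = int (degree d) - int (degree n)"
    using infinite_decomp[OF assms] inf.ord_eqI[OF uniformizer_t0] by metis
  ultimately show ?thesis using mult[of "to_fract n / to_fract d"] ram assms by simp
qed

lemma ord_E: "p \<noteq> 0 \<Longrightarrow> v (E p) = - 3 * int (degree p)"
  using ord_base[of p 1] by (simp add: \<iota>_to_fract)

lemma ord_base_dvd: "r \<noteq> 0 \<Longrightarrow> 3 dvd v (\<iota> r)"
  by (rule fract_nonzero_cases[of r]) (auto simp: ord_base)

lemma base_with_ord: "\<exists>r. r \<noteq> 0 \<and> v (\<iota> r) = 3 * j"
proof -
  have "v (\<iota> t\<^sub>0) = 3" using ord_base[of 1 "[:0, 1:]"] by (simp add: inverse_eq_divide)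
  then show ?thesis using t0_nonzero
    by (intro exI[of _ "t\<^sub>0 powi j"]) (simp add: hom_powi P.ord_powi)
qed

lemma ord_inverse_xi: "v (inverse \<xi>) = 3" and inverse_xi_mem: "inverse \<xi> \<in> max_ideal P"
proof -
  show 1: "v (inverse \<xi>) = 3" using ord_E[of "[:0, 1:]"] by (simp add: P.ord_inverse)
  show "inverse \<xi> \<in> max_ideal P" using P.max_ideal_iff_ord[of "inverse \<xi>"] 1 by simp
qed

text \<open>
  The sum of \<open>e f\<close> over all poles of \<open>x\<close> is at most 3, and \<open>P\<close> contributes \<open>e = 3\<close> already. Thus it
  has degree 1 and is the only pole.
\<close>
lemma place_degree_P: "place_degree \<kappa> P = 1"
proof -
  have "nat (v (inverse \<xi>)) * place_degree \<kappa> P \<le> 3"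
    using sum_ord_degree_le[OF const.dependent_over_inverse[OF dependent_over_xi], of "{P}"]
      P inverse_xi_mem by simp
  then show ?thesis using place_degree_pos[OF P] ord_inverse_xi by simp
qed

lemma pole_of_x_unique:
  assumes R: "valuation_ring \<kappa> R" and x: "\<xi> \<notin> R"
  shows "R = P"
proof (rule ccontr)
  assume "R \<noteq> P"
  interpret R: dvr R by (rule dvr[OF R])
  have m: "inverse \<xi> \<in> max_ideal R" using R.not_mem_imp[OF x] by blast
  then have "ord_at R (inverse \<xi>) > 0" using R.max_ideal_iff_ord[of "inverse \<xi>"] by simp
  then have "nat (ord_at R (inverse \<xi>)) * place_degree \<kappa> R > 0"
    using place_degree_pos[OF R] by simp
  moreover have "(\<Sum>R\<in>{P, R}. nat (ord_at R (inverse \<xi>)) * place_degree \<kappa> R) \<le> 3"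
  proof (rule sum_ord_degree_le[OF const.dependent_over_inverse[OF dependent_over_xi]])
    show "valuation_ring \<kappa> R' \<and> inverse \<xi> \<in> max_ideal R'" if "R' \<in> {P, R}" for R'
      using that P R inverse_xi_mem m by blast
  qed simp
  then have "nat (v (inverse \<xi>)) * place_degree \<kappa> P + nat (ord_at R (inverse \<xi>)) * place_degree \<kappa> R \<le> 3"
    using \<open>R \<noteq> P\<close> by (subst (asm) sum.insert) auto
  ultimately show False unfolding ord_inverse_xi place_degree_P by simp
qed

lemma xi_mem_iff: "valuation_ring \<kappa> R \<Longrightarrow> \<xi> \<in> R \<longleftrightarrow> R \<noteq> P"
proof -
  assume R: "valuation_ring \<kappa> R"
  have "\<xi> \<notin> P" using inverse_xi_mem xi_nonzero unfolding max_ideal_iff by simp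
  then show ?thesis using pole_of_x_unique[OF R] by blast
qed

lemma residue_const:
  assumes "z \<in> P"
  shows "\<exists>c. z - \<kappa> c \<in> max_ideal P"
proof -
  obtain b where b: "\<And>z. z \<in> P \<Longrightarrow> \<exists>c. z - (\<Sum>i<place_degree \<kappa> P. \<kappa> (c i) * b i) \<in> max_ideal P"
    using residue_representatives[OF P] by metis
  then have b: "\<And>z. z \<in> P \<Longrightarrow> \<exists>c. z - \<kappa> (c (0::nat)) * b 0 \<in> max_ideal P"
    unfolding place_degree_P by simp
  obtain c where c: "z - \<kappa> c * b 0 \<in> max_ideal P" using b[OF assms] by blast
  obtain e where e: "1 - \<kappa> e * b 0 \<in> max_ideal P" using b[OF P.one_mem] by blast
  have e0: "e \<noteq> 0" using e P.one_notin_max by auto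
  have "\<kappa> (c / e) * (1 - \<kappa> e * b 0) \<in> max_ideal P"
    by (rule P.max_ideal_mult[OF e const_mem[OF P]])
  from P.max_ideal_diff[OF c this]
  have "z - \<kappa> (c / e) \<in> max_ideal P" using e0 by (simp add: const.hom_divide field_simps)
  then show ?thesis by blast
qed

text \<open>
  As the residue field is \<open>k\<close>, two elements of equal order are proportional to first approximation.
\<close>
lemma leading_const:
  assumes "z \<noteq> 0" "w \<noteq> 0" "v z = v w"
  shows "\<exists>c. P.vge (v z + 1) (z - \<kappa> c * w)"
proof -
  have "z / w \<in> P" using P.mem_iff_ord[of "z / w"] assms by (simp add: P.ord_divide)
  then obtain c where "z / w - \<kappa> c \<in> max_ideal P" using residue_const by blast
  then have "P.vge 1 ((z - \<kappa> c * w) / w)" using assms(2) by (simp add: P.vge_max_ideal diff_divide_distrib)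
  then have "P.vge (1 + v w) (z - \<kappa> c * w)" using P.vge_iff_divide[OF assms(2)] by blast
  then show ?thesis using assms(3) by (auto simp: add.commute)
qed

lemma three_eq_0: "(3 :: 'f) = 0"
proof -
  have "(3 :: 'f) = \<kappa> (1 + 1 + 1)" by (simp only: const.hom_add const.hom_1) simp
  also have "(1 + 1 + 1 :: 'k) = 0" using char3 by simp
  finally show ?thesis by simp
qed

lemma cube_diff: "(a - b) ^ 3 = a ^ 3 - b ^ (3 :: nat)" for a b :: 'f
proof -
  have "(a - b) ^ 3 = a ^ 3 - b ^ 3 + 3 * (a * b * (b - a))"
    by (simp add: power3_eq_cube algebra_simps)
  then show ?thesis by (simp add: three_eq_0)
qed

lemma B_nonzero: "B \<noteq> 0"
  using no_root[of 0] by auto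

text \<open>
  The difference \<open>u = y - r\<close> satisfies \<open>u\<^sup>3 - A u + C = 0\<close>, since cubing is additive. Either \<open>u\<close> has
  pole order exactly \<open>3/2 deg A\<close>, or the linear term dominates the cubic one and balances \<open>C\<close>. In both
  cases the order of \<open>u\<close> is divisible by 3, so that \<open>u\<close> in turn is approximated by an element of \<open>k(x)\<close>.
\<close>
lemma approximation_step:
  assumes A: "A \<noteq> 0" and u: "2 * v (y - \<iota> r) \<ge> - 3 * int (degree A)"
  shows "\<exists>r'. P.vge (v (y - \<iota> r) + 1) (y - \<iota> r')"
proof -
  define u where "u = y - \<iota> r"
  define C where "C = r ^ 3 - to_fract A * r + to_fract B"
  have C0: "C \<noteq> 0" unfolding C_def by (rule no_root)
  have u0: "u \<noteq> 0" using y_notin_base by (simp add: u_def)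
  have eq: "u ^ 3 - E A * u = - \<iota> C"
    using cubic unfolding u_def cube_diff C_def
    by (simp add: hom_add hom_diff hom_mult hom_power \<iota>_to_fract algebra_simps eq_neg_iff_add_eq_0)
  have oA: "v (E A * u) = v u - 3 * int (degree A)" using A u0 by (simp add: P.ord_mult ord_E)
  have "3 dvd v u"
  proof (cases "2 * v u = - 3 * int (degree A)")
    case True
    then show ?thesis by presburger
  next
    case False
    then have lt: "v (- (E A * u)) < v (u ^ 3)"
      using u oA u0 by (simp add: u_def[symmetric] P.ord_power)
    have "v (- (E A * u) + u ^ 3) = v (- (E A * u))"
      using P.ord_add_eq[of "- (E A * u)" "u ^ 3"] lt A u0 by simp
    then have "v (\<iota> C) = v u - 3 * int (degree A)" using eq oA by simp
    moreover have "3 dvd v (\<iota> C)" using C0 by (rule ord_base_dvd)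
    ultimately show ?thesis by presburger
  qed
  then obtain j where j: "v u = 3 * j" by blast
  obtain s where s: "s \<noteq> 0" "v (\<iota> s) = 3 * j" using base_with_ord by blast
  obtain c where c: "P.vge (v u + 1) (u - \<kappa> c * \<iota> s)"
    using leading_const[OF u0, of "\<iota> s"] s j by auto
  have "u - \<kappa> c * \<iota> s = y - \<iota> (r + to_fract [:c:] * s)"
    by (simp add: u_def hom_add hom_mult \<iota>_to_fract E_const)
  then show ?thesis using c unfolding u_def by metis
qed

lemma approximation:
  assumes A: "A \<noteq> 0" and y: "2 * v y \<ge> - 3 * int (degree A)"
  shows "\<exists>r. P.vge (v y + int n) (y - \<iota> r)"
proof (induction n)
  case 0
  show ?case using P.vge_ord by (intro exI[of _ 0]) simp
next
  case (Suc n)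
  then obtain r where r: "P.vge (v y + int n) (y - \<iota> r)" by blast
  have "y - \<iota> r \<noteq> 0" using y_notin_base by simp
  then have le: "v y + int n \<le> v (y - \<iota> r)" using r by (simp add: P.vge_def)
  then have "2 * v (y - \<iota> r) \<ge> - 3 * int (degree A)" using y by linarith
  from approximation_step[OF A this] obtain r' where "P.vge (v (y - \<iota> r) + 1) (y - \<iota> r')" by blast
  then show ?case using le P.vge_mono by (intro exI[of _ r']) fastforce
qed

text \<open>
  Approximating \<open>y\<close>, and with it a uniformizer, from the base field would give an element of the
  base field with order prime to 3.
\<close>
lemma ord_y_bound:
  assumes A: "A \<noteq> 0"
  shows "2 * v y < - 3 * int (degree A)"
proof (rule ccontr)
  assume "\<not> ?thesis"
  then have big: "2 * v y \<ge> - 3 * int (degree A)" by simp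
  obtain t where t: "uniformizer P t" using P.uniformizer_ex by blast
  have t0: "t \<noteq> 0" "v t = 1" using P.uniformizer_nonzero[OF t] P.ord_uniformizer[OF t] by auto
  obtain a b c d where d: "d \<noteq> 0" "E d * t = combo a b c" by (rule fractional_form)
  have dt: "E d * t \<noteq> 0" "v (E d * t) = 1 - 3 * int (degree d)"
    using d(1) t0 by (simp_all add: P.ord_mult ord_E)
  define K where "K = min (v (E b + E c * (2 * y))) (v (E c))"
  define n where "n = nat (- v y) + nat (v (E d * t) + 1 - K - v y)"
  obtain r where r: "P.vge (v y + int n) (y - \<iota> r)" using approximation[OF A big] by blast
  define N where "N = v y + int n"
  have N: "N \<ge> 0" "N + K \<ge> v (E d * t) + 1" unfolding N_def n_def by linarith+
  let ?s = "to_fract a + to_fract b * r + to_fract c * r ^ 2"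
  have "E d * t - \<iota> ?s = (y - \<iota> r) * ((E b + E c * (2 * y)) - E c * (y - \<iota> r))"
    unfolding d(2) combo_def
    by (simp add: hom_add hom_mult hom_power \<iota>_to_fract power2_eq_square algebra_simps)
  moreover have "P.vge (N + K) \<dots>"
  proof (rule P.vge_mult[OF _ P.vge_diff])
    show "P.vge N (y - \<iota> r)" using r by (simp add: N_def)
    show "P.vge K (E b + E c * (2 * y))" using P.vge_mono[OF P.vge_ord] by (simp add: K_def)
    show "P.vge K (E c * (y - \<iota> r))"
      using P.vge_mono[OF P.vge_mult[OF P.vge_ord[of "E c"] r], of K] N(1)
      by (simp add: K_def N_def[symmetric])
  qed
  ultimately have "P.vge (N + K) (E d * t - \<iota> ?s)" by (simp only:)
  then have "P.vge (v (E d * t) + 1) (- (E d * t - \<iota> ?s))"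
    unfolding P.vge_minus by (rule P.vge_mono) (rule N(2))
  then have "P.vge (v (E d * t) + 1) (\<iota> ?s - E d * t)" by (simp only: minus_diff_eq)
  from P.ord_eq_of_vge[OF dt(1) this] have "\<iota> ?s \<noteq> 0" "v (\<iota> ?s) = 1 - 3 * int (degree d)"
    using dt(2) by auto
  then have "3 dvd 1 - 3 * int (degree d)" using ord_base_dvd[of ?s] by (metis hom_eq_0_iff)
  then show False by presburger
qed

lemma y_nonzero: "y \<noteq> 0"
  using y_notin_base[of 0] by simp

text \<open>
  With a pole of order greater than \<open>3/2 deg A\<close>, the term \<open>y\<^sup>3\<close> dominates \<open>A y\<close> and must balance \<open>B\<close>.
\<close>
lemma ord_y:
  assumes A: "A \<noteq> 0"
  shows "v y = - int (degree B)"
proof -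
  have "v (y ^ 3) = 3 * v y" using y_nonzero P.ord_power[of y 3] by simp
  moreover have "v (- (E A * y)) = v y - 3 * int (degree A)"
    using A y_nonzero by (simp add: P.ord_mult ord_E)
  ultimately have "v (y ^ 3 + - (E A * y)) = 3 * v y"
    using P.ord_add_eq(2)[of "y ^ 3" "- (E A * y)"] y_nonzero ord_y_bound[OF A] by simp
  moreover have "y ^ 3 + - (E A * y) = - E B" using y3 by simp
  ultimately show ?thesis using ord_E[OF B_nonzero] by simp
qed

end

section \<open>A basis adapted to the pole orders at infinity\<close>

locale index_cubic = ramified_cubic \<iota> A B y P
  for \<iota> :: "'k :: {field, finite} poly fract \<Rightarrow> 'f :: field" and A B y P +
  fixes bas :: "'f ^ 3"
  assumes A_nonzero: "A \<noteq> 0"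
    and degree_B: "\<not> 3 dvd degree B"
    and basis: "integral_basis \<iota> bas"
begin

abbreviation "\<O> \<equiv> integral_closure \<iota>"

lemma residue_injective:
  assumes "i < 3" "j < (3 :: nat)" "3 dvd (int i - int j) * int (degree B)"
  shows "i = j"
proof -
  have B: "\<not> (3 :: int) dvd int (degree B)" using degree_B by presburger
  have "i = 0 \<or> i = 1 \<or> i = 2" "j = 0 \<or> j = 1 \<or> j = 2" using assms by auto
  then show ?thesis using assms(3) B by (elim disjE) (simp, simp, presburger | simp | presburger)+
qed

text \<open>
  The congruences put the pole orders of \<open>w 0, w 1, w 2\<close> into the three residue classes
  modulo 3, in the order in which \<open>1, y, y^2\<close> occupy them.
\<close>
definition graded :: "(nat \<Rightarrow> 'f) \<Rightarrow> bool" where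
  "graded w \<longleftrightarrow> (\<forall>i<3. w i \<noteq> 0 \<and> 3 dvd v (w i) + int i * int (degree B))"

lemma graded_sum:
  assumes w: "graded w" and k: "k < 3" "c k \<noteq> 0"
  shows "(\<Sum>i<3. E (c i) * w i) \<noteq> 0"
    and "v (\<Sum>i<3. E (c i) * w i) \<le> v (w k) - 3 * int (degree (c k))"
    and "\<exists>i<3. c i \<noteq> 0 \<and> v (\<Sum>i<3. E (c i) * w i) = v (w i) - 3 * int (degree (c i))"
proof -
  have o: "v (E (c i) * w i) = v (w i) - 3 * int (degree (c i))" if "i < 3" "c i \<noteq> 0" for i
    using that w by (simp add: P.ord_mult ord_E graded_def)
  have inj: "i = j" if ij: "i \<in> {..<3}" "j \<in> {..<3}" "E (c i) * w i \<noteq> 0" "E (c j) * w j \<noteq> 0"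
    "v (E (c i) * w i) = v (E (c j) * w j)" for i j
  proof (rule residue_injective)
    show "i < 3" "j < 3" using ij by auto
    have "v (w i) - 3 * int (degree (c i)) = v (w j) - 3 * int (degree (c j))"
      using ij o[of i] o[of j] by auto
    moreover have "3 dvd v (w i) + int i * int (degree B)" "3 dvd v (w j) + int j * int (degree B)"
      using w ij by (auto simp: graded_def)
    ultimately have "3 dvd int i * int (degree B) - int j * int (degree B)" by presburger
    then show "3 dvd (int i - int j) * int (degree B)" by (simp add: left_diff_distrib)
  qed
  have "E (c k) * w k \<noteq> 0" using k w by (simp add: graded_def)
  with P.ord_sum_distinct[of "{..<3}" "\<lambda>i. E (c i) * w i" k] inj k(1)
  have *: "(\<Sum>i<3. E (c i) * w i) \<noteq> 0" "v (\<Sum>i<3. E (c i) * w i) \<le> v (E (c k) * w k)"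
    "\<exists>i\<in>{..<3}. E (c i) * w i \<noteq> 0 \<and> v (\<Sum>i<3. E (c i) * w i) = v (E (c i) * w i)"
    by auto
  from * show "(\<Sum>i<3. E (c i) * w i) \<noteq> 0" "v (\<Sum>i<3. E (c i) * w i) \<le> v (w k) - 3 * int (degree (c k))"
    using o[OF k] by auto
  from *(3) obtain i where "i < 3" "c i \<noteq> 0" "v (\<Sum>i<3. E (c i) * w i) = v (E (c i) * w i)" by auto
  then show "\<exists>i<3. c i \<noteq> 0 \<and> v (\<Sum>i<3. E (c i) * w i) = v (w i) - 3 * int (degree (c i))"
    using o by metis
qed

lemma ord_y_power: "v (y ^ i) = - (int i * int (degree B))"
  using y_nonzero ord_y[OF A_nonzero] by (simp add: P.ord_power)

lemma graded_powers: "graded (\<lambda>i. y ^ i)"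
  using y_nonzero by (simp add: graded_def ord_y_power)

lemma combo_eq_sum: "combo a b c = (\<Sum>i<3. E ([a, b, c] ! i) * y ^ i)"
  by (simp add: combo_def numeral_eq_Suc)

lemma ord_combo_le: "combo a b c \<noteq> 0 \<Longrightarrow> v (combo a b c) \<le> 0"
proof -
  assume nz: "combo a b c \<noteq> 0"
  have "\<exists>k<3. [a, b, c] ! k \<noteq> 0"
  proof (rule ccontr)
    assume "\<not> ?thesis"
    then have "(\<Sum>i<3. E ([a, b, c] ! i) * y ^ i) = 0" by (intro sum.neutral) auto
    then show False using nz by (simp add: combo_eq_sum)
  qed
  then obtain k where "k < 3" "[a, b, c] ! k \<noteq> 0" by blast
  then have "v (combo a b c) \<le> v (y ^ k) - 3 * int (degree ([a, b, c] ! k))"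
    unfolding combo_eq_sum by (rule graded_sum(2)[OF graded_powers])
  moreover have "v (y ^ k) \<le> 0" by (simp add: ord_y_power)
  ultimately show ?thesis by linarith
qed

lemma common_denominator: "\<exists>d. d \<noteq> 0 \<and> (\<forall>z\<in>\<O>. \<exists>a b c. E d * z = combo a b c)"
proof -
  have "\<exists>d a b c. d \<noteq> 0 \<and> E d * bas $ i = combo a b c" for i
  proof -
    obtain a b c d where "d \<noteq> 0" "E d * bas $ i = combo a b c" by (rule fractional_form)
    then show ?thesis by blast
  qed
  then obtain d a b c where d: "\<And>i. d i \<noteq> 0" "\<And>i. E (d i) * bas $ i = combo (a i) (b i) (c i)"
    by metis
  define dd e where "dd = (\<Prod>i\<in>UNIV. d i)" and "e i = (\<Prod>j\<in>UNIV - {i}. d j)" for i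
  have e: "dd = e i * d i" for i
    unfolding dd_def e_def by (subst prod.remove[of _ i]) (auto simp: mult.commute)
  have "\<exists>a b c. E dd * z = combo a b c" if zO: "z \<in> \<O>" for z
  proof -
    obtain r :: "'k poly ^ 3" where r: "z = (\<Sum>i\<in>UNIV. E (r $ i) * bas $ i)"
      using basis zO unfolding integral_basis_def by blast
    have "E dd * z = (\<Sum>i\<in>UNIV. E (r $ i * e i) * (E (d i) * bas $ i))"
      unfolding r sum_distrib_left
    proof (rule sum.cong)
      fix i :: 3
      have "E dd = E (e i) * E (d i)" using arg_cong[OF e[of i], of E] by (simp only: E_mult)
      then show "E dd * (E (r $ i) * bas $ i) = E (r $ i * e i) * (E (d i) * bas $ i)"
        by (simp add: E_mult mult_ac)
    qed simp
    also have "\<dots> = (\<Sum>i\<in>UNIV. combo (r $ i * e i * a i) (r $ i * e i * b i) (r $ i * e i * c i))"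
      by (rule sum.cong) (simp_all add: d(2) combo_smult)
    finally show ?thesis unfolding combo_sum by blast
  qed
  moreover have "dd \<noteq> 0" using d(1) by (simp add: dd_def)
  ultimately show ?thesis by blast
qed

text \<open>
  The powers of an integral element have a common denominator \<open>d\<close>, and elements of \<open>k[x,y]\<close> have no
  zeros at infinity; so zeros of powers of \<open>z\<close> have bounded order.
\<close>
lemma ord_integral_le:
  assumes z: "z \<in> \<O>" "z \<noteq> 0"
  shows "v z \<le> 0"
proof (rule ccontr)
  assume "\<not> ?thesis"
  then have pos: "v z \<ge> 1" by simp
  obtain d where d: "d \<noteq> 0" "\<forall>z\<in>\<O>. \<exists>a b c. E d * z = combo a b c"
    using common_denominator by blast
  define n where "n = Suc (3 * degree d)"
  have "z ^ n \<in> \<O>" using z(1) by (rule integral_closure_power)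
  then obtain a b c where "E d * z ^ n = combo a b c" using d(2) by blast
  moreover have "E d * z ^ n \<noteq> 0" using d(1) z(2) by simp
  ultimately have "v (E d * z ^ n) \<le> 0" using ord_combo_le[of a b c] by (simp only:) simp
  then have "int n * v z \<le> 3 * int (degree d)"
    using d(1) z(2) by (simp add: P.ord_mult ord_E P.ord_power)
  moreover have "int n * 1 \<le> int n * v z" using pos by (intro mult_left_mono) auto
  ultimately have "int n \<le> 3 * int (degree d)" by linarith
  then show False by (simp add: n_def)
qed

text \<open>
  By minimality, subtracting a suitable multiple \<open>c x\<^sup>j w\<^sub>i\<close> lowers the pole order of any nonzero integral
  element or yields \<open>0\<close>.
\<close>
definition reduced :: "(nat \<Rightarrow> 'f) \<Rightarrow> bool" where
  "reduced w \<longleftrightarrow> graded w \<and> (\<forall>i<3. w i \<in> \<O> \<and>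
     (\<forall>z\<in>\<O>. z \<noteq> 0 \<longrightarrow> 3 dvd v z + int i * int (degree B) \<longrightarrow> v z \<le> v (w i)))"

lemma reduced_exists: "\<exists>w. reduced w"
proof -
  have "\<exists>z. (z \<in> \<O> \<and> z \<noteq> 0 \<and> 3 dvd v z + int i * int (degree B)) \<and>
     (\<forall>z'. z' \<in> \<O> \<and> z' \<noteq> 0 \<and> 3 dvd v z' + int i * int (degree B) \<longrightarrow> nat (- v z) \<le> nat (- v z'))" for i :: nat
    by (rule ex_has_least_nat[of _ "y ^ i"])
      (use y_nonzero in \<open>simp add: ord_y_power integral_closure_power y_integral\<close>)
  then obtain w where w: "\<And>i. w i \<in> \<O> \<and> w i \<noteq> 0 \<and> 3 dvd v (w i) + int i * int (degree B)"
    "\<And>i z'. z' \<in> \<O> \<Longrightarrow> z' \<noteq> 0 \<Longrightarrow> 3 dvd v z' + int i * int (degree B) \<Longrightarrow> nat (- v (w i)) \<le> nat (- v z')"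
    by metis
  have "v z \<le> v (w i)" if "z \<in> \<O>" "z \<noteq> 0" "3 dvd v z + int i * int (degree B)" for i z
    using w(2)[OF that] ord_integral_le[OF that(1,2)] ord_integral_le[of "w i"] w(1)[of i] by linarith
  then show ?thesis unfolding reduced_def graded_def using w(1) by blast
qed

text \<open>Leading terms are cancelled one after the other; the pole order cannot drop below zero.\<close>
lemma reduced_spans:
  assumes w: "reduced w" and z: "z \<in> \<O>"
  shows "\<exists>c. z = (\<Sum>i<3. E (c i) * w i)"
  using z
proof (induction "nat (- v z)" arbitrary: z rule: less_induct)
  case less
  show ?case
  proof (cases "z = 0")
    case True
    then show ?thesis by (intro exI[of _ "\<lambda>_. 0"]) simp
  next
    case False
    have "\<exists>i<3. 3 dvd v z + int i * int (degree B)"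
    proof -
      have "\<not> 3 dvd int (degree B)" using degree_B by presburger
      then have "3 dvd v z \<or> 3 dvd v z + int (degree B) \<or> 3 dvd v z + 2 * int (degree B)" by presburger
      then have "3 dvd v z + int 0 * int (degree B) \<or> 3 dvd v z + int 1 * int (degree B) \<or>
        3 dvd v z + int 2 * int (degree B)" by simp
      moreover have "0 < (3::nat)" "1 < (3::nat)" "2 < (3::nat)" by simp_all
      ultimately show ?thesis by blast
    qed
    then obtain i where i: "i < 3" "3 dvd v z + int i * int (degree B)" by blast
    have wi: "w i \<noteq> 0" "w i \<in> \<O>" "3 dvd v (w i) + int i * int (degree B)" "v z \<le> v (w i)"
      using w i less.prems False unfolding reduced_def graded_def by auto
    then have "3 dvd v (w i) - v z" using i(2) by presburger
    then obtain m where m: "v (w i) - v z = 3 * m" by blast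
    define j where "j = nat m"
    have j: "v (w i) - v z = 3 * int j" using m wi(4) by (simp add: j_def)
    have o: "v (E (monom 1 j) * w i) = v z" using wi(1) j by (simp add: P.ord_mult ord_E degree_monom_eq)
    have nz: "E (monom 1 j) * w i \<noteq> 0" using wi(1) by simp
    obtain c where c: "P.vge (v z + 1) (z - \<kappa> c * (E (monom 1 j) * w i))"
      using leading_const[OF False nz] o by auto
    define z' where "z' = z - E (monom c j) * w i"
    have "\<kappa> c * (E (monom 1 j) * w i) = E (monom c j) * w i" by (simp add: E_monom mult.assoc)
    then have vz': "P.vge (v z + 1) z'" using c by (simp only: z'_def)
    have z'O: "z' \<in> \<O>" unfolding z'_def
      by (intro integral_closure_diff integral_closure_mult integral_closure_E less.prems wi)
    have "\<exists>c. z' = (\<Sum>i<3. E (c i) * w i)"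
    proof (cases "z' = 0")
      case True
      then show ?thesis by (intro exI[of _ "\<lambda>_. 0"]) simp
    next
      case False
      then have "v z' \<ge> v z + 1" "v z' \<le> 0" using vz' ord_integral_le[OF z'O] by (auto simp: P.vge_def)
      then have "nat (- v z') < nat (- v z)" by linarith
      then show ?thesis using less.hyps z'O by blast
    qed
    then obtain a where a: "z' = (\<Sum>i<3. E (a i) * w i)" by blast
    have "(\<Sum>k<3. E (a k + (if k = i then monom c j else 0)) * w k) =
        (\<Sum>k<3. E (a k) * w k) + (\<Sum>k<3. if k = i then E (monom c j) * w k else 0)"
      unfolding sum.distrib[symmetric] by (rule sum.cong) (auto simp: E_add algebra_simps)
    also have "\<dots> = z' + E (monom c j) * w i" using i(1) by (simp add: a)
    also have "\<dots> = z" by (simp add: z'_def)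
    finally show ?thesis by metis
  qed
qed

lemma graded_unique:
  assumes w: "graded w" and eq: "(\<Sum>i<3. E (c i) * w i) = (\<Sum>i<3. E (d i) * w i)" and i: "i < 3"
  shows "c i = d i"
proof (rule ccontr)
  assume "c i \<noteq> d i"
  then have "(\<Sum>i<3. E (c i - d i) * w i) \<noteq> 0" using graded_sum(1)[OF w i, of "\<lambda>i. c i - d i"] by simp
  then show False using eq by (simp add: E_diff left_diff_distrib sum_subtractf)
qed

text \<open>
  In a graded basis, a bound on the pole order of a combination bounds each term separately.
\<close>
lemma card_bounded_poles:
  assumes w: "reduced w" and M: "\<And>i. i < 3 \<Longrightarrow> 3 * M + v (w i) \<ge> 0"
  shows "finite {z \<in> \<O>. P.vge (- 3 * M) z}"
    and "card {z \<in> \<O>. P.vge (- 3 * M) z} = CARD('k) ^ (\<Sum>i<3. nat ((3 * M + v (w i)) div 3) + 1)"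
proof -
  have gr: "graded w" using w by (simp add: reduced_def)
  define m where "m i = nat ((3 * M + v (w i)) div 3) + 1" for i
  define T :: "(nat \<Rightarrow> 'k poly) set" where "T = (\<Pi>\<^sub>E i\<in>{..<3}. polys_below (m i))"
  define \<Phi> where "\<Phi> c = (\<Sum>i<3. E (c i) * w i)" for c
  have deg: "c \<in> polys_below (m i) \<longleftrightarrow> c = 0 \<or> 3 * int (degree c) \<le> 3 * M + v (w i)" if "i < 3" for c i
  proof -
    have "degree c < m i \<longleftrightarrow> 3 * int (degree c) \<le> 3 * M + v (w i)"
      using M[OF that] unfolding m_def by linarith
    moreover have "0 \<in> polys_below (m i)" by (simp add: polys_below_def)
    ultimately show ?thesis using degree_polys_below[of c] polys_below_degree[of c] by blast
  qed
  have bij: "bij_betw \<Phi> T {z \<in> \<O>. P.vge (- 3 * M) z}"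
    unfolding bij_betw_def
  proof (intro conjI inj_onI subset_antisym subsetI)
    fix c d assume "c \<in> T" "d \<in> T" "\<Phi> c = \<Phi> d"
    then show "c = d" using graded_unique[OF gr] unfolding T_def \<Phi>_def
      by (intro PiE_ext[of c "{..<3}"]) auto
  next
    fix z assume "z \<in> \<Phi> ` T"
    then obtain c where c: "c \<in> T" "z = \<Phi> c" by blast
    have "z \<in> \<O>" unfolding c \<Phi>_def using w
      by (intro integral_closure_sum integral_closure_mult integral_closure_E) (auto simp: reduced_def)
    moreover have "P.vge (- 3 * M) z"
      unfolding c \<Phi>_def
    proof (rule P.vge_sum)
      fix i :: nat assume "i \<in> {..<3}"
      then have i: "i < 3" "c i \<in> polys_below (m i)" "w i \<noteq> 0" using c gr by (auto simp: T_def graded_def)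
      then have "c i = 0 \<or> 3 * int (degree (c i)) \<le> 3 * M + v (w i)" using deg by blast
      then show "P.vge (- 3 * M) (E (c i) * w i)"
        using i(3) by (cases "c i = 0") (auto simp: P.vge_def P.ord_mult ord_E)
    qed
    ultimately show "z \<in> {z \<in> \<O>. P.vge (- 3 * M) z}" by blast
  next
    fix z assume z: "z \<in> {z \<in> \<O>. P.vge (- 3 * M) z}"
    then obtain c where c: "z = \<Phi> c" using reduced_spans[OF w] unfolding \<Phi>_def by blast
    have "c i \<in> polys_below (m i)" if "i < 3" for i
    proof (cases "c i = 0")
      case False
      have "v z \<ge> - 3 * M" using z graded_sum(1)[where c = c, OF gr that False] c by (auto simp: P.vge_def \<Phi>_def)
      moreover have "v z \<le> v (w i) - 3 * int (degree (c i))"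
        using graded_sum(2)[where c = c, OF gr that False] c by (simp add: \<Phi>_def)
      ultimately have "3 * int (degree (c i)) \<le> 3 * M + v (w i)" by linarith
      then show ?thesis using deg[OF that] by blast
    qed (simp add: polys_below_def)
    then have "restrict c {..<3} \<in> T" by (auto simp: T_def)
    moreover have "\<Phi> (restrict c {..<3}) = z" unfolding c \<Phi>_def by (rule sum.cong) auto
    ultimately show "z \<in> \<Phi> ` T" by blast
  qed
  have "finite T" unfolding T_def by (intro finite_PiE) (auto simp: card_polys_below)
  then show "finite {z \<in> \<O>. P.vge (- 3 * M) z}" using bij_betw_finite[OF bij] by blast
  have "card T = CARD('k) ^ (\<Sum>i<3. m i)"
    unfolding T_def by (simp add: card_PiE card_polys_below power_sum)
  then show "card {z \<in> \<O>. P.vge (- 3 * M) z} = CARD('k) ^ (\<Sum>i<3. nat ((3 * M + v (w i)) div 3) + 1)"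
    using bij_betw_same_card[OF bij] by (simp add: m_def)
qed


section \<open>The genus from the pole orders\<close>

lemma sum_below_3: "(\<Sum>i<3. g i) = g 0 + g 1 + g (2 :: nat)" for g :: "nat \<Rightarrow> 'b :: comm_monoid_add"
  by (simp add: numeral_eq_Suc)

text \<open>
  For reduced \<open>w\<close> this is the number of positive integers that are not pole orders of integral
  elements, that is, the number of gaps at \<open>P\<close>.
\<close>
definition gap_number :: "(nat \<Rightarrow> 'f) \<Rightarrow> int" where
  "gap_number w = (- (\<Sum>i<3. v (w i))) div 3 - 1"

lemma gap_number_eq:
  assumes w: "graded w"
  shows "3 * gap_number w = - (v (w 0) + v (w 1) + v (w 2)) - 3"
proof -
  have "3 dvd v (w 0)" "3 dvd v (w 1) + int (degree B)" "3 dvd v (w 2) + 2 * int (degree B)"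
    using w unfolding graded_def by (metis zero_less_numeral of_nat_0 mult_zero_left add_0_right,
      metis one_less_numeral_iff semiring_norm(77) of_nat_1 mult_1,
      metis of_nat_numeral lessI numeral_3_eq_3 numeral_2_eq_2)
  then have "3 dvd - (v (w 0) + v (w 1) + v (w 2))" by presburger
  moreover have "(\<Sum>i<3. v (w i)) = v (w 0) + v (w 1) + v (w 2)" by (rule sum_below_3)
  ultimately show ?thesis unfolding gap_number_def by (simp add: algebra_simps)
qed

lemma sum_dimensions:
  assumes w: "graded w" and M: "\<And>i. i < 3 \<Longrightarrow> 3 * M + v (w i) \<ge> 0"
  shows "int (\<Sum>i<3. nat ((3 * M + v (w i)) div 3) + 1) = 3 * M + 1 - gap_number w"
proof -
  have d: "3 dvd v (w 0)" "3 dvd v (w 1) + int (degree B)" "3 dvd v (w 2) + 2 * int (degree B)"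
    using w unfolding graded_def by (metis zero_less_numeral of_nat_0 mult_zero_left add_0_right,
      metis one_less_numeral_iff semiring_norm(77) of_nat_1 mult_1,
      metis of_nat_numeral lessI numeral_3_eq_3 numeral_2_eq_2)
  have M': "3 * M + v (w 0) \<ge> 0" "3 * M + v (w 1) \<ge> 0" "3 * M + v (w 2) \<ge> 0" using M by auto
  have B: "\<not> 3 dvd int (degree B)" using degree_B by presburger
  have "(3 * M + v (w 0)) div 3 \<ge> 0" "(3 * M + v (w 1)) div 3 \<ge> 0" "(3 * M + v (w 2)) div 3 \<ge> 0"
    using M' by (simp_all only: pos_imp_zdiv_nonneg_iff[OF zero_less_numeral])
  then have 1: "int (\<Sum>i<3. nat ((3 * M + v (w i)) div 3) + 1) =
      (3 * M + v (w 0)) div 3 + (3 * M + v (w 1)) div 3 + (3 * M + v (w 2)) div 3 + 3"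
    unfolding sum_below_3 by simp
  have 2: "3 * ((3 * M + v (w 0)) div 3 + (3 * M + v (w 1)) div 3 + (3 * M + v (w 2)) div 3 + 3) =
      9 * M + v (w 0) + v (w 1) + v (w 2) + 6"
  proof -
    have "v (w 0) mod 3 = 0" using d(1) by presburger
    moreover have "v (w 1) mod 3 + v (w 2) mod 3 = 3"
    proof -
      have "int (degree B) mod 3 = 1 \<or> int (degree B) mod 3 = 2" using B by presburger
      then have "v (w 1) mod 3 = 2 \<and> v (w 2) mod 3 = 1 \<or> v (w 1) mod 3 = 1 \<and> v (w 2) mod 3 = 2"
        using d(2,3) by (elim disjE) presburger+
      then show ?thesis by auto
    qed
    moreover have "(3 * M + x) div 3 = M + x div 3" for x by simp
    moreover have "x = 3 * (x div 3) + x mod 3" for x :: int by simp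
    ultimately show ?thesis by (smt (verit))
  qed
  have solve: "a = 3 * M + 1 - g" if "3 * a = 9 * M + b + c + d + 6" "3 * g = - (b + c + d) - 3"
    for a b c d g :: int using that by linarith
  show ?thesis unfolding 1 by (rule solve[OF 2 gap_number_eq[OF w]])
qed

lemma integral_iff_vge:
  "z \<in> \<O> \<longleftrightarrow> (\<forall>R. valuation_ring \<kappa> R \<longrightarrow> R \<noteq> P \<longrightarrow> dvr.vge R 0 z)"
  unfolding integral_closure_iff using xi_mem_iff dvr.vge_mem[OF dvr] by blast

text \<open>
  These divisors dominate all others, and multiplication by \<open>f\<close> reduces their Riemann--Roch spaces
  to those of the multiples of \<open>P\<close>.
\<close>
definition zeros_plus :: "'k poly \<Rightarrow> int \<Rightarrow> 'f set \<Rightarrow> int" where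
  "zeros_plus f N R = (if R = P then N else ord_at R (E f))"

lemma zeros_nonneg: "valuation_ring \<kappa> R \<Longrightarrow> R \<noteq> P \<Longrightarrow> f \<noteq> 0 \<Longrightarrow> ord_at R (E f) \<ge> 0"
proof -
  assume R: "valuation_ring \<kappa> R" and "R \<noteq> P" and f: "f \<noteq> 0"
  then have "E f \<in> R" using E_mem xi_mem_iff by blast
  then show ?thesis using dvr.mem_iff_ord[OF dvr[OF R], of "E f"] f by simp
qed

text \<open>
  The zeros of \<open>f\<close>, counted with multiplicity, have total degree at most \<open>[F : k(f)]\<close>.
\<close>
lemma finite_zero_set:
  assumes f: "f \<noteq> 0"
  shows "finite {R. valuation_ring \<kappa> R \<and> R \<noteq> P \<and> ord_at R (E f) \<noteq> 0}"
    and "\<And>S. finite S \<Longrightarrow> S \<subseteq> {R. valuation_ring \<kappa> R \<and> R \<noteq> P \<and> ord_at R (E f) \<noteq> 0} \<Longrightarrow>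
      (\<Sum>R\<in>S. ord_at R (E f) * int (place_degree \<kappa> R)) \<le> 3 * int (degree f)"
proof -
  let ?Z = "{R. valuation_ring \<kappa> R \<and> R \<noteq> P \<and> ord_at R (E f) \<noteq> 0}"
  have pos: "valuation_ring \<kappa> R" "ord_at R (E f) > 0" "E f \<in> max_ideal R" if "R \<in> ?Z" for R
  proof -
    show R: "valuation_ring \<kappa> R" using that by blast
    show o: "ord_at R (E f) > 0" using that zeros_nonneg[OF R _ f] by force
    then show "E f \<in> max_ideal R" using dvr.max_ideal_iff_ord[OF dvr[OF R], of "E f"] f by simp
  qed
  have le: "(\<Sum>R\<in>S. nat (ord_at R (E f)) * place_degree \<kappa> R) \<le> 3 * degree f" if "finite S" "S \<subseteq> ?Z" for S
  proof (rule sum_ord_degree_le[OF dependent_over_E[OF f] that(1)])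
    show "valuation_ring \<kappa> R \<and> E f \<in> max_ideal R" if "R \<in> S" for R
      using pos[of R] that \<open>S \<subseteq> ?Z\<close> by blast
  qed
  show "(\<Sum>R\<in>S. ord_at R (E f) * int (place_degree \<kappa> R)) \<le> 3 * int (degree f)"
    if S: "finite S" "S \<subseteq> ?Z" for S
  proof -
    have "(\<Sum>R\<in>S. ord_at R (E f) * int (place_degree \<kappa> R)) =
        int (\<Sum>R\<in>S. nat (ord_at R (E f)) * place_degree \<kappa> R)"
      unfolding of_nat_sum
    proof (rule sum.cong)
      fix R assume "R \<in> S"
      then have "ord_at R (E f) > 0" using S pos(2) by blast
      then show "ord_at R (E f) * int (place_degree \<kappa> R) = int (nat (ord_at R (E f)) * place_degree \<kappa> R)" by simp
    qed simp
    then show ?thesis using le[OF S] by linarith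
  qed
  show "finite ?Z"
  proof (rule ccontr)
    assume "infinite ?Z"
    then obtain S where S: "finite S" "card S = Suc (3 * degree f)" "S \<subseteq> ?Z"
      using infinite_arbitrarily_large by blast
    have "(\<Sum>R\<in>S. 1) \<le> (\<Sum>R\<in>S. nat (ord_at R (E f)) * place_degree \<kappa> R)"
    proof (rule sum_mono)
      fix R assume "R \<in> S"
      then have "R \<in> ?Z" using S by blast
      have "nat (ord_at R (E f)) > 0" "place_degree \<kappa> R > 0"
        using pos(2)[OF \<open>R \<in> ?Z\<close>] place_degree_pos[OF pos(1)[OF \<open>R \<in> ?Z\<close>]] by simp_all
      then have "nat (ord_at R (E f)) * place_degree \<kappa> R > 0" by simp
      then show "1 \<le> nat (ord_at R (E f)) * place_degree \<kappa> R" by linarith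
    qed
    then show False using le[OF S(1,3)] S(2) by simp
  qed
qed

lemma zeros_plus_divisor:
  assumes f: "f \<noteq> 0"
  shows "is_divisor \<kappa> (zeros_plus f N)" "divisor_degree \<kappa> (zeros_plus f N) \<le> N + 3 * int (degree f)"
proof -
  let ?Z = "{R. valuation_ring \<kappa> R \<and> R \<noteq> P \<and> ord_at R (E f) \<noteq> 0}"
  have sub: "divisor_support \<kappa> (zeros_plus f N) \<subseteq> insert P ?Z"
    by (auto simp: divisor_support_def zeros_plus_def)
  have fin: "finite (insert P ?Z)" using finite_zero_set(1)[OF f] by simp
  then show "is_divisor \<kappa> (zeros_plus f N)" unfolding is_divisor_def using sub finite_subset by blast
  have "divisor_degree \<kappa> (zeros_plus f N) = (\<Sum>R\<in>insert P ?Z. zeros_plus f N R * int (place_degree \<kappa> R))"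
    by (rule divisor_degree_eq[OF fin sub]) (use P in auto)
  also have "\<dots> = N + (\<Sum>R\<in>?Z. zeros_plus f N R * int (place_degree \<kappa> R))"
    using finite_zero_set(1)[OF f] by (subst sum.insert) (auto simp: zeros_plus_def place_degree_P)
  also have "(\<Sum>R\<in>?Z. zeros_plus f N R * int (place_degree \<kappa> R)) = (\<Sum>R\<in>?Z. ord_at R (E f) * int (place_degree \<kappa> R))"
    by (rule sum.cong) (auto simp: zeros_plus_def)
  also have "\<dots> \<le> 3 * int (degree f)"
    using finite_zero_set(2)[OF f finite_zero_set(1)[OF f]] by blast
  finally show "divisor_degree \<kappa> (zeros_plus f N) \<le> N + 3 * int (degree f)" by simp
qed

lemma zeros_plus_space:
  assumes f: "f \<noteq> 0"
  shows "riemann_roch_space \<kappa> (zeros_plus f N) =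
    (\<lambda>z. z / E f) ` {z \<in> \<O>. P.vge (- (N + 3 * int (degree f))) z}"
proof -
  have 1: "z \<in> riemann_roch_space \<kappa> (zeros_plus f N) \<longleftrightarrow>
      E f * z \<in> {z \<in> \<O>. P.vge (- (N + 3 * int (degree f))) z}" for z
  proof -
    have "dvr.vge R (- ord_at R (E f)) z \<longleftrightarrow> dvr.vge R 0 (E f * z)" if R: "valuation_ring \<kappa> R" for R
    proof -
      interpret dvr R by (rule dvr[OF R])
      show ?thesis using vge_iff_divide[of "E f" "- ord_at R (E f)" "E f * z"] f by simp
    qed
    moreover have "P.vge (- N) z \<longleftrightarrow> P.vge (- (N + 3 * int (degree f))) (E f * z)"
      using P.vge_iff_divide[of "E f" "- N" "E f * z"] f ord_E[OF f] by simp
    ultimately show ?thesis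
      unfolding riemann_roch_space_iff zeros_plus_def mem_Collect_eq integral_iff_vge using P by auto
  qed
  show ?thesis
  proof (intro subset_antisym subsetI)
    fix z assume "z \<in> riemann_roch_space \<kappa> (zeros_plus f N)"
    then show "z \<in> (\<lambda>z. z / E f) ` {z \<in> \<O>. P.vge (- (N + 3 * int (degree f))) z}"
      using 1[of z] f by (intro image_eqI[of _ _ "E f * z"]) auto
  next
    fix z assume "z \<in> (\<lambda>z. z / E f) ` {z \<in> \<O>. P.vge (- (N + 3 * int (degree f))) z}"
    then have "E f * z \<in> {z \<in> \<O>. P.vge (- (N + 3 * int (degree f))) z}" using f by auto
    then show "z \<in> riemann_roch_space \<kappa> (zeros_plus f N)" using 1 by blast
  qed
qed

lemma zeros_plus_dim:
  assumes w: "reduced w" and f: "f \<noteq> 0" and M: "\<And>i. i < 3 \<Longrightarrow> 3 * M + v (w i) \<ge> 0"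
    and N: "N = 3 * (M - int (degree f))"
  shows "finite (riemann_roch_space \<kappa> (zeros_plus f N))"
    and "int (divisor_dim \<kappa> (zeros_plus f N)) = 3 * M + 1 - gap_number w"
proof -
  let ?L = "{z \<in> \<O>. P.vge (- 3 * M) z}" and ?e = "\<Sum>i<3. nat ((3 * M + v (w i)) div 3) + 1"
  have L: "riemann_roch_space \<kappa> (zeros_plus f N) = (\<lambda>z. z / E f) ` ?L"
    unfolding zeros_plus_space[OF f] by (simp add: N algebra_simps)
  show fin: "finite (riemann_roch_space \<kappa> (zeros_plus f N))"
    unfolding L using card_bounded_poles(1)[OF w M] by simp
  have "card (riemann_roch_space \<kappa> (zeros_plus f N)) = card ?L"
    unfolding L using f by (intro card_image) (auto simp: inj_on_def)
  then have "CARD('k) ^ divisor_dim \<kappa> (zeros_plus f N) = CARD('k) ^ ?e"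
    using card_riemann_roch_space[OF fin] card_bounded_poles(2)[OF w M] by simp
  then have "divisor_dim \<kappa> (zeros_plus f N) = ?e" using card_const_gt_1 power_inject_exp by blast
  then show "int (divisor_dim \<kappa> (zeros_plus f N)) = 3 * M + 1 - gap_number w"
    using sum_dimensions[OF _ M] w by (simp add: reduced_def)
qed

lemma polynomial_in_max_ideal:
  assumes R: "valuation_ring \<kappa> R" "R \<noteq> P"
  shows "\<exists>p. p \<noteq> 0 \<and> E p \<in> max_ideal R"
proof -
  interpret dvr R by (rule dvr[OF R(1)])
  obtain z where z: "z \<in> \<mm>" "z \<noteq> 0" using max_ideal_nonzero[OF R(1)] by blast
  obtain c0 c1 c2 c3 where c: "E c0 \<noteq> 0" "E c0 = - z * (E c1 + E c2 * z + E c3 * z ^ 2)"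
    using algebraic[OF disjI1[OF refl] z(2)] unfolding eval_xi by blast
  have x: "\<xi> \<in> R" using R xi_mem_iff by blast
  note E = E_mem[OF R(1) x] and zR = max_ideal_sub[OF z(1)]
  have "- (E c1 + E c2 * z + E c3 * z ^ 2) \<in> R"
    by (rule minus_mem[OF add_mem[OF add_mem[OF E mult_mem[OF E zR]] mult_mem[OF E power_mem[OF zR]]]])
  then have "- (E c1 + E c2 * z + E c3 * z ^ 2) * z \<in> \<mm>" by (rule max_ideal_mult[OF z(1)])
  moreover have "E c0 = - (E c1 + E c2 * z + E c3 * z ^ 2) * z" unfolding c(2) by (simp add: algebra_simps)
  ultimately have "E c0 \<in> \<mm>" by (simp only:)
  then show ?thesis using c(1) by auto
qed

lemma dominating_polynomial:
  assumes S: "finite S" "\<And>R. R \<in> S \<Longrightarrow> valuation_ring \<kappa> R \<and> R \<noteq> P"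
  shows "\<exists>f. f \<noteq> 0 \<and> (\<forall>R\<in>S. D R \<le> ord_at R (E f))"
proof -
  obtain p where p: "\<And>R. R \<in> S \<Longrightarrow> p R \<noteq> 0 \<and> E (p R) \<in> max_ideal R"
    using polynomial_in_max_ideal S(2) by metis
  define f where "f = (\<Prod>R\<in>S. p R ^ nat \<bar>D R\<bar>)"
  have f: "f \<noteq> 0" using p S(1) by (simp add: f_def)
  have "D R \<le> ord_at R (E f)" if R: "R \<in> S" for R
  proof -
    have Rv: "valuation_ring \<kappa> R" "R \<noteq> P" using S(2) R by auto
    interpret dvr R by (rule dvr[OF Rv(1)])
    define g where "g = (\<Prod>R\<in>S - {R}. p R ^ nat \<bar>D R\<bar>)"
    have fg: "f = p R ^ nat \<bar>D R\<bar> * g" unfolding f_def g_def using S(1) R by (rule prod.remove)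
    have g: "g \<noteq> 0" using f fg by auto
    have "ord_at R (E g) \<ge> 0" by (rule zeros_nonneg[OF Rv g])
    moreover have "ord_at R (E (p R)) \<ge> 1" using p[OF R] max_ideal_iff_ord[of "E (p R)"] by simp
    then have "int (nat \<bar>D R\<bar>) * 1 \<le> int (nat \<bar>D R\<bar>) * ord_at R (E (p R))" by (intro mult_left_mono) auto
    moreover have "ord_at R (E f) = int (nat \<bar>D R\<bar>) * ord_at R (E (p R)) + ord_at R (E g)"
      using p[OF R] g unfolding fg by (simp add: E_mult E_power ord_mult ord_power)
    ultimately show ?thesis by linarith
  qed
  then show ?thesis using f by blast
qed

text \<open>
  The value is attained at large multiples of \<open>P\<close>. An arbitrary divisor lies below some divisor
  \<open>zeros_plus f N\<close>, whose degree is at most that of the multiple of \<open>P\<close> with the same dimension.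
\<close>
lemma genus_eq_gap_number:
  assumes w: "reduced w"
  shows "genus \<kappa> = gap_number w"
  unfolding genus_def
proof (rule Greatest_equality)
  define M0 where "M0 = (\<Sum>i<3. \<bar>v (w i)\<bar>)"
  have M0: "3 * M + v (w i) \<ge> 0" if "M \<ge> M0" "i < 3" for i M
  proof -
    have "\<bar>v (w i)\<bar> \<le> M0" unfolding M0_def using that(2) by (intro member_le_sum) auto
    then show ?thesis using that(1) by linarith
  qed
  let ?D = "zeros_plus 1 (3 * M0)"
  have dim: "int (divisor_dim \<kappa> ?D) = 3 * M0 + 1 - gap_number w"
    by (rule zeros_plus_dim(2)[OF w]) (use M0 in auto)
  have one: "ord_at R (E 1) = 0" if "valuation_ring \<kappa> R" for R
    using dvr.ord_1[OF dvr[OF that]] by simp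
  then have "divisor_support \<kappa> ?D \<subseteq> {P}" by (auto simp: divisor_support_def zeros_plus_def)
  then have "divisor_degree \<kappa> ?D = 3 * M0"
    using divisor_degree_eq[of "{P}" ?D] P by (simp add: zeros_plus_def place_degree_P)
  then show "\<exists>D. is_divisor \<kappa> D \<and> gap_number w = divisor_degree \<kappa> D - int (divisor_dim \<kappa> D) + 1"
    using zeros_plus_divisor(1)[of 1 "3 * M0"] dim by (intro exI[of _ ?D]) simp
  fix g assume "\<exists>D. is_divisor \<kappa> D \<and> g = divisor_degree \<kappa> D - int (divisor_dim \<kappa> D) + 1"
  then obtain D where D: "is_divisor \<kappa> D" "g = divisor_degree \<kappa> D - int (divisor_dim \<kappa> D) + 1" by blast
  let ?S = "divisor_support \<kappa> D - {P}"
  obtain f where f: "f \<noteq> 0" "\<And>R. R \<in> ?S \<Longrightarrow> D R \<le> ord_at R (E f)"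
  proof -
    have "finite ?S" using D(1) by (simp add: is_divisor_def)
    moreover have "\<And>R. R \<in> ?S \<Longrightarrow> valuation_ring \<kappa> R \<and> R \<noteq> P" by (simp add: divisor_support_def)
    ultimately have "\<exists>f. f \<noteq> 0 \<and> (\<forall>R\<in>?S. D R \<le> ord_at R (E f))" by (rule dominating_polynomial)
    then show ?thesis using that by blast
  qed
  define M where "M = max M0 (\<bar>D P\<bar> + int (degree f))"
  define N where "N = 3 * (M - int (degree f))"
  have le: "D R \<le> zeros_plus f N R" if R: "valuation_ring \<kappa> R" for R
  proof (cases "R = P")
    case True
    have "\<bar>D P\<bar> + int (degree f) \<le> M" by (simp add: M_def)
    moreover have "D P \<le> \<bar>D P\<bar>" "0 \<le> \<bar>D P\<bar>" by simp_all
    moreover have "a \<le> 3 * (c - e)" if "b + e \<le> c" "a \<le> b" "0 \<le> b" for a b c e :: int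
      using that by simp
    ultimately have "D P \<le> N" unfolding N_def by blast
    then show ?thesis by (simp add: zeros_plus_def True)
  next
    case False
    then show ?thesis using f(2)[of R] R zeros_nonneg[OF R False f(1)]
      by (cases "D R = 0") (auto simp: zeros_plus_def divisor_support_def)
  qed
  have MM: "3 * M + v (w i) \<ge> 0" if "i < 3" for i using M0[OF _ that, of M] by (simp add: M_def)
  note dimN = zeros_plus_dim[OF w f(1) MM N_def]
  have "divisor_degree \<kappa> D - int (divisor_dim \<kappa> D) \<le>
      divisor_degree \<kappa> (zeros_plus f N) - int (divisor_dim \<kappa> (zeros_plus f N))"
    by (rule degree_minus_dim_mono[OF D(1) zeros_plus_divisor(1)[OF f(1)] le dimN(1)])
  also have "\<dots> \<le> N + 3 * int (degree f) - (3 * M + 1 - gap_number w)"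
    using zeros_plus_divisor(2)[OF f(1), of N] dimN(2) by linarith
  finally show "g \<le> gap_number w" using D(2) by (simp add: N_def algebra_simps)
qed

end

section \<open>Trace and discriminant\<close>

context cubic_extension
begin

definition coordinate :: "nat \<Rightarrow> 'f \<Rightarrow> 'k poly fract" where
  "coordinate = (SOME \<gamma>. \<forall>z. z = \<iota> (\<gamma> 0 z) + \<iota> (\<gamma> 1 z) * y + \<iota> (\<gamma> 2 z) * y ^ 2)"

lemma coordinate_sum: "z = \<iota> (coordinate 0 z) + \<iota> (coordinate 1 z) * y + \<iota> (coordinate 2 z) * y ^ 2"
proof -
  have "\<exists>a b c. z = \<iota> a + \<iota> b * y + \<iota> c * y ^ 2" for z
  proof -
    obtain a b c d where d: "d \<noteq> 0" "E d * z = combo a b c" by (rule fractional_form)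
    have "z = combo a b c / E d" using d by (simp add: field_simps)
    then have "z = \<iota> (to_fract a / to_fract d) + \<iota> (to_fract b / to_fract d) * y + \<iota> (to_fract c / to_fract d) * y ^ 2"
      by (simp add: combo_def hom_divide \<iota>_to_fract add_divide_distrib)
    then show ?thesis by blast
  qed
  then obtain a b c where "\<And>z. z = \<iota> (a z) + \<iota> (b z) * y + \<iota> (c z) * y ^ 2" by metis
  then have "\<exists>\<gamma>. \<forall>z. z = \<iota> (\<gamma> (0 :: nat) z) + \<iota> (\<gamma> 1 z) * y + \<iota> (\<gamma> 2 z) * y ^ 2"
    by (intro exI[of _ "\<lambda>i. if i = 0 then a else if i = 1 then b else c"]) simp
  then have "\<forall>z. z = \<iota> (coordinate 0 z) + \<iota> (coordinate 1 z) * y + \<iota> (coordinate 2 z) * y ^ 2"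
    unfolding coordinate_def by (rule someI_ex)
  then show ?thesis by blast
qed

lemma coordinate_eqI:
  assumes "z = \<iota> a + \<iota> b * y + \<iota> c * y ^ 2"
  shows "coordinate 0 z = a" "coordinate 1 z = b" "coordinate 2 z = c"
proof -
  have "\<iota> (coordinate 0 z - a) + \<iota> (coordinate 1 z - b) * y + \<iota> (coordinate 2 z - c) * y ^ 2 = 0"
    using coordinate_sum[of z] assms by (simp add: hom_diff algebra_simps)
  from independent[OF this] show "coordinate 0 z = a" "coordinate 1 z = b" "coordinate 2 z = c" by auto
qed

lemma coordinate_add: "i < 3 \<Longrightarrow> coordinate i (z + w) = coordinate i z + coordinate i w"
proof -
  have "z + w = (\<iota> (coordinate 0 z) + \<iota> (coordinate 1 z) * y + \<iota> (coordinate 2 z) * y ^ 2) +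
      (\<iota> (coordinate 0 w) + \<iota> (coordinate 1 w) * y + \<iota> (coordinate 2 w) * y ^ 2)"
    using coordinate_sum[of z] coordinate_sum[of w] by simp
  also have "\<dots> = \<iota> (coordinate 0 z + coordinate 0 w) + \<iota> (coordinate 1 z + coordinate 1 w) * y +
      \<iota> (coordinate 2 z + coordinate 2 w) * y ^ 2"
    by (simp add: hom_add algebra_simps)
  finally have "z + w = \<dots>" .
  from coordinate_eqI[OF this] show "i < 3 \<Longrightarrow> ?thesis" by (auto simp: numeral_eq_Suc less_Suc_eq)
qed

lemma coordinate_scale: "i < 3 \<Longrightarrow> coordinate i (\<iota> a * z) = a * coordinate i z"
proof -
  have "\<iota> a * z = \<iota> (a * coordinate 0 z) + \<iota> (a * coordinate 1 z) * y + \<iota> (a * coordinate 2 z) * y ^ 2"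
    using arg_cong[OF coordinate_sum[of z], of "(*) (\<iota> a)"] by (simp add: hom_mult algebra_simps)
  from coordinate_eqI[OF this] show "i < 3 \<Longrightarrow> ?thesis" by (auto simp: numeral_eq_Suc less_Suc_eq)
qed

lemma coordinate_sum_linear:
  "i < 3 \<Longrightarrow> coordinate i (\<Sum>b\<in>S. \<iota> (g b) * h b) = (\<Sum>b\<in>S. g b * coordinate i (h b))"
proof (induction S rule: infinite_finite_induct)
  case (infinite S)
  then show ?case using coordinate_scale[of i 0 0] by simp
next
  case empty
  then show ?case using coordinate_scale[of i 0 0] by simp
qed (simp add: coordinate_add coordinate_scale)

lemma power_basis:
  "\<not> module.dependent (scale_by \<iota>) {1, y, y ^ 2}" "module.span (scale_by \<iota>) {1, y, y ^ 2} = UNIV"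
  "card {1, y, y ^ 2} = 3"
proof -
  interpret vs: vector_space "scale_by \<iota>" by (rule vector_space_scale)
  have ne: "1 \<noteq> y" "1 \<noteq> y ^ 2" "y \<noteq> y ^ 2"
    using independent[of 1 "-1" 0] independent[of 1 0 "-1"] independent[of 0 1 "-1"]
    by (auto simp: hom_minus)
  then show "card {1, y, y ^ 2} = 3" by simp
  show "vs.independent {1, y, y ^ 2}"
  proof
    assume "vs.dependent {1, y, y ^ 2}"
    then obtain u where u: "\<exists>x\<in>{1, y, y ^ 2}. u x \<noteq> 0" "(\<Sum>x\<in>{1, y, y ^ 2}. scale_by \<iota> (u x) x) = 0"
      unfolding vs.dependent_finite[of "{1, y, y ^ 2}", simplified] by auto
    have "\<iota> (u 1) + \<iota> (u y) * y + \<iota> (u (y ^ 2)) * y ^ 2 = 0"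
      using u(2) ne by (simp add: scale_by_def add.assoc)
    from independent[OF this] show False using u(1) by auto
  qed
  have "z \<in> vs.span {1, y, y ^ 2}" for z
  proof -
    have "scale_by \<iota> (coordinate 0 z) 1 + scale_by \<iota> (coordinate 1 z) y + scale_by \<iota> (coordinate 2 z) (y ^ 2)
        \<in> vs.span {1, y, y ^ 2}"
      by (intro vs.span_add vs.span_scale vs.span_base) auto
    then show ?thesis using coordinate_sum[of z] by (simp add: scale_by_def)
  qed
  then show "vs.span {1, y, y ^ 2} = UNIV" by blast
qed

lemma ext_degree_3: "ext_degree \<iota> = 3"
proof -
  interpret vs: vector_space "scale_by \<iota>" by (rule vector_space_scale)
  have "vs.span {1, y, y ^ 2} = vs.span UNIV" using power_basis(2) by simp
  then have "vs.dim UNIV = card {1, y, y ^ 2}" using power_basis(1) by (rule vs.dim_eq_card)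
  then show ?thesis unfolding ext_degree_def power_basis(3) .
qed

text \<open>
  The trace of a linear map computed in two bases: both sides equal
  \<open>\<Sum>\<^sub>j \<Sum>\<^sub>b \<gamma>\<^sub>j(b) \<beta>\<^sub>b(z y^j)\<close>, where \<open>\<gamma>\<^sub>j\<close> and \<open>\<beta>\<^sub>b\<close> are the coordinate functions.
\<close>
lemma field_trace_eq:
  "field_trace \<iota> z = coordinate 0 z + coordinate 1 (z * y) + coordinate 2 (z * y ^ 2)"
proof -
  interpret vs: vector_space "scale_by \<iota>" by (rule vector_space_scale)
  define Bs where "Bs = (SOME B. vs.independent B \<and> vs.span B = UNIV)"
  have Bs: "vs.independent Bs" "vs.span Bs = UNIV"
    unfolding Bs_def using someI_ex[of "\<lambda>B. vs.independent B \<and> vs.span B = UNIV"] power_basis(1,2) by blast+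
  have fin: "finite Bs"
    using vs.independent_span_bound[of "{1, y, y ^ 2}" Bs] Bs(1) power_basis(2) by simp
  define \<beta> where "\<beta> b x = vs.representation Bs x b" for b x
  have \<beta>_sum: "x = (\<Sum>b\<in>Bs. \<iota> (\<beta> b x) * b)" for x
    using vs.sum_representation_eq[OF Bs(1) _ fin order_refl, of x] Bs(2)
    by (simp add: \<beta>_def scale_by_def)
  have \<beta>_add: "\<beta> b (x + x') = \<beta> b x + \<beta> b x'" for b x x'
    using vs.representation_add[OF Bs(1), of x' x] Bs(2) by (simp add: \<beta>_def)
  have \<beta>_scale: "\<beta> b (\<iota> a * x) = a * \<beta> b x" for b a x
    using vs.representation_scale[OF Bs(1), of x a] Bs(2) by (simp add: \<beta>_def scale_by_def)
  have summand: "\<beta> b (z * b) = coordinate 0 b * \<beta> b z + coordinate 1 b * \<beta> b (z * y) + coordinate 2 b * \<beta> b (z * y ^ 2)" for b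
  proof -
    have "z * b = \<iota> (coordinate 0 b) * z + \<iota> (coordinate 1 b) * (z * y) + \<iota> (coordinate 2 b) * (z * y ^ 2)"
      using arg_cong[OF coordinate_sum[of b], of "(*) z"] by (simp add: algebra_simps)
    then show ?thesis by (simp add: \<beta>_add \<beta>_scale)
  qed
  have co: "coordinate j x = (\<Sum>b\<in>Bs. coordinate j b * \<beta> b x)" if "j < 3" for j x
  proof -
    have "coordinate j x = coordinate j (\<Sum>b\<in>Bs. \<iota> (\<beta> b x) * b)" using \<beta>_sum[of x] by simp
    then show ?thesis using coordinate_sum_linear[OF that] by (simp add: mult.commute)
  qed
  have "field_trace \<iota> z = (\<Sum>b\<in>Bs. \<beta> b (z * b))"
    unfolding field_trace_def Let_def Bs_def[symmetric] \<beta>_def ..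
  also have "\<dots> = (\<Sum>b\<in>Bs. coordinate 0 b * \<beta> b z) + (\<Sum>b\<in>Bs. coordinate 1 b * \<beta> b (z * y)) +
      (\<Sum>b\<in>Bs. coordinate 2 b * \<beta> b (z * y ^ 2))"
    unfolding summand sum.distrib ..
  also have "\<dots> = coordinate 0 z + coordinate 1 (z * y) + coordinate 2 (z * y ^ 2)"
    using co[of 0 z] co[of 1 "z * y"] co[of 2 "z * y ^ 2"] by simp
  finally show ?thesis .
qed

lemma trace_add: "field_trace \<iota> (z + w) = field_trace \<iota> z + field_trace \<iota> w"
  by (simp add: field_trace_eq distrib_right coordinate_add)

lemma trace_scale: "field_trace \<iota> (\<iota> a * z) = a * field_trace \<iota> z"
  by (simp add: field_trace_eq mult.assoc coordinate_scale distrib_left)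

lemma trace_sum: "field_trace \<iota> (\<Sum>i\<in>S. \<iota> (g i) * h i) = (\<Sum>i\<in>S. g i * field_trace \<iota> (h i))"
proof (induction S rule: infinite_finite_induct)
  case (infinite S)
  then show ?case using trace_scale[of 0 0] by simp
next
  case empty
  then show ?case using trace_scale[of 0 0] by simp
qed (simp add: trace_add trace_scale)

lemma discriminant_change_basis:
  fixes b b' :: "'f ^ 3" and M :: "'k poly fract ^ 3 ^ 3"
  assumes b': "\<And>i. b' $ i = (\<Sum>j\<in>UNIV. \<iota> (M $ i $ j) * b $ j)"
  shows "discriminant \<iota> b' = det M ^ 2 * discriminant \<iota> b"
proof -
  let ?T = "\<lambda>b :: 'f ^ 3. \<chi> i j. field_trace \<iota> (b $ i * b $ j)"
  have "?T b' = M ** (?T b ** transpose M)"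
  proof (rule vec_eq_iff[THEN iffD2], intro allI, rule vec_eq_iff[THEN iffD2], intro allI)
    fix i j
    have "b' $ i * b' $ j = (\<Sum>k\<in>UNIV. \<iota> (M $ i $ k) * (\<Sum>l\<in>UNIV. \<iota> (M $ j $ l) * (b $ k * b $ l)))"
      unfolding b'[of i] sum_distrib_right
      by (intro sum.cong refl) (simp add: b'[of j] sum_distrib_left mult_ac)
    then show "?T b' $ i $ j = (M ** (?T b ** transpose M)) $ i $ j"
      by (simp add: trace_sum matrix_matrix_mult_def transpose_def mult.commute)
  qed
  then have "discriminant \<iota> b' = det (M ** (?T b ** transpose M))" by (simp add: discriminant_def)
  also have "\<dots> = det M * (discriminant \<iota> b * det M)"
    by (simp only: det_mul det_transpose discriminant_def)
  finally show ?thesis by (simp add: power2_eq_square)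
qed

end

context ramified_cubic
begin

text \<open>
  The traces of \<open>1, y, y\<^sup>2, y\<^sup>3\<close> are \<open>0, 0, 2A, 0\<close>, so the determinant of the trace form is \<open>-(2A)\<^sup>3\<close>.
\<close>
lemma discriminant_powers_nonzero:
  assumes A: "A \<noteq> 0"
  shows "discriminant \<iota> (vector [1, y, y ^ 2] :: 'f ^ 3) \<noteq> 0"
proof -
  let ?A = "to_fract A" and ?B = "to_fract B"
  have three: "(3 :: 'k poly fract) = 0"
  proof -
    have "(3 :: 'k poly) = [:3:]" by (simp add: numeral_poly)
    then have "(3 :: 'k poly) = 0" using char3 by simp
    moreover have "(3 :: 'k poly fract) = to_fract (1 + 1 + 1)" by (simp only: to_fract_add to_fract_1) simp
    moreover have "(1 + 1 + 1 :: 'k poly) = 3" by simp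
    ultimately show ?thesis by (metis to_fract_0)
  qed
  have pow: "y ^ 3 = \<iota> (- ?B) + \<iota> ?A * y + \<iota> 0 * y ^ 2"
    by (simp add: y3 hom_minus \<iota>_to_fract)
  have y4: "y ^ 4 = \<iota> 0 + \<iota> (- ?B) * y + \<iota> ?A * y ^ 2"
  proof -
    have "y ^ 4 = y * y ^ 3" by (simp add: numeral_eq_Suc)
    then show ?thesis by (simp add: y3 hom_minus \<iota>_to_fract power2_eq_square algebra_simps)
  qed
  have y5: "y ^ 5 = \<iota> (- (?A * ?B)) + \<iota> (?A ^ 2) * y + \<iota> (- ?B) * y ^ 2"
  proof -
    have "y ^ 5 = y ^ 2 * y ^ 3" by (simp flip: power_add)
    also have "\<dots> = E A * (y ^ 2 * y) - E B * y ^ 2" unfolding y3 by (simp add: algebra_simps)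
    also have "y ^ 2 * y = y ^ 3" by (simp add: numeral_eq_Suc)
    finally show ?thesis
      by (simp add: y3 hom_minus hom_mult hom_power \<iota>_to_fract power2_eq_square algebra_simps)
  qed
  have y6: "y ^ 6 = \<iota> (?B ^ 2) + \<iota> (- (2 * ?A * ?B)) * y + \<iota> (?A ^ 2) * y ^ 2"
  proof -
    have "y ^ 6 = (y ^ 3) ^ 2" by (simp flip: power_mult)
    also have "\<dots> = E B ^ 2 - 2 * E A * E B * y + E A ^ 2 * y ^ 2"
      unfolding y3 by (simp add: power2_eq_square algebra_simps)
    finally have "y ^ 6 = E B ^ 2 - 2 * E A * E B * y + E A ^ 2 * y ^ 2" .
    moreover have "\<iota> 2 = (2 :: 'f)" using hom_add[of 1 1] by simp
    ultimately show ?thesis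
      by (simp add: hom_minus hom_mult hom_power \<iota>_to_fract algebra_simps)
  qed
  have y0: "1 = \<iota> 1 + \<iota> 0 * y + \<iota> 0 * y ^ 2" and y1: "y = \<iota> 0 + \<iota> 1 * y + \<iota> 0 * y ^ 2"
    and y2: "y ^ 2 = \<iota> 0 + \<iota> 0 * y + \<iota> 1 * y ^ 2" by simp_all
  note co = coordinate_eqI[OF y0] coordinate_eqI[OF y1] coordinate_eqI[OF y2] coordinate_eqI[OF pow]
    coordinate_eqI[OF y4] coordinate_eqI[OF y5] coordinate_eqI[OF y6]
  have yy: "y * y = y ^ 2" "y * y ^ 2 = y ^ 3" "y ^ 2 * y = y ^ 3" "y ^ 3 * y = y ^ 4" "y ^ 2 * y ^ 2 = y ^ 4"
    "y ^ 3 * y ^ 2 = y ^ 5" "y ^ 4 * y = y ^ 5" "y ^ 4 * y ^ 2 = y ^ 6"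
    by (simp_all add: numeral_eq_Suc)
  have T0: "field_trace \<iota> 1 = 0" using three by (simp add: field_trace_eq co del: One_nat_def)
  have T1: "field_trace \<iota> y = 0" by (simp add: field_trace_eq yy co del: One_nat_def)
  have T2: "field_trace \<iota> (y ^ 2) = 2 * ?A" by (simp add: field_trace_eq yy co del: One_nat_def)
  have T3: "field_trace \<iota> (y ^ 3) = 0"
  proof -
    have "field_trace \<iota> (y ^ 3) = - (3 * ?B)" by (simp add: field_trace_eq yy co del: One_nat_def)
    then show ?thesis using three by simp
  qed
  have "discriminant \<iota> (vector [1, y, y ^ 2] :: 'f ^ 3) = - (2 * ?A * (2 * ?A) * (2 * ?A))"
    unfolding discriminant_def det_3 by (simp add: yy T0 T1 T2 T3)
  moreover have "(2 :: 'k poly fract) \<noteq> 0"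
  proof
    assume "(2 :: 'k poly fract) = 0"
    then have "(3 :: 'k poly fract) - 2 = 0" using three by simp
    then show False by simp
  qed
  then have "2 * ?A \<noteq> 0" using A by simp
  ultimately show ?thesis by (simp only: neg_equal_0_iff_equal mult_eq_0_iff) blast
qed

end

context index_cubic
begin

text \<open>
  The matrix expressing \<open>1, y, y^2\<close> in a reduced basis has its largest entries, measured by pole
  orders, on the diagonal, so its determinant has the degree of the diagonal product. It differs
  from the matrix for an integral basis by a unimodular factor.
\<close>
lemma degree_index:
  assumes w: "reduced w"
    and I: "discriminant \<iota> (vector [1, y, y ^ 2] :: 'f ^ 3) = to_fract I ^ 2 * discriminant \<iota> bas"
  shows "gap_number w = int (degree B) - int (degree I) - 1"
proof -
  define pw :: "'f ^ 3" where "pw = vector [1, y, y ^ 2]"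
  define W :: "'f ^ 3" where "W = vector [w 0, w 1, w 2]"
  have gr: "graded w" using w by (simp add: reduced_def)
  have WO: "W $ i \<in> \<O>" for i
  proof -
    have "\<forall>i. W $ i \<in> \<O>" unfolding forall_3 W_def using w by (simp add: reduced_def)
    then show ?thesis by blast
  qed
  have pwO: "pw $ i \<in> \<O>" for i
  proof -
    have "\<forall>i. pw $ i \<in> \<O>" unfolding forall_3 pw_def
      using integral_closure_E[of 1] y_integral integral_closure_power[OF y_integral, of 2] by simp
    then show ?thesis by blast
  qed
  have in_bas: "\<exists>c :: 'k poly ^ 3. z = (\<Sum>j\<in>UNIV. E (c $ j) * bas $ j)" if "z \<in> \<O>" for z
    using basis that unfolding integral_basis_def by blast
  have in_W: "\<exists>c :: 'k poly ^ 3. z = (\<Sum>j\<in>UNIV. E (c $ j) * W $ j)" if z: "z \<in> \<O>" for z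
  proof -
    obtain c where "z = (\<Sum>i<3. E (c i) * w i)" using reduced_spans[OF w z] by blast
    then have "z = (\<Sum>j\<in>UNIV. E ((vector [c 0, c 1, c 2] :: 'k poly ^ 3) $ j) * W $ j)"
      by (simp add: sum_below_3 sum_3 W_def)
    then show ?thesis by blast
  qed
  have W_unique: "c = d" if eq: "(\<Sum>j\<in>UNIV. E (c $ j) * W $ j) = (\<Sum>j\<in>UNIV. E (d $ j) * W $ j)"
    for c d :: "'k poly ^ 3"
  proof -
    let ?f = "\<lambda>(c :: 'k poly ^ 3) i. c $ (if i = 0 then 1 else if i = 1 then 2 else (3 :: 3))"
    have sums: "(\<Sum>i<3. E (?f c i) * w i) = (\<Sum>j\<in>UNIV. E (c $ j) * W $ j)" for c
      by (simp add: sum_below_3 sum_3 W_def)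
    have "?f c i = ?f d i" if "i < 3" for i :: nat
      by (rule graded_unique[OF gr _ that]) (simp only: sums eq)
    from this[of 0] this[of 1] this[of 2] show ?thesis by (simp add: vec_eq_iff forall_3)
  qed
  have "\<exists>M :: 'k poly ^ 3 ^ 3. \<forall>i. b $ i = (\<Sum>j\<in>UNIV. E (M $ i $ j) * b' $ j)"
    if ex: "\<And>i. \<exists>c :: 'k poly ^ 3. b $ i = (\<Sum>j\<in>UNIV. E (c $ j) * b' $ j)" for b b' :: "'f ^ 3"
  proof -
    obtain c :: "3 \<Rightarrow> 'k poly ^ 3" where "\<And>i. b $ i = (\<Sum>j\<in>UNIV. E (c i $ j) * b' $ j)"
      using ex by metis
    then show ?thesis by (intro exI[of _ "\<chi> i. c i"]) simp
  qed
  note matrix = this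
  obtain M :: "'k poly ^ 3 ^ 3" where M: "\<And>i. pw $ i = (\<Sum>j\<in>UNIV. E (M $ i $ j) * bas $ j)"
    using matrix[of pw bas, OF in_bas[OF pwO]] by blast
  have basO: "bas $ i \<in> \<O>" for i using basis unfolding integral_basis_def by blast
  obtain U :: "'k poly ^ 3 ^ 3" where U: "\<And>i. bas $ i = (\<Sum>j\<in>UNIV. E (U $ i $ j) * W $ j)"
    using matrix[of bas W, OF in_W[OF basO]] by blast
  obtain V :: "'k poly ^ 3 ^ 3" where V: "\<And>i. W $ i = (\<Sum>j\<in>UNIV. E (V $ i $ j) * bas $ j)"
    using matrix[of W bas, OF in_bas[OF WO]] by blast
  have comp: "(\<Sum>j\<in>UNIV. E (N $ i $ j) * bas $ j) = (\<Sum>j\<in>UNIV. E ((N ** U) $ i $ j) * W $ j)"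
    for N :: "'k poly ^ 3 ^ 3" and i
  proof -
    have "(\<Sum>j\<in>UNIV. E (N $ i $ j) * bas $ j) = (\<Sum>j\<in>UNIV. \<Sum>k\<in>UNIV. E (N $ i $ j * U $ j $ k) * W $ k)"
      unfolding U sum_distrib_left by (simp add: E_mult mult.assoc)
    also have "\<dots> = (\<Sum>k\<in>UNIV. \<Sum>j\<in>UNIV. E (N $ i $ j * U $ j $ k) * W $ k)" by (rule sum.swap)
    finally show ?thesis by (simp add: matrix_matrix_mult_def E_sum sum_distrib_right)
  qed
  have "V ** U = mat 1"
  proof -
    have "(V ** U) $ i = mat 1 $ i" for i
    proof (rule W_unique)
      have "(\<Sum>j\<in>UNIV. E ((V ** U) $ i $ j) * W $ j) = W $ i" using V[of i] comp[of V i] by simp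
      also have "W $ i = (\<Sum>j\<in>UNIV. if i = j then W $ j else 0)" by simp
      also have "\<dots> = (\<Sum>j\<in>UNIV. E ((mat 1 :: 'k poly ^ 3 ^ 3) $ i $ j) * W $ j)"
        by (rule sum.cong) (auto simp: mat_def)
      finally show "(\<Sum>j\<in>UNIV. E ((V ** U) $ i $ j) * W $ j) =
          (\<Sum>j\<in>UNIV. E ((mat 1 :: 'k poly ^ 3 ^ 3) $ i $ j) * W $ j)" .
    qed
    then show ?thesis by (simp add: vec_eq_iff)
  qed
  then have VU: "det V * det U = 1" by (metis det_I det_mul)
  then have U0: "det U \<noteq> 0" "degree (det U) = 0"
  proof -
    show "det U \<noteq> 0" using VU by auto
    have "det V \<noteq> 0" using VU by auto
    then have "degree (det V) + degree (det U) = 0"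
      using arg_cong[OF VU, of degree] \<open>det U \<noteq> 0\<close> by (simp add: degree_mult_eq)
    then show "degree (det U) = 0" by simp
  qed
  \<comment> \<open>the index is the determinant of \<open>M\<close>, up to sign\<close>
  have detM: "det (\<chi> i j. to_fract (M $ i $ j)) = to_fract (det M)"
    by (simp add: det_3)
  have "discriminant \<iota> pw = det (\<chi> i j. to_fract (M $ i $ j)) ^ 2 * discriminant \<iota> bas"
    by (rule discriminant_change_basis) (simp add: M \<iota>_to_fract)
  moreover have "discriminant \<iota> pw \<noteq> 0" unfolding pw_def by (rule discriminant_powers_nonzero[OF A_nonzero])
  ultimately have "to_fract (det M) ^ 2 = to_fract I ^ 2" "to_fract I \<noteq> 0"
    using I unfolding detM pw_def by auto
  then have "to_fract (det M) = to_fract I \<or> to_fract (det M) = to_fract (- I)"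
    by (simp add: power2_eq_iff)
  then have "det M = I \<or> det M = - I" by (simp only: to_fract_eq_iff)
  then have degM: "degree (det M) = degree I" "det M \<noteq> 0" using \<open>to_fract I \<noteq> 0\<close> by auto
  define N where "N = M ** U"
  have N: "pw $ i = (\<Sum>j\<in>UNIV. E (N $ i $ j) * W $ j)" for i
    using M[of i] comp[of M i] by (simp add: N_def)
  have detN: "degree (det N) = degree I"
    unfolding N_def det_mul using U0 degM by (simp add: degree_mult_eq)
  \<comment> \<open>off the diagonal the residue classes modulo 3 exclude equality in the degree bounds\<close>
  define ix :: "nat \<Rightarrow> 3" where "ix i = (if i = 0 then 1 else if i = 1 then 2 else 3)" for i
  define n where "n i j = N $ ix i $ ix j" for i j
  have row: "y ^ i = (\<Sum>j<3. E (n i j) * w j)" if "i < 3" for i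
  proof -
    have "pw $ ix i = y ^ i" using that by (auto simp: pw_def ix_def numeral_eq_Suc less_Suc_eq)
    then show ?thesis using N[of "ix i"] by (simp add: sum_below_3 sum_3 n_def ix_def W_def)
  qed
  have le: "3 * int (degree (n i j)) \<le> int i * int (degree B) + v (w j)" if "i < 3" "j < 3" "n i j \<noteq> 0" for i j
    using graded_sum(2)[where c = "n i", OF gr that(2,3)] row[OF that(1)] ord_y_power[of i] by simp
  have strict: "3 * int (degree (n i j)) < int i * int (degree B) + v (w j)"
    if ij: "i < 3" "j < 3" "n i j \<noteq> 0" "i \<noteq> j" for i j
  proof -
    have "3 * int (degree (n i j)) \<noteq> int i * int (degree B) + v (w j)"
    proof
      assume eq: "3 * int (degree (n i j)) = int i * int (degree B) + v (w j)"
      have "3 dvd v (w j) + int j * int (degree B)" using gr ij by (simp add: graded_def)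
      then have "3 dvd int i * int (degree B) - int j * int (degree B)" using eq by presburger
      then have "3 dvd (int i - int j) * int (degree B)" by (simp add: left_diff_distrib)
      then show False using residue_injective[OF ij(1,2)] ij(4) by blast
    qed
    then show ?thesis using le[OF ij(1-3)] by linarith
  qed
  have diag: "n i i \<noteq> 0 \<and> 3 * int (degree (n i i)) = int i * int (degree B) + v (w i)" if i: "i < 3" for i
  proof -
    have "\<exists>j<3. n i j \<noteq> 0"
    proof (rule ccontr)
      assume "\<not> ?thesis"
      then have "(\<Sum>j<3. E (n i j) * w j) = 0" by (intro sum.neutral) auto
      then show False using row[OF i] y_nonzero by simp
    qed
    then obtain k where "k < 3" "n i k \<noteq> 0" by blast
    from graded_sum(3)[where c = "n i", OF gr this] obtain j where
      j: "j < 3" "n i j \<noteq> 0" "v (y ^ i) = v (w j) - 3 * int (degree (n i j))"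
      using row[OF i] by auto
    then have "3 * int (degree (n i j)) = int i * int (degree B) + v (w j)"
      by (simp add: ord_y_power)
    moreover from this have "j = i" using strict[OF i j(1,2)] by fastforce
    ultimately show ?thesis using j(2) by simp
  qed
  let ?p = "n 0 0 * n 1 1 * n 2 2"
  define b where "b = int (degree B)"
  have d: "n 0 0 \<noteq> 0" "n 1 1 \<noteq> 0" "n 2 2 \<noteq> 0" "3 * int (degree (n 0 0)) = v (w 0)"
    "3 * int (degree (n 1 1)) = b + v (w 1)" "3 * int (degree (n 2 2)) = 2 * b + v (w 2)"
    using diag[of 0] diag[of 1] diag[of 2] by (simp_all add: b_def)
  have p: "?p \<noteq> 0" "3 * int (degree ?p) = 3 * b + v (w 0) + v (w 1) + v (w 2)"
    using d by (simp_all add: degree_mult_eq)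
  define small :: "'k poly \<Rightarrow> bool" where "small q \<longleftrightarrow> q = 0 \<or> degree q < degree ?p" for q
  have small_add: "small q \<Longrightarrow> small r \<Longrightarrow> small (q + r)" and small_minus: "small q \<Longrightarrow> small (- q)" for q r :: "'k poly"
    unfolding small_def using degree_add_less by auto
  have small_mult: "small (n 0 i * n 1 j * n 2 k)"
    if ijk: "i < 3" "j < 3" "k < 3" "{i, j, k} = {0, 1, 2}" "i \<noteq> 0 \<or> j \<noteq> 1 \<or> k \<noteq> 2" for i j k
  proof (cases "n 0 i = 0 \<or> n 1 j = 0 \<or> n 2 k = 0")
    case False
    then have nz: "n 0 i \<noteq> 0" "n 1 j \<noteq> 0" "n 2 k \<noteq> 0" by auto
    have l: "3 * int (degree (n 0 i)) \<le> v (w i)" "3 * int (degree (n 1 j)) \<le> b + v (w j)"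
      "3 * int (degree (n 2 k)) \<le> 2 * b + v (w k)"
      using le[of 0 i] le[of 1 j] le[of 2 k] ijk nz by (simp_all add: b_def)
    have "i \<noteq> 0 \<Longrightarrow> 3 * int (degree (n 0 i)) < v (w i)" "j \<noteq> 1 \<Longrightarrow> 3 * int (degree (n 1 j)) < b + v (w j)"
      "k \<noteq> 2 \<Longrightarrow> 3 * int (degree (n 2 k)) < 2 * b + v (w k)"
      using strict[of 0 i] strict[of 1 j] strict[of 2 k] ijk nz by (simp_all add: b_def)
    then have lt: "3 * int (degree (n 0 i * n 1 j * n 2 k)) < 3 * b + (v (w i) + v (w j) + v (w k))"
      using l nz ijk(5) by (auto simp: degree_mult_eq)
    have "v (w i) + v (w j) + v (w k) = v (w 0) + v (w 1) + v (w 2)"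
    proof -
      have dist: "i \<noteq> j \<and> j \<noteq> k \<and> i \<noteq> k"
      proof (rule ccontr)
        assume "\<not> ?thesis"
        then have "card {i, j, k} \<le> 2" by (auto simp: card_insert_if)
        moreover have "card {0, 1, 2 :: nat} = 3" by simp
        ultimately show False using ijk(4) by simp
      qed
      have "(\<Sum>x\<in>{i, j, k}. v (w x)) = (\<Sum>x\<in>{0, 1, 2}. v (w x))" by (simp only: ijk(4))
      then show ?thesis using dist by simp
    qed
    then show ?thesis using lt p(2) unfolding small_def by linarith
  qed (auto simp: small_def)
  let ?r = "n 0 1 * n 1 2 * n 2 0 + n 0 2 * n 1 0 * n 2 1 + (- (n 0 0 * n 1 2 * n 2 1) +
      (- (n 0 1 * n 1 0 * n 2 2) + - (n 0 2 * n 1 1 * n 2 0)))"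
  have "det N = ?p + ?r"
    unfolding det_3 n_def ix_def by (simp add: algebra_simps)
  moreover have "small ?r"
    by (intro small_add small_minus small_mult) auto
  ultimately have "degree (det N) = degree ?p"
    unfolding small_def using degree_add_eq_left by fastforce
  then have "3 * int (degree I) = 3 * int (degree B) + v (w 0) + v (w 1) + v (w 2)"
    using detN p(2) by (simp add: b_def)
  then show ?thesis using gap_number_eq[OF gr] by linarith
qed

end


section \<open>Genus and index\<close>

text \<open>
  If a cubic over \<open>k[x]\<close> has a root \<open>r\<close> in \<open>k(x)\<close>, then \<open>r\<close> lies in \<open>k[x]\<close>: the denominators of
  the ring \<open>k[x][r]\<close> form an ideal stable under \<open>r\<close>, and a generator \<open>g\<close> of it divides \<open>r g\<close>.
\<close>
lemma rational_root_is_polynomial: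
  fixes A B :: "'k :: field poly"
  assumes r: "r ^ 3 - to_fract A * r + to_fract B = 0"
  shows "\<exists>s. r = to_fract s"
proof -
  define J where "J = {c. \<exists>a b. to_fract c * r = to_fract a \<and> to_fract c * r ^ 2 = to_fract b}"
  have r3: "r ^ 3 = to_fract A * r - to_fract B" using r by (simp add: algebra_simps eq_neg_iff_add_eq_0)
  obtain n d :: "'k poly" where nd: "r = to_fract n / to_fract d" "d \<noteq> 0"
    by (cases r) (auto simp: Fract_conv_to_fract)
  have "to_fract (d ^ 2) * r = to_fract (n * d)" "to_fract (d ^ 2) * r ^ 2 = to_fract (n ^ 2)"
    using nd by (auto simp: power2_eq_square)
  then have "d ^ 2 \<in> J" unfolding J_def by blast
  then have "\<exists>c. c \<in> J \<and> c \<noteq> 0" using nd(2) by (intro exI[of _ "d ^ 2"]) simp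
  then obtain g where g: "g \<in> J" "g \<noteq> 0" and min: "\<And>c. c \<in> J \<Longrightarrow> c \<noteq> 0 \<Longrightarrow> degree g \<le> degree c"
    using ex_has_least_nat[of "\<lambda>c. c \<in> J \<and> c \<noteq> 0" _ degree] by metis
  obtain a b where ab: "to_fract g * r = to_fract a" "to_fract g * r ^ 2 = to_fract b"
    using g(1) unfolding J_def by blast
  have "to_fract a * r = to_fract b" unfolding ab(1)[symmetric] ab(2)[symmetric] by (simp add: power2_eq_square mult.assoc)
  moreover have "to_fract a * r ^ 2 = to_fract (A * a - B * g)"
  proof -
    have "to_fract a * r ^ 2 = to_fract g * r ^ 3"
      unfolding ab(1)[symmetric] by (simp add: power2_eq_square power3_eq_cube mult_ac)
    also have "\<dots> = to_fract A * (to_fract g * r) - to_fract B * to_fract g"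
      unfolding r3 by (simp add: algebra_simps)
    finally show ?thesis by (simp add: ab(1))
  qed
  ultimately have aJ: "to_fract (a - q * g) * r = to_fract (b - q * a) \<and>
      to_fract (a - q * g) * r ^ 2 = to_fract (A * a - B * g - q * b)" for q
    using ab by (simp add: left_diff_distrib mult.assoc)
  have "a mod g \<in> J"
    using aJ[of "a div g"] unfolding J_def minus_div_mult_eq_mod by blast
  then have "a mod g = 0"
    using min[of "a mod g"] degree_mod_less[OF g(2), of a] by force
  then obtain s where "a = g * s" by auto
  then have "to_fract g * r = to_fract g * to_fract s" using ab(1) by simp
  then have "r = to_fract s" using g(2) by simp
  then show ?thesis by blast
qed

lemma map_poly_to_ac_mult: "map_poly to_ac (p * q) = map_poly to_ac p * map_poly to_ac (q :: 'k :: field poly)"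
  by (rule poly_eqI) (simp add: coeff_map_poly coeff_mult to_ac_sum)

lemma absolutely_irreducible_no_root:
  assumes irr: "absolutely_irreducible (cubic_poly A B)"
  shows "r ^ 3 - to_fract A * r + to_fract B \<noteq> (0 :: 'k :: field poly fract)"
proof
  assume r: "r ^ 3 - to_fract A * r + to_fract B = 0"
  then obtain s where s: "r = to_fract s" using rational_root_is_polynomial by blast
  have "to_fract (s * s * s - A * s + B) = 0" using r by (simp add: s power3_eq_cube mult.assoc)
  then have "s * s * s - A * s + B = 0" by (simp only: to_fract_eq_0_iff)
  then have B: "B = A * s - s * s * s" by (simp add: algebra_simps eq_neg_iff_add_eq_0)
  let ?m = "map_poly to_ac :: 'k poly \<Rightarrow> 'k alg_closure poly"
  have add: "?m (p - q) = ?m p - ?m q" for p q by (rule poly_eqI) (simp add: coeff_map_poly)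
  have "map_poly ?m (cubic_poly A B) = [:?m B, ?m (- A), 0, 1:]"
    by (simp add: cubic_poly_def map_poly_pCons)
  also have "\<dots> = [:- ?m s, 1:] * [:?m s * ?m s - ?m A, ?m s, 1:]"
    using add[of 0 A] by (simp add: B add map_poly_to_ac_mult algebra_simps)
  finally have "[:- ?m s, 1:] dvd 1 \<or> [:?m s * ?m s - ?m A, ?m s, 1:] dvd 1"
    using irr unfolding absolutely_irreducible_def irreducible_def by blast
  then show False by (auto simp: is_unit_poly_iff)
qed

lemma char_3_of_card:
  assumes "CARD('k :: {field, finite}) = 3 ^ m"
  shows "(3 :: 'k) = 0"
proof -
  have "CHAR('k) dvd 3 ^ m" using CHAR_dvd_CARD[where 'a = 'k] assms by simp
  then obtain j where j: "CHAR('k) = 3 ^ j" using divides_primepow_nat[of 3 "CHAR('k)" m] by auto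
  have "prime CHAR('k)" by (rule prime_CHAR_semidom) (simp add: finite_imp_CHAR_pos)
  then have "CHAR('k) = 3" using j by (metis One_nat_def not_prime_1 power_0 power_one_right prime_power_iff)
  then have "of_nat 3 = (0 :: 'k)" using of_nat_eq_0_iff_char_dvd[of 3, where 'a = 'k] by simp
  then show ?thesis by simp
qed

theorem theorem5p2:
  fixes A B I :: "'k :: {field, finite} poly"
    and \<iota> :: "'k poly fract \<Rightarrow> 'f :: field"
    and y :: 'f
    and m :: nat
  assumes "CARD('k) = 3 ^ m"
    and "A \<noteq> 0"
    and "absolutely_irreducible (cubic_poly A B)"
    and "field_hom \<iota>"
    and "y ^ 3 - emb_poly \<iota> A * y + emb_poly \<iota> B = 0"
    and "generated_by \<iota> y"
    and "standard_form A B"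
    and "is_index \<iota> y I"
    and "totally_ramified \<iota> infinite_place"
  shows "genus (emb_const \<iota>) =
    int (Polynomial.degree B) - int (Polynomial.degree I) - 1"
proof -
  interpret cubic_extension \<iota> A B y
    by unfold_locales (use assms absolutely_irreducible_no_root in auto)
  obtain P where P: "valuation_ring \<kappa> P" "\<iota> -` P = infinite_place" "ramification_index \<iota> P = 3"
    using assms(9) unfolding totally_ramified_def ext_degree_3 by auto
  interpret ramified_cubic \<iota> A B y P
    by unfold_locales (use P char_3_of_card[OF assms(1)] in auto)
  have "2 * degree B > 3 * degree A"
    using ord_y_bound[OF assms(2)] ord_y[OF assms(2)] by linarith
  then have B: "\<not> 3 dvd degree B"
    using assms(7) unfolding standard_form_def by linarith
  obtain bas :: "'f ^ 3" where bas: "integral_basis \<iota> bas"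
    "discriminant \<iota> (vector [1, y, y ^ 2] :: 'f ^ 3) = to_fract I ^ 2 * discriminant \<iota> bas"
    using assms(8) unfolding is_index_def by blast
  interpret index_cubic \<iota> A B y P bas
    by unfold_locales (use assms(2) B bas(1) in auto)
  obtain w where w: "reduced w" using reduced_exists by blast
  show ?thesis using genus_eq_gap_number[OF w] degree_index[OF w bas(2)] by simp
qed

end
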